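(* Let $\tau>0$ and consider the Hammersley process with sources of intensity $\tau$, sinks of intensity $\tau$ and $\alpha$-points of intensity $\tau^2$. Let $O^{(\tau)}$ be the region in the plane enclosed by the trajectories $(X_\tau(t),t)$ and $(X'_\tau(t),t)$ of a second class particle and a dual second class particle starting in the origin, until their first intersection point. Fix $x,t>0$ and let $\mathrm{Area}$ denote Lebesgue measure on the plane. Then $$\mathbb{E}\,\mathrm{Area}\big(O^{(\tau)}\cap([0,x]\times[0,t])\big)=\frac{x+t}{2\tau}-\frac{1}{2\tau}\Big(\mathbb{E}\,(x-X_\tau(t))_+ +\mathbb{E}\,(t-X_\tau(x))_+\Big).$$
   Context: Hammersley process with sources and sinks. Take three independent homogeneous Poisson processes: a process of "sources" on the positive $x$-axis $(0,\infty)\times\{0\}$ with intensity $\tau$, a process of "sinks" on the positive $t$-axis $\{0\}\times(0,\infty)$ with intensity $\tau$, and a process of "$\alpha$-points" in $(0,\infty)^2$ with intensity $\tau^2$ (with respect to Lebesgue measure). The vertical coordinate $t$ is time. The Hammersley process is the evolving (locally finite) particle configuration $\eta_t$ on $(0,\infty)$ defined as follows. At time $0$ the particles are located at the sources. When an $\alpha$-point $(u,s)$ occurs, the particle immediately to the right of $u$ jumps at time $s$ to $u$. When a sink $(0,s)$ occurs, the leftmost particle disappears at time $s$ (it exits through the $t$-axis). Nothing else changes. This is well defined because for each $R>0$ the restriction of $\eta_t$ to $(0,R]$ evolves autonomously: at an $\alpha$-point $(u,s)$ with $u\le R$, the leftmost particle in $(u,R]$, if any, is removed and a particle is put at $u$;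 at a sink, the leftmost particle in $(0,R]$, if any, is removed; these restrictions are consistent as $R$ varies. Second class particle. It is created by putting an extra source at the origin: let $\eta^+_t$ be the configuration on $[0,\infty)$ evolving by the same rules with the same sources, sinks and $\alpha$-points, but with one additional particle at $0$ at time $0$. Almost surely, for all $t$, $\eta^+_t$ consists of the particles of $\eta_t$ plus exactly one more particle, whose location is $X_\tau(t)$. Equivalently, $X_\tau(0)=0$, and $X_\tau$ stays constant except that whenever a particle of $\eta$ at a position $y>X_\tau(s-)$ jumps at time $s$ to a position $u<X_\tau(s-)$ or exits through a sink, $X_\tau(s)=y$. Dual second class particle. It is created by putting an extra sink at the origin, i.e. removing the leftmost particle at time $0$: let $\eta^-_t$ evolve by the same rules with the same sinks and $\alpha$-points, but started from the sources with the leftmost source removed. Almost surely, for all $t$, $\eta_t$ consists of the particles of $\eta^-_t$ plus exactly one more particle, whose location is $X'_\tau(t)$. Equivalently, $X'_\tau(0)$ is the position of the leftmost source, and whenever the particle of $\eta$ sitting at $X'_\tau(s-)$ jumps or exits through a sink at time $s$, $X'_\tau(s)$ is the position of the next particle of $\eta$ to the right. Both particles use the same realization. Trajectories are regarded as staircase curves in the plane including horizontal jump segments; one has $X_\tau(t)\le X'_\tau(t)$. The first intersection point (other than the origin) occurs at time $T=\inf\{s>0: X_\tau(s)=X'_\tau(s-)\}$, which is almost surely finite, and, up to a Lebesgue null set, $O^{(\tau)}=\{(y,s): 0<s<T,\ X_\tau(s)<y<X'_\tau(s)\}$. Notation: $z_+=\max(z,0)$. *)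

theory Defs
  imports "HOL-Probability.Probability"
begin

text \<open>A point process is a random set of points. The Poisson process is simple almost surely,
  so nothing is lost compared with random counting measures. The weights are spelled out
  because \<^const>\<open>poisson_pmf\<close> is only specified for positive rates, whereas \<open>B\<close> may be a null set.\<close>

definition poisson_process ::
  "'w measure \<Rightarrow> 'a::euclidean_space set \<Rightarrow> real \<Rightarrow> ('w \<Rightarrow> 'a set) \<Rightarrow> bool" where
  "poisson_process M D c N \<longleftrightarrow>
     (\<forall>\<omega>\<in>space M. N \<omega> \<subseteq> D) \<and>
     (AE \<omega> in M. \<forall>B. bounded B \<longrightarrow> finite (N \<omega> \<inter> B)) \<and>
     (\<forall>B\<in>sets borel. bounded B \<longrightarrow>
        (\<lambda>\<omega>. card (N \<omega> \<inter> B)) \<in> measurable M (count_space UNIV) \<and>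
        (\<forall>k. measure M {\<omega>\<in>space M. card (N \<omega> \<inter> B) = k} =
              exp (- (c * measure lborel (B \<inter> D))) * (c * measure lborel (B \<inter> D)) ^ k / fact k)) \<and>
     (\<forall>(B :: nat \<Rightarrow> 'a set) I. finite I \<longrightarrow> disjoint_family_on B I \<longrightarrow>
        (\<forall>i\<in>I. B i \<in> sets borel \<and> bounded (B i)) \<longrightarrow>
        prob_space.indep_vars M (\<lambda>_. count_space UNIV) (\<lambda>i \<omega>. card (N \<omega> \<inter> B i)) I)"

definition process_events :: "'w measure \<Rightarrow> ('w \<Rightarrow> 'a::euclidean_space set) \<Rightarrow> 'w set set" where
  "process_events M N = sigma_sets (space M)
     {{\<omega>\<in>space M. card (N \<omega> \<inter> B) = k} | B k. B \<in> sets borel \<and> bounded B}"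

text \<open>Singleton containing the least element, or empty if there is none.\<close>

definition leftmost :: "real set \<Rightarrow> real set" where
  "leftmost C = {y\<in>C. \<forall>z\<in>C. y \<le> z}"

text \<open>Sinks and \<open>\<alpha>\<close>-points are merged into one set of marks \<open>(u, s)\<close> (position, time);
  a sink is a mark with \<open>u = 0\<close>.\<close>

definition marks :: "real set \<Rightarrow> (real \<times> real) set \<Rightarrow> (real \<times> real) set" where
  "marks K A = {0} \<times> K \<union> A"

definition step :: "real \<Rightarrow> real set \<Rightarrow> real set" where
  "step u C = (if u = 0 then C - leftmost C else insert u (C - leftmost (C \<inter> {u<..})))"

text \<open>The autonomous evolution on \<open>[0, R]\<close>, started from \<open>C \<inter> [0, R]\<close>. Almost surely there are
  finitely many marks in \<open>[0, R] \<times> (0, t]\<close>, with distinct times, so that the description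
  determines the mark occurring at a given time. The location \<open>0\<close> is included since the extra
  particle of the second class construction starts there.\<close>

definition hammersley_upto ::
  "real \<Rightarrow> (real \<times> real) set \<Rightarrow> real set \<Rightarrow> real \<Rightarrow> real set" where
  "hammersley_upto R E C t =
     (let E' = {(u, s) \<in> E. u \<le> R \<and> 0 < s \<and> s \<le> t}
      in fold (\<lambda>s. step (THE u. (u, s) \<in> E')) (sorted_list_of_set (snd ` E')) (C \<inter> {0..R}))"

definition hammersley :: "(real \<times> real) set \<Rightarrow> real set \<Rightarrow> real \<Rightarrow> real set" where
  "hammersley E C t = (\<Union>R\<in>{0<..}. hammersley_upto R E C t)"

definition second_class :: "real set \<Rightarrow> real set \<Rightarrow> (real \<times> real) set \<Rightarrow> real \<Rightarrow> real" where
  "second_class S K A t =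
     (THE y. y \<notin> hammersley (marks K A) S t \<and>
        hammersley (marks K A) (insert 0 S) t = insert y (hammersley (marks K A) S t))"

definition dual_second_class :: "real set \<Rightarrow> real set \<Rightarrow> (real \<times> real) set \<Rightarrow> real \<Rightarrow> real" where
  "dual_second_class S K A t =
     (THE y. y \<notin> hammersley (marks K A) (S - leftmost S) t \<and>
        hammersley (marks K A) S t = insert y (hammersley (marks K A) (S - leftmost S) t))"

text \<open>The condition \<open>X s = X' (s-)\<close> is expressed by the left limit of \<open>X'\<close> at \<open>s\<close>.\<close>

definition meeting_time :: "(real \<Rightarrow> real) \<Rightarrow> (real \<Rightarrow> real) \<Rightarrow> ereal" where
  "meeting_time X X' = (INF s\<in>{s. 0 < s \<and> (X' \<longlongrightarrow> X s) (at_left s)}. ereal s)"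

definition enclosed_region :: "(real \<Rightarrow> real) \<Rightarrow> (real \<Rightarrow> real) \<Rightarrow> (real \<times> real) set" where
  "enclosed_region X X' =
     {(y, s). 0 < s \<and> ereal s < meeting_time X X' \<and> X s < y \<and> y < X' s}"

end

theory Submission imports Defs
begin

text \<open>Cut \<open>[0, x] \<times> [0, t]\<close> into \<open>n \<times> n\<close> cells and record which cells contain a point. In the limit this
  is last passage percolation on a grid with independent Bernoulli points: odds \<open>r\<close> and \<open>s\<close> on the two
  axes, and probability \<open>r s\<close> in the interior. For these parameters the increments of the last
  passage time are stationary exactly (a discrete Burke property), so that the expected last passage
  time is \<open>n r / (1 + r) + n s / (1 + s)\<close>. Scale both odds by \<open>\<theta>\<close> and differentiate at \<open>\<theta> = 1\<close>. By
  Russo's formula the derivative is a sum over the cells of the expected effect of adding a point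
  there. By stationarity the effect of a point on an axis is that of a point next to the origin,
  i.e. of a second class particle: it is the probability that this particle is still in the
  rectangle, and such a sum tends to the expectation of \<open>(x - X t)\<^sub>+\<close> or, with the axes exchanged, of
  \<open>(t - X x)\<^sub>+\<close>. A point in the interior likewise has the effect of one in the cell at the origin,
  which amounts to adding a source at the origin and deleting the leftmost one. The upper corner
  feels this if and only if it lies between the second class particle and the dual one before they
  meet, so these sums tend to the expected area.

  The second class particles stay finite because the flux through the right edge has a known
  variance: its covariance with the number of sources is a sum of probabilities that the second
  class particle has left the rectangle, and Cauchy's inequality bounds it.\<close>

section \<open>Functions of independent Bernoulli points\<close>

text \<open>The lattice law is a stand-in: a Poisson cell is nonempty with probability
  \<open>1 - exp (- u)\<close>, which is not the stationary choice. The two probabilities differ by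
  at most \<open>u\<^sup>2\<close>; summed over all cells this is \<open>O(1 / n)\<close>, so
  bounded functionals keep their limits. Scaling both odds by \<theta> is the right direction of
  differentiation because the interior probability stays the product of the odds: every \<theta>
  belongs to the solvable family, and the derivative of \<theta> squared is the factor 2 in front of
  the area. Stationarity moves each added point to the origin and lets the upper corner vary
  instead, so one realization is tested by all corners, and each test compares particle counts of
  coupled configurations. The obstacle is that the second class particles are definite descriptions
  on an infinite half-line. They can be identified in a window \<open>[0, R]\<close> only while a
  discrepancy is visible there, which makes a quantitative bound on the escape of the dual particle
  unavoidable. The integrals are over the completion because the quantities are obtained as almost
  sure limits of measurable ones.\<close>

definition bern :: "'a set \<Rightarrow> ('a \<Rightarrow> real) \<Rightarrow> ('a set \<Rightarrow> real) \<Rightarrow> real" where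
  "bern G P f = (\<Sum>c\<in>Pow G. (\<Prod>g\<in>G. if g \<in> c then P g else 1 - P g) * f c)"

lemma bern_empty [simp]: "bern {} P f = f {}"
  by (simp add: bern_def)

lemma bern_insert:
  assumes "finite G" "g \<notin> G"
  shows "bern (insert g G) P f =
    P g * bern G P (\<lambda>c. f (insert g c)) + (1 - P g) * bern G P f"
proof -
  have dj: "Pow G \<inter> insert g ` Pow G = {}" using assms(2) by auto
  have inj: "inj_on (insert g) (Pow G)"
    using assms(2) by (auto simp: inj_on_def)
  have 1: "(\<Prod>h\<in>G. if h \<in> insert g c then P h else 1 - P h) = (\<Prod>h\<in>G. if h \<in> c then P h else 1 - P h)" for c
    using assms(2) by (intro prod.cong) auto
  have "bern (insert g G) P f =
     (\<Sum>c\<in>Pow G. (\<Prod>h\<in>insert g G. if h \<in> c then P h else 1 - P h) * f c) +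
     (\<Sum>c\<in>insert g ` Pow G. (\<Prod>h\<in>insert g G. if h \<in> c then P h else 1 - P h) * f c)"
    unfolding bern_def Pow_insert using dj assms(1) by (intro sum.union_disjoint) auto
  also have "(\<Sum>c\<in>Pow G. (\<Prod>h\<in>insert g G. if h \<in> c then P h else 1 - P h) * f c) = (1 - P g) * bern G P f"
    unfolding bern_def sum_distrib_left using assms by (intro sum.cong) (auto simp: mult.assoc)
  also have "(\<Sum>c\<in>insert g ` Pow G. (\<Prod>h\<in>insert g G. if h \<in> c then P h else 1 - P h) * f c)
     = P g * bern G P (\<lambda>c. f (insert g c))"
    unfolding bern_def sum_distrib_left sum.reindex[OF inj] using assms
    by (intro sum.cong refl) (simp add: mult.assoc 1[simplified])
  finally show ?thesis by simp
qed

lemma bern_insert2: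
  assumes "finite G" "x \<notin> G" "y \<notin> G" "x \<noteq> y"
  shows "bern (insert x (insert y G)) P f =
    P x * (P y * bern G P (\<lambda>c. f (insert x (insert y c))) + (1 - P y) * bern G P (\<lambda>c. f (insert x c)))
    + (1 - P x) * (P y * bern G P (\<lambda>c. f (insert y c)) + (1 - P y) * bern G P f)"
  using assms by (simp add: bern_insert)

lemma bern_add: "bern G P (\<lambda>c. f c + g c) = bern G P f + bern G P g"
  by (simp add: bern_def distrib_left sum.distrib)

lemma bern_cmult: "bern G P (\<lambda>c. a * f c) = a * bern G P f"
  by (simp add: bern_def sum_distrib_left mult.left_commute)

lemma bern_diff: "bern G P (\<lambda>c. f c - g c) = bern G P f - bern G P g"
  by (simp add: bern_def right_diff_distrib sum_subtractf)

lemma bern_sum: "bern G P (\<lambda>c. \<Sum>i\<in>I. f i c) = (\<Sum>i\<in>I. bern G P (f i))"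
  by (simp add: bern_def sum_distrib_left sum.swap[of _ I])

lemma bern_const: "finite G \<Longrightarrow> bern G P (\<lambda>c. a) = a"
  by (induction G rule: finite_induct) (simp_all add: bern_insert algebra_simps)

lemma bern_cong:
  assumes "\<And>c. c \<subseteq> G \<Longrightarrow> f c = g c" "\<And>x. x \<in> G \<Longrightarrow> P x = Q x"
  shows "bern G P f = bern G Q g"
  unfolding bern_def using assms by (intro sum.cong arg_cong2[where f="(*)"] prod.cong) auto

lemma bern_mono:
  assumes "\<And>x. x \<in> G \<Longrightarrow> 0 \<le> P x \<and> P x \<le> 1" "\<And>c. c \<subseteq> G \<Longrightarrow> f c \<le> g c"
  shows "bern G P f \<le> bern G P g"
  unfolding bern_def using assms by (intro sum_mono mult_left_mono prod_nonneg) auto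

lemma bern_union:
  assumes "finite G" "finite H" "G \<inter> H = {}"
  shows "bern (G \<union> H) P f = bern G P (\<lambda>a. bern H P (\<lambda>b. f (a \<union> b)))"
  using assms
proof (induction G arbitrary: f rule: finite_induct)
  case (insert g G)
  then show ?case by (simp add: bern_insert)
qed simp

lemma bern_subset:
  assumes "finite G" "H \<subseteq> G" "\<And>c. f (c \<inter> H) = f c"
  shows "bern G P f = bern H P f"
proof -
  have fin: "finite H" "finite (G - H)" using assms finite_subset by auto
  have "bern G P f = bern (H \<union> (G - H)) P f" using assms by (simp add: Un_absorb1)
  also have "\<dots> = bern H P (\<lambda>a. bern (G - H) P (\<lambda>b. f (a \<union> b)))"
    using fin by (intro bern_union) auto
  also have "\<dots> = bern H P f"
  proof (intro bern_cong refl)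
    fix a assume "a \<subseteq> H"
    have "bern (G - H) P (\<lambda>b. f (a \<union> b)) = bern (G - H) P (\<lambda>b. f a)"
    proof (intro bern_cong refl)
      fix b assume "b \<subseteq> G - H"
      then have "(a \<union> b) \<inter> H = a" using \<open>a \<subseteq> H\<close> by auto
      then show "f (a \<union> b) = f a" using assms(3)[of "a \<union> b"] by simp
    qed
    then show "bern (G - H) P (\<lambda>b. f (a \<union> b)) = f a" by (simp add: bern_const fin)
  qed
  finally show ?thesis .
qed

lemma bern_reindex:
  assumes "finite G" "inj \<phi>"
  shows "bern (\<phi> ` G) P f = bern G (P \<circ> \<phi>) (\<lambda>c. f (\<phi> ` c))"
  using assms
proof (induction G arbitrary: f rule: finite_induct)
  case (insert g G)
  then show ?case by (simp add: bern_insert inj_image_mem_iff)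
qed simp

lemma bern_bounded:
  assumes "\<And>x. x \<in> G \<Longrightarrow> 0 \<le> P x \<and> P x \<le> 1" "\<And>c. c \<subseteq> G \<Longrightarrow> \<bar>f c\<bar> \<le> B" "finite G"
  shows "\<bar>bern G P f\<bar> \<le> B"
proof -
  have "f c \<le> B" "- B \<le> f c" if "c \<subseteq> G" for c
    using assms(2)[OF that] by auto
  then have "bern G P f \<le> bern G P (\<lambda>_. B)" "bern G P (\<lambda>_. - B) \<le> bern G P f"
    using assms(1) by (intro bern_mono; blast)+
  then show ?thesis using assms(3) by (simp add: bern_const)
qed

text \<open>Replacing the marginal laws one coordinate at a time.\<close>

lemma bern_change_prob:
  assumes "finite G" "\<And>x. x \<in> G \<Longrightarrow> 0 \<le> P x \<and> P x \<le> 1" "\<And>x. x \<in> G \<Longrightarrow> 0 \<le> Q x \<and> Q x \<le> 1"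
    and "\<And>c. \<bar>f c\<bar> \<le> B"
  shows "\<bar>bern G P f - bern G Q f\<bar> \<le> 2 * B * (\<Sum>g\<in>G. \<bar>P g - Q g\<bar>)"
  using assms
proof (induction G arbitrary: f rule: finite_induct)
  case (insert g G)
  define a a' b b' where "a = bern G P (\<lambda>c. f (insert g c))" and "a' = bern G P f"
    and "b = bern G Q (\<lambda>c. f (insert g c))" and "b' = bern G Q f"
  have 1: "\<bar>a - b\<bar> \<le> 2 * B * (\<Sum>g\<in>G. \<bar>P g - Q g\<bar>)" "\<bar>a' - b'\<bar> \<le> 2 * B * (\<Sum>g\<in>G. \<bar>P g - Q g\<bar>)"
    unfolding a_def b_def a'_def b'_def using insert.prems by (intro insert.IH; blast)+
  have 2: "\<bar>b\<bar> \<le> B" "\<bar>b'\<bar> \<le> B"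
    unfolding b_def b'_def using insert.prems insert.hyps by (intro bern_bounded; blast)+
  define K where "K = 2 * B * (\<Sum>g\<in>G. \<bar>P g - Q g\<bar>)"
  have p: "0 \<le> P g" "P g \<le> 1" using insert.prems(1)[of g] by auto
  have "bern (insert g G) P f - bern (insert g G) Q f
      = (P g * a + (1 - P g) * a') - (Q g * b + (1 - Q g) * b')"
    using insert.hyps by (simp add: bern_insert a_def b_def a'_def b'_def)
  also have "\<dots> = P g * (a - b) + (1 - P g) * (a' - b') + (P g - Q g) * (b - b')"
    by (simp add: algebra_simps)
  also have "\<bar>\<dots>\<bar> \<le> \<bar>P g * (a - b)\<bar> + \<bar>(1 - P g) * (a' - b')\<bar> + \<bar>(P g - Q g) * (b - b')\<bar>"
    by linarith
  also have "\<dots> = P g * \<bar>a - b\<bar> + (1 - P g) * \<bar>a' - b'\<bar> + \<bar>P g - Q g\<bar> * \<bar>b - b'\<bar>"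
    using p by (simp add: abs_mult)
  also have "\<dots> \<le> P g * K + (1 - P g) * K + \<bar>P g - Q g\<bar> * (2 * B)"
  proof -
    have "\<bar>b - b'\<bar> \<le> 2 * B" using 2 by linarith
    then show ?thesis using p 1[folded K_def] by (intro add_mono mult_left_mono) auto
  qed
  also have "\<dots> = K + 2 * B * \<bar>P g - Q g\<bar>" by (simp add: algebra_simps)
  also have "\<dots> = 2 * B * (\<Sum>g\<in>insert g G. \<bar>P g - Q g\<bar>)"
    using insert.hyps by (simp add: K_def distrib_left)
  finally show ?case .
qed simp

section \<open>Discrete derivatives: covariances and Russo's formula\<close>

definition flip :: "'a \<Rightarrow> ('a set \<Rightarrow> real) \<Rightarrow> 'a set \<Rightarrow> real" where
  "flip g f c = f (insert g c) - f (c - {g})"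

lemma bern_split:
  assumes "finite G" "g \<in> G"
  shows "bern G P f = P g * bern G P (\<lambda>c. f (insert g c)) + (1 - P g) * bern G P (\<lambda>c. f (c - {g}))"
proof -
  have ins: "bern G P h = P g * bern (G - {g}) P (\<lambda>c. h (insert g c)) + (1 - P g) * bern (G - {g}) P h" for h
    using bern_insert[of "G - {g}" g P h] assms by (simp add: insert_absorb)
  have "bern (G - {g}) P (\<lambda>c. f (c - {g})) = bern (G - {g}) P f"
    by (intro bern_cong refl arg_cong[of _ _ f]) auto
  then have "bern G P (\<lambda>c. f (c - {g})) = bern (G - {g}) P f"
    by (subst ins) (simp add: algebra_simps)
  moreover have "bern G P (\<lambda>c. f (insert g c)) = bern (G - {g}) P (\<lambda>c. f (insert g c))"
    by (subst ins) (simp add: algebra_simps)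
  ultimately show ?thesis by (subst ins) simp
qed

text \<open>Condition on \<open>g\<close>: the centred indicator is \<open>1 - P g\<close> with
  weight \<open>P g\<close> and \<open>- P g\<close> with weight \<open>1 - P g\<close>, so only the
  difference of the two conditional expectations remains.\<close>

lemma bern_covariance:
  assumes "finite G" "g \<in> G"
  shows "bern G P (\<lambda>c. (of_bool (g \<in> c) - P g) * f c) = P g * (1 - P g) * bern G P (flip g f)"
proof -
  define u v where "u = bern G P (\<lambda>c. f (insert g c))" and "v = bern G P (\<lambda>c. f (c - {g}))"
  have "bern G P (\<lambda>c. (of_bool (g \<in> c) - P g) * f c) = P g * ((1 - P g) * u) + (1 - P g) * (- P g * v)"
    by (subst bern_split[OF assms]) (simp add: u_def v_def bern_cmult[of _ _ "1 - P g"] bern_cmult[of _ _ "- P g", simplified])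
  then show ?thesis
    by (simp add: flip_def[abs_def] bern_diff u_def[symmetric] v_def[symmetric] algebra_simps)
qed

text \<open>The effect of adding \<open>g\<close> is computed from the other points only. This
  separates the presence of a source from its effect in \<open>drop_first_bound\<close>.\<close>

lemma bern_flip_indep:
  assumes "finite G" "g \<in> G"
  shows "bern G P (\<lambda>c. of_bool (g \<in> c) * h (flip g f c)) = P g * bern G P (\<lambda>c. h (flip g f c))"
proof -
  have "flip g f (insert g c) = flip g f c" "flip g f (c - {g}) = flip g f c" for c
    by (auto simp: flip_def insert_absorb)
  then show ?thesis
    by (subst bern_split[OF assms]) (simp add: bern_const assms bern_cmult)
qed

text \<open>Russo's formula: \<open>bern\<close> is affine in each single probability, with the
  expected effect of the point as slope. As a polynomial in the values of \<open>P\<close> it may be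
  differentiated at any real values.\<close>

lemma bern_has_derivative:
  assumes "finite G" "\<And>g. g \<in> G \<Longrightarrow> ((\<lambda>\<theta>. P \<theta> g) has_real_derivative P' g) (at \<theta>)"
  shows "((\<lambda>\<theta>. bern G (P \<theta>) f) has_real_derivative (\<Sum>g\<in>G. P' g * bern G (P \<theta>) (flip g f))) (at \<theta>)"
  using assms
proof (induction G arbitrary: f rule: finite_induct)
  case (insert g G)
  have fl: "bern (insert g G) (P \<theta>) (flip h f) =
     P \<theta> g * bern G (P \<theta>) (flip h (\<lambda>c. f (insert g c))) + (1 - P \<theta> g) * bern G (P \<theta>) (flip h f)"
    if "h \<in> G" for h
  proof -
    have "h \<noteq> g" using that insert.hyps by auto
    then show ?thesis using insert.hyps
      by (simp add: bern_insert flip_def[abs_def] insert_commute insert_Diff_if)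
  qed
  have flg: "bern (insert g G) (P \<theta>) (flip g f) = bern G (P \<theta>) (\<lambda>c. f (insert g c)) - bern G (P \<theta>) f"
  proof -
    have "bern G (P \<theta>) (\<lambda>c. f (c - {g})) = bern G (P \<theta>) f"
      using insert.hyps by (intro bern_cong arg_cong[of _ _ f]) auto
    then show ?thesis using insert.hyps
      by (simp add: bern_insert flip_def[abs_def] bern_diff algebra_simps)
  qed
  have "((\<lambda>\<theta>. P \<theta> g * bern G (P \<theta>) (\<lambda>c. f (insert g c)) + (1 - P \<theta> g) * bern G (P \<theta>) f) has_real_derivative
     P' g * bern G (P \<theta>) (\<lambda>c. f (insert g c)) + (\<Sum>h\<in>G. P' h * bern G (P \<theta>) (flip h (\<lambda>c. f (insert g c)))) * P \<theta> g
     + ((0 - P' g) * bern G (P \<theta>) f + (\<Sum>h\<in>G. P' h * bern G (P \<theta>) (flip h f)) * (1 - P \<theta> g))) (at \<theta>)"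
    using insert.prems by (intro DERIV_add DERIV_mult DERIV_diff DERIV_const insert.IH) auto
  moreover have "(\<Sum>h\<in>insert g G. P' h * bern (insert g G) (P \<theta>) (flip h f)) =
     P' g * bern G (P \<theta>) (\<lambda>c. f (insert g c)) + (\<Sum>h\<in>G. P' h * bern G (P \<theta>) (flip h (\<lambda>c. f (insert g c)))) * P \<theta> g
     + ((0 - P' g) * bern G (P \<theta>) f + (\<Sum>h\<in>G. P' h * bern G (P \<theta>) (flip h f)) * (1 - P \<theta> g))"
  proof -
    have *: "(\<Sum>h\<in>G. a h * (p * u h + q * v h)) = (\<Sum>h\<in>G. a h * u h) * p + (\<Sum>h\<in>G. a h * v h) * q"
      for a u v :: "'a \<Rightarrow> real" and p q
      unfolding sum_distrib_right sum.distrib[symmetric] by (intro sum.cong) (simp_all add: algebra_simps)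
    have "(\<Sum>h\<in>insert g G. P' h * bern (insert g G) (P \<theta>) (flip h f)) =
       P' g * (bern G (P \<theta>) (\<lambda>c. f (insert g c)) - bern G (P \<theta>) f) +
       (\<Sum>h\<in>G. P' h * (P \<theta> g * bern G (P \<theta>) (flip h (\<lambda>c. f (insert g c))) + (1 - P \<theta> g) * bern G (P \<theta>) (flip h f)))"
      using insert.hyps by (simp add: flg fl cong: sum.cong)
    then show ?thesis by (simp only: *) (simp add: right_diff_distrib)
  qed
  ultimately show ?case using insert.hyps by (simp add: bern_insert)
qed simp

section \<open>Stationary last passage percolation\<close>

text \<open>\<open>lpp i j c\<close> is the maximal number of points of \<open>c\<close> on a path from \<open>(0, 0)\<close> to \<open>(i, j)\<close> that first
  follows one of the axes and then increases strictly in both coordinates. \<open>hinc c i j\<close> and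
  \<open>vinc c i j\<close> are its increments from \<open>(i - 1, j)\<close> and from \<open>(i, j - 1)\<close> to \<open>(i, j)\<close>. For the particle
  system, \<open>hinc c i j\<close> says that column \<open>i\<close> is occupied after row \<open>j\<close>, and \<open>vinc c i j\<close> that a particle
  crosses the right border of column \<open>i\<close> during row \<open>j\<close>.\<close>

fun hinc :: "(nat \<times> nat) set \<Rightarrow> nat \<Rightarrow> nat \<Rightarrow> bool" and vinc :: "(nat \<times> nat) set \<Rightarrow> nat \<Rightarrow> nat \<Rightarrow> bool" where
  "hinc c 0 j = False"
| "hinc c (Suc i) 0 = ((Suc i, 0) \<in> c)"
| "hinc c (Suc i) (Suc j) = ((hinc c (Suc i) j \<or> (Suc i, Suc j) \<in> c) \<and> \<not> vinc c i (Suc j))"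
| "vinc c i 0 = False"
| "vinc c 0 (Suc j) = ((0, Suc j) \<in> c)"
| "vinc c (Suc i) (Suc j) = ((vinc c i (Suc j) \<or> (Suc i, Suc j) \<in> c) \<and> \<not> hinc c (Suc i) j)"

definition cnt :: "(nat \<times> nat) set \<Rightarrow> nat \<Rightarrow> nat \<Rightarrow> real" where
  "cnt c i j = (\<Sum>k=1..i. of_bool (hinc c k j))"

definition flux :: "(nat \<times> nat) set \<Rightarrow> nat \<Rightarrow> nat \<Rightarrow> real" where
  "flux c i j = (\<Sum>l=1..j. of_bool (vinc c i l))"

definition lpp :: "nat \<Rightarrow> nat \<Rightarrow> (nat \<times> nat) set \<Rightarrow> real" where
  "lpp i j c = flux c 0 j + cnt c i j"

lemma cnt_Suc: "cnt c (Suc i) j = cnt c i j + of_bool (hinc c (Suc i) j)"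
  by (simp add: cnt_def)

lemma flux_Suc: "flux c i (Suc j) = flux c i j + of_bool (vinc c i (Suc j))"
  by (simp add: flux_def)

lemma cnt_0 [simp]: "cnt c 0 j = 0" by (simp add: cnt_def)
lemma flux_0 [simp]: "flux c i 0 = 0" by (simp add: flux_def)

text \<open>Both ways around a unit square give the same total, so the increments have a potential,
  which is \<open>lpp\<close>. For particles: what enters a cell leaves it.\<close>

lemma cell_conservation:
  "of_bool (hinc c (Suc i) (Suc j)) + of_bool (vinc c i (Suc j))
    = (of_bool (hinc c (Suc i) j) + of_bool (vinc c (Suc i) (Suc j)) :: real)"
  by auto

lemma cnt_row: "cnt c i (Suc j) + of_bool (vinc c 0 (Suc j)) = cnt c i j + of_bool (vinc c i (Suc j))"
proof (induction i)
  case (Suc i)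
  then show ?case using cell_conservation[of c i j] by (simp add: cnt_Suc del: hinc.simps vinc.simps)
qed simp

lemma lpp_conservation: "lpp i j c = cnt c i 0 + flux c i j"
proof (induction j)
  case (Suc j)
  then show ?case using cnt_row[of c i j] by (simp add: lpp_def flux_Suc del: hinc.simps vinc.simps)
qed (simp add: lpp_def)

lemma hinc_vinc_cong:
  "c \<inter> {..i} \<times> {..j} = c' \<inter> {..i} \<times> {..j} \<Longrightarrow> hinc c i j = hinc c' i j"
  "c \<inter> {..i} \<times> {..j} = c' \<inter> {..i} \<times> {..j} \<Longrightarrow> vinc c i j = vinc c' i j"
proof (induction c i j and c i j rule: hinc_vinc.induct)
  have sub: "c \<inter> B = c' \<inter> B" if "c \<inter> A = c' \<inter> A" "B \<subseteq> A" for A B :: "(nat \<times> nat) set" and c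
    using that by blast
  have mem: "x \<in> c \<longleftrightarrow> x \<in> c'" if "c \<inter> A = c' \<inter> A" "x \<in> A" for A :: "(nat \<times> nat) set" and c x
    using that by blast
  {
    case (2 c i) then show ?case using mem[OF 2, of "(Suc i, 0)"] by simp
  next
    case (5 c j) then show ?case using mem[OF 5, of "(0, Suc j)"] by simp
  next
    case (3 c i j)
    have "c \<inter> {..Suc i} \<times> {..j} = c' \<inter> {..Suc i} \<times> {..j}" "c \<inter> {..i} \<times> {..Suc j} = c' \<inter> {..i} \<times> {..Suc j}"
      by (rule sub[OF 3(3)]; auto)+
    with 3 mem[OF 3(3), of "(Suc i, Suc j)"] show ?case by simp
  next
    case (6 c i j)
    have "c \<inter> {..Suc i} \<times> {..j} = c' \<inter> {..Suc i} \<times> {..j}" "c \<inter> {..i} \<times> {..Suc j} = c' \<inter> {..i} \<times> {..Suc j}"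
      by (rule sub[OF 6(3)]; auto)+
    with 6 mem[OF 6(3), of "(Suc i, Suc j)"] show ?case by simp
  }
qed simp_all

lemma hinc_vinc_swap: "hinc (prod.swap ` c) i j = vinc c j i" "vinc (prod.swap ` c) i j = hinc c j i"
proof (induction "prod.swap ` c" i j and "prod.swap ` c" i j rule: hinc_vinc.induct)
qed (simp_all add: pair_in_swap_image conj_commute disj_commute)

text \<open>Reflection turns the path along the left and top edges into the one along the bottom and
  right edges, so this rests on \<open>lpp_conservation\<close>.\<close>

lemma lpp_swap: "lpp i j (prod.swap ` c) = lpp j i c"
  by (simp add: lpp_conservation[of i j] lpp_def[of j i] cnt_def flux_def hinc_vinc_swap)

section \<open>Rectangles, their stationary law and its invariance\<close>

definition grid :: "nat \<Rightarrow> nat \<Rightarrow> (nat \<times> nat) set" where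
  "grid n m = {..n} \<times> {..m} - {(0, 0)}"

lemma finite_grid [simp]: "finite (grid n m)" by (simp add: grid_def)

lemma lpp_grid: "n \<le> n' \<Longrightarrow> m \<le> m' \<Longrightarrow> lpp n m (c \<inter> grid n' m') = lpp n m c"
proof -
  have *: "hinc (c \<inter> X) i j = hinc c i j" "vinc (c \<inter> X) i j = vinc c i j"
    if "{..n'} \<times> {..m'} \<subseteq> X" "i \<le> n'" "j \<le> m'" for i j X
  proof -
    have "{..i} \<times> {..j} \<subseteq> {..n'} \<times> {..m'}" using that by auto
    then have "c \<inter> X \<inter> {..i} \<times> {..j} = c \<inter> {..i} \<times> {..j}" using that(1) by blast
    then show "hinc (c \<inter> X) i j = hinc c i j" "vinc (c \<inter> X) i j = vinc c i j" by (auto intro!: hinc_vinc_cong)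
  qed
  have z: "hinc (c - {(0,0)}) i j = hinc c i j" "vinc (c - {(0,0)}) i j = vinc c i j" for c i j
    by (induction c i j and c i j rule: hinc_vinc.induct) auto
  assume "n \<le> n'" "m \<le> m'"
  moreover have "{..n'} \<times> {..m'} \<subseteq> insert (0,0) (grid n' m')" by (auto simp: grid_def)
  ultimately have "lpp n m (c \<inter> insert (0,0) (grid n' m')) = lpp n m c"
    by (auto simp: lpp_def cnt_def flux_def * intro!: sum.cong arg_cong2[where f="(+)"])
  moreover have "lpp n m ((c \<inter> insert (0,0) (grid n' m')) - {(0,0)}) = lpp n m (c \<inter> insert (0,0) (grid n' m'))"
    by (simp add: lpp_def cnt_def flux_def z)
  moreover have "(c \<inter> insert (0,0) (grid n' m')) - {(0,0)} = c \<inter> grid n' m'"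
    by (auto simp: grid_def)
  ultimately show ?thesis by simp
qed

definition lat :: "real \<Rightarrow> real \<Rightarrow> nat \<times> nat \<Rightarrow> real" where
  "lat r s = (\<lambda>(i, j). if j = 0 then r / (1 + r) else if i = 0 then s / (1 + s) else r * s)"

text \<open>The configuration seen from the right border of the first column, which becomes the new
  vertical axis.\<close>

definition strip :: "(nat \<times> nat) set \<Rightarrow> (nat \<times> nat) set" where
  "strip c = {(0, j) |j. vinc c 1 j} \<union> {(Suc i, j) |i j. (Suc (Suc i), j) \<in> c}"

text \<open>The discrete Burke property: on the right border of the first column the vertical increments
  are again independent with odds \<open>s\<close>, and independent of the increment along the top.\<close>

lemma strip_column:
  assumes "r \<noteq> -1" "s \<noteq> -1"
  shows "bern (insert (1, 0) ({0, 1} \<times> {1..m})) (lat r s) (\<lambda>a. g (hinc a 1 m) {(0, j) |j. j \<le> m \<and> vinc a 1 j}) =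
    r / (1 + r) * bern ({0} \<times> {1..m}) (lat r s) (g True)
    + (1 - r / (1 + r)) * bern ({0} \<times> {1..m}) (lat r s) (g False)"
proof (induction m arbitrary: g)
  case 0
  have "{(0::nat, j) |j. j \<le> 0 \<and> vinc a 1 j} = {}" for a by auto
  then show ?case by (simp add: bern_insert lat_def)
next
  case (Suc m)
  let ?G = "insert (1, 0) ({0, 1} \<times> {1..m}) :: (nat \<times> nat) set"
  let ?V = "\<lambda>a m. {(0::nat, j) |j. j \<le> m \<and> vinc a 1 j}"
  define W where "W = (\<lambda>h s v w. g ((h \<or> w) \<and> \<not> v) (s \<union> (if (v \<or> w) \<and> \<not> h then {(0, Suc m)} else {})))"
  \<comment> \<open>\<open>G2\<close> averages over the two new points of row \<open>Suc m\<close>.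
    It again depends only on the top increment and the collected crossings, so the induction
    hypothesis, with \<open>g\<close> arbitrary, applies to it.\<close>
  define G2 where "G2 = (\<lambda>h s'. s/(1+s) * (r * s * W h s' True True + (1 - r * s) * W h s' True False)
     + (1 - s/(1+s)) * (r * s * W h s' False True + (1 - r * s) * W h s' False False))"
  have eq: "insert (1, 0) ({0, 1} \<times> {1..Suc m}) = insert (0, Suc m) (insert (1, Suc m) ?G)"
    by (auto simp: atLeastAtMostSuc_conv)
  have W: "g (hinc a' 1 (Suc m)) (?V a' (Suc m)) = W (hinc a 1 m) (?V a m) ((0, Suc m) \<in> b) ((1, Suc m) \<in> b)"
    if "a \<subseteq> ?G" "a' = a \<union> b" "b \<subseteq> {(0, Suc m), (1, Suc m)}" for a a' b
  proof -
    have loc: "hinc a' 1 j = hinc a 1 j" "vinc a' 1 j = vinc a 1 j" if "j \<le> m" for j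
      using that \<open>a' = _\<close> \<open>b \<subseteq> _\<close> by (auto intro!: hinc_vinc_cong)
    have na: "(0, Suc m) \<notin> a" "(1, Suc m) \<notin> a" using that(1) by auto
    have V: "?V a' (Suc m) = ?V a m \<union> (if vinc a' 1 (Suc m) then {(0, Suc m)} else {})"
      using loc by (auto simp: le_Suc_eq)
    show ?thesis unfolding W_def V using na loc(1)[of m] that by auto
  qed
  have "bern (insert (1, 0) ({0, 1} \<times> {1..Suc m})) (lat r s) (\<lambda>a. g (hinc a 1 (Suc m)) (?V a (Suc m)))
     = bern ?G (lat r s) (\<lambda>a. G2 (hinc a 1 m) (?V a m))"
  proof -
    have I1: "bern ?G (lat r s) (\<lambda>a. g (hinc (insert (0, Suc m) (insert (1, Suc m) a)) 1 (Suc m)) (?V (insert (0, Suc m) (insert (1, Suc m) a)) (Suc m)))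
      = bern ?G (lat r s) (\<lambda>a. W (hinc a 1 m) (?V a m) True True)"
      by (intro bern_cong refl) (subst W[where b="{(0, Suc m), (1, Suc m)}"]; auto)
    have I2: "bern ?G (lat r s) (\<lambda>a. g (hinc (insert (0, Suc m) a) 1 (Suc m)) (?V (insert (0, Suc m) a) (Suc m)))
      = bern ?G (lat r s) (\<lambda>a. W (hinc a 1 m) (?V a m) True False)"
      by (intro bern_cong refl) (subst W[where b="{(0, Suc m)}"]; auto)
    have I3: "bern ?G (lat r s) (\<lambda>a. g (hinc (insert (1, Suc m) a) 1 (Suc m)) (?V (insert (1, Suc m) a) (Suc m)))
      = bern ?G (lat r s) (\<lambda>a. W (hinc a 1 m) (?V a m) False True)"
      by (intro bern_cong refl) (subst W[where b="{(1, Suc m)}"]; auto)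
    have I4: "bern ?G (lat r s) (\<lambda>a. g (hinc a 1 (Suc m)) (?V a (Suc m)))
      = bern ?G (lat r s) (\<lambda>a. W (hinc a 1 m) (?V a m) False False)"
      by (intro bern_cong refl) (subst W[where b="{}"]; auto)
    have P: "lat r s (0, Suc m) = s/(1+s)" "lat r s (1, Suc m) = r * s" by (auto simp: lat_def)
    show ?thesis unfolding eq
      by (subst bern_insert2)
         (simp_all only: I1 I2 I3 I4 P G2_def bern_add bern_cmult, auto)
  qed
  also have "\<dots> = r / (1 + r) * bern ({0} \<times> {1..m}) (lat r s) (G2 True)
    + (1 - r / (1 + r)) * bern ({0} \<times> {1..m}) (lat r s) (G2 False)"
    by (rule Suc.IH)
  also have "\<dots> = r / (1 + r) * bern ({0} \<times> {1..Suc m}) (lat r s) (g True)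
    + (1 - r / (1 + r)) * bern ({0} \<times> {1..Suc m}) (lat r s) (g False)"
  proof -
    have e2: "{0} \<times> {1..Suc m} = insert (0, Suc m) ({0} \<times> {1..m})" by (auto simp: atLeastAtMostSuc_conv)
    have P: "lat r s (0, Suc m) = s/(1+s)" by (auto simp: lat_def)
    define x1 x2 x3 x4 where "x1 = bern ({0} \<times> {1..m}) (lat r s) (g True)"
      and "x2 = bern ({0} \<times> {1..m}) (lat r s) (g False)"
      and "x3 = bern ({0} \<times> {1..m}) (lat r s) (\<lambda>c. g True (insert (0, Suc m) c))"
      and "x4 = bern ({0} \<times> {1..m}) (lat r s) (\<lambda>c. g False (insert (0, Suc m) c))"
    have "G2 True s' = s/(1+s) * g False s' + (1 - s/(1+s)) * g True s'" for s'
    proof -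
      have "S * (k * y + (1 - k) * y) + (1 - S) * (k * x + (1 - k) * x) = S * y + (1 - S) * x" for S k x y :: real
        by (simp add: algebra_simps)
      from this[of "s/(1+s)" "r * s" "g False s'" "g True s'"] show ?thesis by (simp add: G2_def W_def)
    qed
    then have Gt: "bern ({0} \<times> {1..m}) (lat r s) (G2 True) = s/(1+s) * x2 + (1 - s/(1+s)) * x1"
      using bern_cong[of "{0} \<times> {1..m}" "G2 True"] by (simp only: x1_def x2_def bern_add[symmetric] bern_cmult[symmetric])
    have "G2 False s' = s/(1+s) * g False (insert (0, Suc m) s') + (1 - s/(1+s)) *
        (r * s * g True (insert (0, Suc m) s') + (1 - r * s) * g False s')" for s'
    proof -
      have "S * (k * y + (1 - k) * y) + z = S * y + z" for S k y z :: real
        by (simp add: algebra_simps)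
      from this[of "s/(1+s)" "r * s"] show ?thesis by (simp add: G2_def W_def)
    qed
    then have Gf: "bern ({0} \<times> {1..m}) (lat r s) (G2 False) =
        s/(1+s) * x4 + (1 - s/(1+s)) * (r * s * x3 + (1 - r * s) * x2)"
      using bern_cong[of "{0} \<times> {1..m}" "G2 False"]
      by (simp only: x2_def x3_def x4_def bern_add[symmetric] bern_cmult[symmetric])
    have "1 + r \<noteq> 0" "1 + s \<noteq> 0" using assms by (auto simp: add_eq_0_iff)
    \<comment> \<open>The balance behind stationarity. A cell with both incoming increments emits
      none, and an empty one with an interior point emits both; these two cases must have equal
      weight, which forces the interior probability to be the product of the odds.\<close>
    then have key: "r/(1+r) * (s/(1+s)) = (1 - r/(1+r)) * (1 - s/(1+s)) * (r * s)"
      by (simp add: divide_simps)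
    have alg: "R * (S * x2 + (1 - S) * x1) + (1 - R) * (S * x4 + (1 - S) * (k * x3 + (1 - k) * x2))
        = R * (S * x3 + (1 - S) * x1) + (1 - R) * (S * x4 + (1 - S) * x2)"
      if "R * S = (1 - R) * (1 - S) * k" for R S k :: real
    proof -
      have "R * (S * x2 + (1 - S) * x1) + (1 - R) * (S * x4 + (1 - S) * (k * x3 + (1 - k) * x2))
        = R * (S * x3 + (1 - S) * x1) + (1 - R) * (S * x4 + (1 - S) * x2)
          + (x2 - x3) * (R * S - (1 - R) * (1 - S) * k)"
        by (simp add: algebra_simps)
      then show ?thesis using that by simp
    qed
    have "bern ({0} \<times> {1..Suc m}) (lat r s) (g True) = s/(1+s) * x3 + (1 - s/(1+s)) * x1"
      "bern ({0} \<times> {1..Suc m}) (lat r s) (g False) = s/(1+s) * x4 + (1 - s/(1+s)) * x2"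
      unfolding e2 x1_def x2_def x3_def x4_def P[symmetric] by (subst bern_insert; simp)+
    then show ?thesis using Gt Gf alg[OF key] by (simp only: )
  qed
  finally show ?case .
qed

lemma hinc_vinc_strip: "hinc (strip c) i j = (i > 0 \<and> hinc c (Suc i) j)" "vinc (strip c) i j = vinc c (Suc i) j"
proof (induction "strip c" i j and "strip c" i j rule: hinc_vinc.induct)
qed (auto simp: strip_def)

lemma hinc_vinc_axis: "hinc c i 0 = (i > 0 \<and> (i, 0) \<in> c)" "vinc c 0 j = (j > 0 \<and> (0, j) \<in> c)"
  by (cases i; simp) (cases j; simp)

lemma cnt_strip: "cnt c (Suc n) 0 = of_bool ((1, 0) \<in> c) + cnt (strip c) n 0"
  by (induction n) (simp_all add: cnt_Suc hinc_vinc_strip hinc_vinc_axis[of "strip c"] strip_def del: hinc.simps(3) vinc.simps)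

lemma lpp_strip: "lpp (Suc n) m c = of_bool ((1, 0) \<in> c) + lpp n m (strip c)"
  by (simp add: lpp_conservation cnt_strip flux_def hinc_vinc_strip)

text \<open>Columns \<open>0\<close> and \<open>1\<close> are integrated first, by
  \<open>strip_column\<close>. The others are only shifted, and \<open>lat\<close> does not see a
  shift among columns \<open>i \<ge> 1\<close>.\<close>

lemma bern_strip:
  assumes "r \<noteq> -1" "s \<noteq> -1"
  shows "bern (grid (Suc n) m) (lat r s) (\<lambda>c. f (strip c)) = bern (grid n m) (lat r s) f"
proof -
  define col where "col = insert (1, 0) ({0, 1} \<times> {1..m} :: (nat \<times> nat) set)"
  define R where "R = {1..n} \<times> {..m}"
  define \<phi> where "\<phi> = (\<lambda>(i, j). (Suc i, j :: nat))"
  have fin: "finite col" "finite R" and inj: "inj \<phi>" by (auto simp: col_def R_def \<phi>_def inj_def)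
  have \<phi>R: "\<phi> ` R = {2..Suc n} \<times> {..m}"
  proof (intro equalityI subsetI)
    fix x assume "x \<in> {2..Suc n} \<times> {..m}"
    then have "x = \<phi> (fst x - 1, snd x)" "(fst x - 1, snd x) \<in> R" by (auto simp: \<phi>_def R_def)
    then show "x \<in> \<phi> ` R" by blast
  qed (auto simp: \<phi>_def R_def)
  have "grid (Suc n) m = col \<union> \<phi> ` R" "col \<inter> \<phi> ` R = {}"
    unfolding \<phi>R by (auto simp: grid_def col_def)
  then have "bern (grid (Suc n) m) (lat r s) (\<lambda>c. f (strip c))
    = bern col (lat r s) (\<lambda>a. bern (\<phi> ` R) (lat r s) (\<lambda>b. f (strip (a \<union> b))))"
    using fin by (simp add: bern_union)
  also have "\<dots> = bern col (lat r s) (\<lambda>a. bern R (lat r s) (\<lambda>b. f ({(0, j) |j. j \<le> m \<and> vinc a 1 j} \<union> b)))"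
  proof (rule bern_cong[OF _ refl])
    fix a assume a: "a \<subseteq> col"
    have "bern (\<phi> ` R) (lat r s) (\<lambda>b. f (strip (a \<union> b))) = bern R (lat r s \<circ> \<phi>) (\<lambda>b. f (strip (a \<union> \<phi> ` b)))"
      using bern_reindex[OF fin(2) inj] .
    also have "\<dots> = bern R (lat r s) (\<lambda>b. f ({(0, j) |j. j \<le> m \<and> vinc a 1 j} \<union> b))"
    proof (rule bern_cong)
      fix b assume b: "b \<subseteq> R"
      have v: "vinc (a \<union> \<phi> ` b) 1 j = vinc a 1 j" for j
        using b by (intro hinc_vinc_cong) (auto simp: \<phi>_def R_def)
      have z: "j \<le> m" if "vinc a 1 j" for j
      proof (cases j)
        case (Suc k)
        with that have "(0, Suc k) \<in> a \<or> (1, Suc k) \<in> a" by auto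
        then show ?thesis using a Suc by (auto simp: col_def)
      qed simp
      have "strip (a \<union> \<phi> ` b) = {(0, j) |j. j \<le> m \<and> vinc a 1 j} \<union> b" (is "?l = ?r")
      proof (intro set_eqI)
        fix x :: "nat \<times> nat"
        obtain i j where x: "x = (i, j)" by fastforce
        show "x \<in> ?l \<longleftrightarrow> x \<in> ?r"
        proof (cases i)
          case 0
          then show ?thesis using b z v by (auto simp: strip_def x R_def)
        next
          case (Suc k)
          have "(Suc (Suc k), j) \<in> \<phi> ` b \<longleftrightarrow> (Suc k, j) \<in> b"
            by (force simp: \<phi>_def)
          moreover have "(Suc (Suc k), j) \<notin> a" using a by (auto simp: col_def)
          ultimately show ?thesis using Suc by (auto simp: strip_def x)
        qed
      qed
      then show "f (strip (a \<union> \<phi> ` b)) = f ({(0, j) |j. j \<le> m \<and> vinc a 1 j} \<union> b)" by simp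
    qed (auto simp: \<phi>_def R_def lat_def)
    finally show "bern (\<phi> ` R) (lat r s) (\<lambda>b. f (strip (a \<union> b)))
       = bern R (lat r s) (\<lambda>b. f ({(0, j) |j. j \<le> m \<and> vinc a 1 j} \<union> b))" .
  qed
  also have "\<dots> = bern ({0} \<times> {1..m}) (lat r s) (\<lambda>a. bern R (lat r s) (\<lambda>b. f (a \<union> b)))"
    unfolding col_def
    using strip_column[OF assms, where g="\<lambda>_ V. bern R (lat r s) (\<lambda>b. f (V \<union> b))"]
    by (simp add: algebra_simps)
  also have "\<dots> = bern ({0} \<times> {1..m} \<union> R) (lat r s) f"
    using fin by (subst bern_union) (auto simp: R_def)
  also have "{0} \<times> {1..m} \<union> R = grid n m" by (auto simp: grid_def R_def)
  finally show ?thesis .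
qed

lemma bern_grid_swap:
  "bern (grid n m) (lat r s) f = bern (grid m n) (lat s r) (\<lambda>c. f (prod.swap ` c))"
proof -
  have "grid n m = prod.swap ` grid m n" by (simp add: grid_def image_set_diff[OF inj_swap] product_swap)
  then have "bern (grid n m) (lat r s) f = bern (grid m n) (lat r s \<circ> prod.swap) (\<lambda>c. f (prod.swap ` c))"
    by (simp add: bern_reindex)
  also have "\<dots> = bern (grid m n) (lat s r) (\<lambda>c. f (prod.swap ` c))"
  proof (rule bern_cong[OF refl])
    fix g assume "g \<in> grid m n"
    moreover obtain i j where "g = (i, j)" by fastforce
    ultimately show "(lat r s \<circ> prod.swap) g = lat s r g"
      by (cases "i = 0"; cases "j = 0") (simp_all add: lat_def grid_def mult.commute)
  qed
  finally show ?thesis .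
qed

lemma flip_swap: "flip (i, j) (lpp n m) (prod.swap ` c) = flip (j, i) (lpp m n) c"
proof -
  have "insert (i, j) (prod.swap ` c) = prod.swap ` insert (j, i) c"
    "prod.swap ` c - {(i, j)} = prod.swap ` (c - {(j, i)})" by auto
  then show ?thesis by (simp only: flip_def lpp_swap)
qed

text \<open>A point beyond the first column cannot influence the right border of that column, so
  adding it commutes with \<open>strip\<close>.\<close>

lemma flip_strip:
  assumes "i \<ge> 1"
  shows "flip (Suc i, j) (lpp (Suc n) m) c = flip (i, j) (lpp n m) (strip c)"
proof -
  have "strip (insert (Suc i, j) c) = insert (i, j) (strip c)" "strip (c - {(Suc i, j)}) = strip c - {(i, j)}"
  proof -
    have "vinc (insert (Suc i, j) c) 1 k = vinc c 1 k" "vinc (c - {(Suc i, j)}) 1 k = vinc c 1 k" for k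
      using assms by (auto intro!: hinc_vinc_cong)
    then show "strip (insert (Suc i, j) c) = insert (i, j) (strip c)" "strip (c - {(Suc i, j)}) = strip c - {(i, j)}"
      using assms by (auto simp: strip_def gr0_conv_Suc Suc_le_eq)
  qed
  then show ?thesis using assms by (simp add: flip_def lpp_strip)
qed

context
  fixes r s :: real
  assumes pos: "r > 0" "s > 0"
begin

text \<open>Each \<open>strip\<close> moves the point and the upper corner to the left together and
  preserves the law, so only their distance matters.\<close>

lemma bern_flip_column:
  assumes "i \<ge> 1"
  shows "bern (grid (n + d) m) (lat r s) (flip (i + d, j) (lpp (n + d) m)) = bern (grid n m) (lat r s) (flip (i, j) (lpp n m))"
proof (induction d)
  case (Suc d)
  have "bern (grid (Suc (n + d)) m) (lat r s) (flip (Suc (i + d), j) (lpp (Suc (n + d)) m))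
     = bern (grid (Suc (n + d)) m) (lat r s) (\<lambda>c. flip (i + d, j) (lpp (n + d) m) (strip c))"
    by (intro bern_cong) (use assms in \<open>auto simp: flip_strip\<close>)
  also have "\<dots> = bern (grid (n + d) m) (lat r s) (flip (i + d, j) (lpp (n + d) m))"
    using pos by (intro bern_strip) auto
  finally show ?case using Suc by simp
qed simp

text \<open>Every stripped column contributes the mean of its source; in the end only the vertical
  axis is left.\<close>

lemma expectation_lpp: "bern (grid n m) (lat r s) (lpp n m) = n * (r / (1 + r)) + m * (s / (1 + s))"
proof (induction n)
  case 0
  have "bern (grid 0 m) (lat r s) (lpp 0 m) = (\<Sum>l=1..m. bern (grid 0 m) (lat r s) (\<lambda>c. of_bool ((0, l) \<in> c)))"
    unfolding bern_sum[symmetric]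
    by (intro bern_cong refl) (auto simp: lpp_def flux_def hinc_vinc_axis intro!: sum.cong simp del: sum_of_bool_eq)
  also have "\<dots> = (\<Sum>l=1..m. s / (1 + s))"
  proof (intro sum.cong refl)
    fix l assume "l \<in> {1..m}"
    then have "(0, l) \<in> grid 0 m" and "lat r s (0, l) = s / (1 + s)" by (auto simp: grid_def lat_def)
    then show "bern (grid 0 m) (lat r s) (\<lambda>c. of_bool ((0, l) \<in> c)) = s / (1 + s)"
      by (subst bern_split[where g="(0, l)"]) (auto simp: bern_const)
  qed
  finally show ?case by simp
next
  case (Suc n)
  have "(1, 0) \<in> grid (Suc n) m" and "lat r s (1, 0) = r / (1 + r)" by (auto simp: grid_def lat_def)
  then have "bern (grid (Suc n) m) (lat r s) (\<lambda>c. of_bool ((1, 0) \<in> c)) = r / (1 + r)"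
    by (subst bern_split[where g="(1, 0)"]) (auto simp: bern_const)
  moreover have "bern (grid (Suc n) m) (lat r s) (lpp (Suc n) m) =
      bern (grid (Suc n) m) (lat r s) (\<lambda>c. of_bool ((1, 0) \<in> c)) + bern (grid (Suc n) m) (lat r s) (\<lambda>c. lpp n m (strip c))"
    unfolding bern_add[symmetric] by (intro bern_cong) (auto simp: lpp_strip)
  moreover have "bern (grid (Suc n) m) (lat r s) (\<lambda>c. lpp n m (strip c)) = bern (grid n m) (lat r s) (lpp n m)"
    using pos by (intro bern_strip) auto
  ultimately show ?case using Suc by (simp add: algebra_simps add_divide_distrib)
qed

text \<open>After \<open>n\<close> strips the right edge has become the vertical axis, so its flux
  is in law a sum of independent Bernoulli variables. This is what makes its variance known.\<close>

lemma bern_flux: "bern (grid n m) (lat r s) (\<lambda>c. h (flux c n m)) = bern (grid 0 m) (lat r s) (\<lambda>c. h (flux c 0 m))"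
proof (induction n)
  case (Suc n)
  have "flux c (Suc n) m = flux (strip c) n m" for c by (simp add: flux_def hinc_vinc_strip)
  then have "bern (grid (Suc n) m) (lat r s) (\<lambda>c. h (flux c (Suc n) m)) = bern (grid n m) (lat r s) (\<lambda>c. h (flux c n m))"
    using pos bern_strip[of r s n m "\<lambda>c. h (flux c n m)"] by simp
  with Suc show ?case by simp
qed simp

end

section \<open>The identity on the lattice\<close>

text \<open>The probability that a second class particle from the origin has not left the rectangle
  through its right edge.\<close>

definition survive :: "real \<Rightarrow> real \<Rightarrow> nat \<Rightarrow> nat \<Rightarrow> real" where
  "survive r s n m = bern (grid n m) (lat r s) (flip (1, 0) (lpp n m))"

text \<open>The lattice version of the probability that the upper corner lies between the two second
  class particles before they meet.\<close>

definition enclosed :: "real \<Rightarrow> real \<Rightarrow> nat \<Rightarrow> nat \<Rightarrow> real" where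
  "enclosed r s n m = bern (grid n m) (lat r s) (flip (1, 1) (lpp n m))"

context
  fixes r s :: real
  assumes pos: "r > 0" "s > 0"
begin

lemma bern_flip_source:
  assumes "1 \<le> i" "i \<le> n"
  shows "bern (grid n m) (lat r s) (flip (i, 0) (lpp n m)) = survive r s (n + 1 - i) m"
  using bern_flip_column[OF pos, of 1 "n + 1 - i" "i - 1" m 0] assms by (simp add: survive_def)

text \<open>Columns are stripped first; after an exchange of the axes the same stripping shortens
  the other coordinate.\<close>

lemma bern_flip_alpha:
  assumes "1 \<le> i" "i \<le> n" "1 \<le> j" "j \<le> m"
  shows "bern (grid n m) (lat r s) (flip (i, j) (lpp n m)) = enclosed r s (n + 1 - i) (m + 1 - j)"
proof -
  have "bern (grid n m) (lat r s) (flip (i, j) (lpp n m)) = bern (grid (n + 1 - i) m) (lat r s) (flip (1, j) (lpp (n + 1 - i) m))"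
    using bern_flip_column[OF pos, of 1 "n + 1 - i" "i - 1" m j] assms by simp
  also have "\<dots> = bern (grid m (n + 1 - i)) (lat s r) (flip (j, 1) (lpp m (n + 1 - i)))"
    by (subst bern_grid_swap) (simp add: flip_swap)
  also have "\<dots> = bern (grid (m + 1 - j) (n + 1 - i)) (lat s r) (flip (1, 1) (lpp (m + 1 - j) (n + 1 - i)))"
    using bern_flip_column[OF pos(2,1), of 1 "m + 1 - j" "j - 1" "n + 1 - i" 1] assms by simp
  also have "\<dots> = enclosed r s (n + 1 - i) (m + 1 - j)"
    unfolding enclosed_def by (subst bern_grid_swap) (simp add: flip_swap)
  finally show ?thesis .
qed

lemma bern_flip_sink:
  assumes "1 \<le> j" "j \<le> m"
  shows "bern (grid n m) (lat r s) (flip (0, j) (lpp n m)) = survive s r (m + 1 - j) n"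
proof -
  have "bern (grid n m) (lat r s) (flip (0, j) (lpp n m)) = bern (grid m n) (lat s r) (flip (j, 0) (lpp m n))"
    by (subst bern_grid_swap) (simp add: flip_swap)
  then show ?thesis
    using bern_flip_column[OF pos(2,1), of 1 "m + 1 - j" "j - 1" n 0] assms by (simp add: survive_def)
qed

end

lemma sum_grid:
  "(\<Sum>g\<in>grid n m. F g) = (\<Sum>i=1..n. F (i, 0)) + (\<Sum>j=1..m. F (0, j)) + (\<Sum>i=1..n. \<Sum>j=1..m. F (i, j) :: real)"
proof -
  have g: "grid n m = ({1..n} \<times> {0} \<union> {0} \<times> {1..m}) \<union> {1..n} \<times> {1..m}" by (auto simp: grid_def)
  have "sum F (A \<times> B) = (\<Sum>i\<in>A. \<Sum>j\<in>B. F (i, j))" for A B :: "nat set"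
    by (simp add: sum.cartesian_product)
  moreover have "sum F (grid n m) = sum F ({1..n} \<times> {0}) + sum F ({0} \<times> {1..m}) + sum F ({1..n} \<times> {1..m})"
    unfolding g by (subst sum.union_disjoint, simp, simp, force, subst sum.union_disjoint) auto
  ultimately show ?thesis by simp
qed

lemma sum_rev: "(\<Sum>i=1..n. f (n + 1 - i)) = (\<Sum>i=1..n. f i :: real)" for n :: nat
  by (rule sum.reindex_bij_witness[of _ "\<lambda>i. n + 1 - i" "\<lambda>i. n + 1 - i"]) auto

text \<open>The derivative at \<open>\<theta> = 1\<close> of the expectation when both axis odds are multiplied by \<open>\<theta>\<close>.\<close>

lemma lattice_identity:
  assumes pos: "r > 0" "s > 0"
  shows "n * (r / (1 + r)\<^sup>2) + m * (s / (1 + s)\<^sup>2) =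
     r / (1 + r)\<^sup>2 * (\<Sum>k=1..n. survive r s k m) + s / (1 + s)\<^sup>2 * (\<Sum>k=1..m. survive s r k n)
     + 2 * r * s * (\<Sum>k=1..n. \<Sum>l=1..m. enclosed r s k l)"
proof -
  \<comment> \<open>Multiplying both odds by \<theta> multiplies the interior probability by its
    square, so \<open>expectation_lpp\<close> still applies, and the interior derivative is
    \<open>2 * r * s\<close>.\<close>
  define P where "P = (\<lambda>\<theta>. lat (\<theta> * r) (\<theta> * s))"
  define P' where "P' = (\<lambda>(i, j). if j = (0::nat) then r / (1 + r)\<^sup>2 else if i = (0::nat) then s / (1 + s)\<^sup>2 else 2 * r * s)"
  have axis: "((\<lambda>\<theta>. \<theta> * q / (1 + \<theta> * q)) has_real_derivative q / (1 + q)\<^sup>2) (at 1)" if "q > 0" for q :: real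
    using that by (auto intro!: derivative_eq_intros simp: power2_eq_square algebra_simps)
  have "((\<lambda>\<theta>. bern (grid n m) (P \<theta>) (lpp n m)) has_real_derivative
      (\<Sum>g\<in>grid n m. P' g * bern (grid n m) (P 1) (flip g (lpp n m)))) (at 1)"
  proof (rule bern_has_derivative)
    fix g assume "g \<in> grid n m"
    obtain i j where g: "g = (i, j)" by fastforce
    have "((\<lambda>\<theta>. \<theta> * r * (\<theta> * s)) has_real_derivative 2 * r * s) (at 1)"
      by (auto intro!: derivative_eq_intros)
    then show "((\<lambda>\<theta>. P \<theta> g) has_real_derivative P' g) (at 1)"
      using axis pos by (simp add: P_def P'_def lat_def g)
  qed simp
  moreover have "((\<lambda>\<theta>. bern (grid n m) (P \<theta>) (lpp n m)) has_real_derivative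
      n * (r / (1 + r)\<^sup>2) + m * (s / (1 + s)\<^sup>2)) (at 1)"
  proof (rule has_field_derivative_transform_within_open[where S="{0<..}"])
    show "((\<lambda>\<theta>. n * (\<theta> * r / (1 + \<theta> * r)) + m * (\<theta> * s / (1 + \<theta> * s))) has_real_derivative
      n * (r / (1 + r)\<^sup>2) + m * (s / (1 + s)\<^sup>2)) (at 1)"
      using axis pos by (intro DERIV_add DERIV_cmult) auto
  qed (use pos in \<open>auto simp: P_def expectation_lpp\<close>)
  ultimately have "n * (r / (1 + r)\<^sup>2) + m * (s / (1 + s)\<^sup>2) =
    (\<Sum>g\<in>grid n m. P' g * bern (grid n m) (lat r s) (flip g (lpp n m)))"
    using DERIV_unique by (fastforce simp: P_def)
  also have "\<dots> = (\<Sum>i=1..n. r / (1 + r)\<^sup>2 * survive r s (n + 1 - i) m)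
     + (\<Sum>j=1..m. s / (1 + s)\<^sup>2 * survive s r (m + 1 - j) n)
     + (\<Sum>i=1..n. \<Sum>j=1..m. 2 * r * s * enclosed r s (n + 1 - i) (m + 1 - j))"
    unfolding sum_grid
    by (intro arg_cong2[where f="(+)"] sum.cong refl)
       (auto simp: P'_def bern_flip_source[OF pos] bern_flip_sink[OF pos] bern_flip_alpha[OF pos])
  also have "\<dots> = r / (1 + r)\<^sup>2 * (\<Sum>k=1..n. survive r s k m) + s / (1 + s)\<^sup>2 * (\<Sum>k=1..m. survive s r k n)
     + 2 * r * s * (\<Sum>k=1..n. \<Sum>l=1..m. enclosed r s k l)"
  proof -
    have "(\<Sum>i=1..n. \<Sum>j=1..m. enclosed r s (n + 1 - i) (m + 1 - j)) = (\<Sum>i=1..n. \<Sum>l=1..m. enclosed r s (n + 1 - i) l)"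
      by (intro sum.cong refl sum_rev)
    also have "\<dots> = (\<Sum>k=1..n. \<Sum>l=1..m. enclosed r s k l)"
      by (rule sum_rev)
    finally show ?thesis
      using sum_rev[of "\<lambda>k. survive r s k m" n] sum_rev[of "\<lambda>k. survive s r k n" m]
      by (simp only: sum_distrib_left[symmetric])
  qed
  finally show ?thesis .
qed

section \<open>Survival of the second class particle\<close>

text \<open>An additional source means more particles and less flux: the surplus is either still
  present as a particle or has been used up by suppressing a crossing.\<close>

lemma flip_source_mono:
  "(hinc (c - {(1, 0)}) i j \<longrightarrow> hinc (insert (1, 0) c) i j) \<and> (vinc (insert (1, 0) c) i j \<longrightarrow> vinc (c - {(1, 0)}) i j)"
proof (induction i arbitrary: j)
  case 0
  then show ?case by (cases j) auto
next
  case (Suc i)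
  note column = Suc.IH
  show ?case
  proof (induction j)
    case (Suc j)
    then show ?case using column[of "Suc j"] by auto
  qed auto
qed

lemma flip_source_cnt: "flip (1, 0) (lpp n m) c = cnt (insert (1, 0) c) n m - cnt (c - {(1, 0)}) n m"
  by (simp add: flip_def lpp_def flux_def hinc_vinc_axis)

text \<open>Along the left and top edges only the particle count changes, and it grows; this gives
  the lower bound and the monotonicity in \<open>n\<close>. Along the bottom and right edges the
  source count grows by at most one and the flux falls; this gives the upper bound.\<close>

lemma flip_source_bounds:
  "0 \<le> flip (1, 0) (lpp n m) c" "flip (1, 0) (lpp n m) c \<le> 1"
  "flip (1, 0) (lpp n m) c \<le> flip (1, 0) (lpp (Suc n) m) c"
proof -
  show "0 \<le> flip (1, 0) (lpp n m) c"
    unfolding flip_source_cnt diff_ge_0_iff_ge cnt_def using flip_source_mono[of c]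
    by (intro sum_mono) auto
  have "flux (insert (1, 0) c) n m \<le> flux (c - {(1, 0)}) n m"
    unfolding flux_def using flip_source_mono[of c] by (intro sum_mono) auto
  moreover have "cnt (insert (1, 0) c) n 0 - cnt (c - {(1, 0)}) n 0 \<le> 1"
  proof -
    have "cnt (insert (1, 0) c) n 0 - cnt (c - {(1, 0)}) n 0 \<le> (\<Sum>k=1..n. of_bool (k = 1))"
      unfolding cnt_def sum_subtractf[symmetric] by (intro sum_mono) (auto simp: hinc_vinc_axis)
    also have "\<dots> \<le> 1" by (auto simp: card_le_Suc0_iff_eq)
    finally show ?thesis .
  qed
  ultimately show "flip (1, 0) (lpp n m) c \<le> 1" by (simp add: flip_def lpp_conservation)
  show "flip (1, 0) (lpp n m) c \<le> flip (1, 0) (lpp (Suc n) m) c"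
    unfolding flip_source_cnt cnt_Suc using flip_source_mono[of c "Suc n" m] by simp
qed

lemma flip_source_cong: "n \<le> n' \<Longrightarrow> m \<le> m' \<Longrightarrow> flip g (lpp n m) (c \<inter> grid n' m') = flip g (lpp n m) c" if "g \<in> grid n' m'"
proof -
  assume a: "n \<le> n'" "m \<le> m'"
  have "insert g (c \<inter> grid n' m') = insert g c \<inter> grid n' m'" "(c \<inter> grid n' m') - {g} = (c - {g}) \<inter> grid n' m'"
    using that by auto
  then show ?thesis unfolding flip_def using a by (simp add: lpp_grid del: insert_disjoint Int_insert_left Int_insert_right)
qed

lemma bern_grid_flip:
  assumes "g \<in> grid n m" "n \<le> n'" "m \<le> m'"
  shows "bern (grid n' m') P (\<lambda>c. h (flip g (lpp n m) c)) = bern (grid n m) P (\<lambda>c. h (flip g (lpp n m) c))"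
proof (rule bern_subset)
  show "grid n m \<subseteq> grid n' m'" using assms by (auto simp: grid_def)
  show "h (flip g (lpp n m) (c \<inter> grid n m)) = h (flip g (lpp n m) c)" for c
    using flip_source_cong[OF assms(1) order_refl order_refl] by simp
qed simp

context
  fixes r s :: real
  assumes pos: "r > 0" "s > 0" and rs: "r * s \<le> 1"
begin

lemma lat_prob: "0 \<le> lat r s g \<and> lat r s g \<le> 1"
  using pos rs by (auto simp: lat_def split: prod.splits)

lemma survive_bounds:
  "0 \<le> survive r s n m" "survive r s n m \<le> 1" "n \<ge> 1 \<Longrightarrow> survive r s n m \<le> survive r s (Suc n) m"
proof -
  show "0 \<le> survive r s n m"
    using bern_mono[of "grid n m" "lat r s" "\<lambda>_. 0" "flip (1, 0) (lpp n m)"] lat_prob flip_source_bounds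
    by (simp add: survive_def bern_const)
  show "survive r s n m \<le> 1"
    using bern_mono[of "grid n m" "lat r s" "flip (1, 0) (lpp n m)" "\<lambda>_. 1"] lat_prob flip_source_bounds
    by (simp add: survive_def bern_const)
  assume "n \<ge> 1"
  then have "survive r s n m = bern (grid (Suc n) m) (lat r s) (flip (1, 0) (lpp n m))"
    unfolding survive_def by (intro bern_grid_flip[where h="\<lambda>x. x", symmetric]) (auto simp: grid_def)
  then show "survive r s n m \<le> survive r s (Suc n) m"
    unfolding survive_def by (simp only:) (intro bern_mono lat_prob flip_source_bounds)
qed

lemma survive_mono: "n \<le> n' \<Longrightarrow> 1 \<le> n \<Longrightarrow> survive r s n m \<le> survive r s n' m"
proof (induction n' rule: dec_induct)
  case (step k)
  then show ?case using survive_bounds(3)[of k m] by linarith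
qed simp

text \<open>The variance is the sum of the covariances of the single indicators with the whole sum,
  which changes by exactly one when a point is added.\<close>

lemma bern_variance:
  fixes p :: real
  assumes "finite G" "I \<subseteq> G" "\<And>i. i \<in> I \<Longrightarrow> P i = p"
  shows "bern G P (\<lambda>c. (\<Sum>i\<in>I. of_bool (i \<in> c) - p)\<^sup>2) = card I * (p * (1 - p))"
proof -
  have fI: "finite I" using assms finite_subset by auto
  let ?N = "\<lambda>c. \<Sum>i\<in>I. of_bool (i \<in> c) - p"
  have "bern G P (\<lambda>c. (?N c)\<^sup>2) = (\<Sum>i\<in>I. bern G P (\<lambda>c. (of_bool (i \<in> c) - P i) * ?N c))"
    unfolding bern_sum[symmetric] power2_eq_square sum_distrib_right using assms(3) by (intro bern_cong) auto
  also have "\<dots> = (\<Sum>i\<in>I. p * (1 - p))"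
  proof (intro sum.cong refl)
    fix i assume i: "i \<in> I"
    have "flip i ?N c = 1" for c
    proof -
      have "flip i ?N c = (\<Sum>k\<in>I. of_bool (k = i))"
        unfolding flip_def sum_subtractf[symmetric] by (intro sum.cong) auto
      also have "\<dots> = 1"
      proof -
        have "(\<Sum>k\<in>I. of_bool (k = i)) = (\<Sum>k\<in>I. if k = i then 1 else 0 :: real)" by (intro sum.cong) auto
        then show ?thesis using i fI by simp
      qed
      finally show ?thesis .
    qed
    then have "flip i ?N = (\<lambda>_. 1)" by blast
    then show "bern G P (\<lambda>c. (of_bool (i \<in> c) - P i) * ?N c) = p * (1 - p)"
      using assms i by (subst bern_covariance) (auto simp: bern_const)
  qed
  finally show ?thesis by simp
qed

text \<open>The sum on the left is, up to a factor, minus the covariance of the number of sources and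
  the flux through the right edge, and both variances are known.\<close>

lemma survive_deficit:
  fixes n m :: nat and R S \<epsilon> :: real
  assumes R_def: "R = r / (1 + r)" and S_def: "S = s / (1 + s)" and "\<epsilon> > 0"
  shows "R * (1 - R) * (\<Sum>k=1..n. 1 - survive r s k m) \<le> (\<epsilon> * (n * (R * (1 - R))) + m * (S * (1 - S)) / \<epsilon>) / 2"
proof -
  define N where "N = (\<lambda>c. \<Sum>g\<in>{1..n} \<times> {0::nat}. of_bool (g \<in> c) - R)"
  define J where "J = (\<lambda>c. flux c n m - m * S)"
  let ?E = "bern (grid n m) (lat r s)"
  have "?E (\<lambda>c. N c * J c) = (\<Sum>g\<in>{1..n} \<times> {0::nat}. ?E (\<lambda>c. (of_bool (g \<in> c) - lat r s g) * J c))"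
    unfolding bern_sum[symmetric] N_def sum_distrib_right
    by (intro bern_cong[OF _ refl] sum.cong refl) (auto simp: lat_def R_def)
  also have "\<dots> = (\<Sum>g\<in>{1..n} \<times> {0::nat}. R * (1 - R) * (survive r s (n + 1 - fst g) m - 1))"
  proof (intro sum.cong refl)
    fix g :: "nat \<times> nat" assume "g \<in> {1..n} \<times> {0}"
    then obtain i where g: "g = (i, 0)" and i: "1 \<le> i" "i \<le> n" by auto
    have "cnt (insert (i, 0) c) n 0 - cnt (c - {(i, 0)}) n 0 = 1" for c
    proof -
      have "cnt (insert (i, 0) c) n 0 - cnt (c - {(i, 0)}) n 0 = (\<Sum>k\<in>{1..n}. if k = i then 1 else 0)"
        unfolding cnt_def sum_subtractf[symmetric] using i by (intro sum.cong) (auto simp: hinc_vinc_axis)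
      then show ?thesis using i by simp
    qed
    \<comment> \<open>\<open>lpp\<close> is the number of sources plus the flux through the right
      edge, and the former grows by one.\<close>
    then have "flip g J = (\<lambda>c. flip (i, 0) (lpp n m) c - 1)"
      by (simp add: fun_eq_iff flip_def J_def lpp_conservation g algebra_simps)
    then have "?E (flip g J) = survive r s (n + 1 - i) m - 1"
      using bern_flip_source[OF pos i] by (simp add: bern_diff bern_const)
    moreover have "g \<in> grid n m" "lat r s g = R" using i by (auto simp: g grid_def lat_def R_def)
    ultimately show "?E (\<lambda>c. (of_bool (g \<in> c) - lat r s g) * J c) = R * (1 - R) * (survive r s (n + 1 - fst g) m - 1)"
      using bern_covariance[OF finite_grid, of g n m "lat r s" J] by (simp add: g)
  qed
  also have "\<dots> = (\<Sum>i=1..n. R * (1 - R) * (survive r s (n + 1 - i) m - 1))"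
    by (rule sum.reindex_bij_witness[of _ "\<lambda>i. (i, 0)" fst]) auto
  also have "\<dots> = (\<Sum>k=1..n. R * (1 - R) * (survive r s k m - 1))"
    by (rule sum_rev)
  also have "\<dots> = - (R * (1 - R) * (\<Sum>k=1..n. 1 - survive r s k m))"
    unfolding sum_distrib_left[symmetric] by (simp add: sum_subtractf right_diff_distrib)
  finally have cov: "R * (1 - R) * (\<Sum>k=1..n. 1 - survive r s k m) = - ?E (\<lambda>c. N c * J c)" by simp
  have "- ?E (\<lambda>c. N c * J c) = ?E (\<lambda>c. - 1 * (N c * J c))" by (subst bern_cmult) simp
  \<comment> \<open>Cauchy's inequality in additive form; the weight \<open>\<epsilon>\<close> is
    chosen only in \<open>dead_bound\<close>.\<close>
  also have "\<dots> \<le> ?E (\<lambda>c. \<epsilon> / 2 * (N c)\<^sup>2 + 1 / (2 * \<epsilon>) * (J c)\<^sup>2)"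
  proof (intro bern_mono lat_prob)
    fix c
    have "0 \<le> (\<epsilon> * N c + J c)\<^sup>2 / (2 * \<epsilon>)" using \<open>\<epsilon> > 0\<close> by simp
    also have "\<dots> = \<epsilon> / 2 * (N c)\<^sup>2 + 1 / (2 * \<epsilon>) * (J c)\<^sup>2 + N c * J c"
      using \<open>\<epsilon> > 0\<close>
      by (simp add: power2_sum add_divide_distrib power_mult_distrib power2_eq_square[of \<epsilon>])
    finally show "- 1 * (N c * J c) \<le> \<epsilon> / 2 * (N c)\<^sup>2 + 1 / (2 * \<epsilon>) * (J c)\<^sup>2" by simp
  qed
  also have "\<dots> = \<epsilon> / 2 * ?E (\<lambda>c. (N c)\<^sup>2) + 1 / (2 * \<epsilon>) * ?E (\<lambda>c. (J c)\<^sup>2)"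
    by (simp only: bern_add bern_cmult)
  also have "?E (\<lambda>c. (N c)\<^sup>2) = n * (R * (1 - R))"
    unfolding N_def by (subst bern_variance) (auto simp: grid_def lat_def R_def card_cartesian_product)
  also have "?E (\<lambda>c. (J c)\<^sup>2) = m * (S * (1 - S))"
  proof -
    have "?E (\<lambda>c. (J c)\<^sup>2) = bern (grid 0 m) (lat r s) (\<lambda>c. (flux c 0 m - m * S)\<^sup>2)"
      unfolding J_def by (rule bern_flux[OF pos, where h="\<lambda>x. (x - m * S)\<^sup>2"])
    also have "\<dots> = bern (grid 0 m) (lat r s) (\<lambda>c. (\<Sum>g\<in>{0} \<times> {1..m}. of_bool (g \<in> c) - S)\<^sup>2)"
    proof -
      have "flux c 0 m - m * S = (\<Sum>g\<in>{0} \<times> {1..m}. of_bool (g \<in> c) - S)" for c :: "(nat \<times> nat) set"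
      proof -
        have "(\<Sum>g\<in>{0::nat} \<times> {1..m}. of_bool (g \<in> c) - S) = (\<Sum>l=1..m. of_bool ((0, l) \<in> c) - S)"
          by (rule sum.reindex_bij_witness[of _ "\<lambda>i. (0, i)" snd]) auto
        also have "\<dots> = (\<Sum>l=1..m. of_bool ((0, l) \<in> c)) - m * S" by (simp add: sum_subtractf del: sum_of_bool_eq)
        also have "(\<Sum>l=1..m. of_bool ((0, l) \<in> c)) = flux c 0 m"
          unfolding flux_def by (intro sum.cong) (auto simp: hinc_vinc_axis)
        finally show ?thesis by simp
      qed
      then show ?thesis by simp
    qed
    also have "\<dots> = m * (S * (1 - S))"
      by (subst bern_variance) (auto simp: grid_def lat_def S_def card_cartesian_product)
    finally show ?thesis .
  qed
  also have "\<epsilon> / 2 * a + 1 / (2 * \<epsilon>) * b = (\<epsilon> * a + b / \<epsilon>) / 2" for a b :: real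
    by (simp add: add_divide_distrib)
  finally show ?thesis using cov by (simp only:)
qed

end

section \<open>Deleting the leftmost source on the lattice\<close>

definition drop_first :: "(nat \<times> nat) set \<Rightarrow> (nat \<times> nat) set" where
  "drop_first c = c - {(i, 0) |i. (i, 0) \<in> c \<and> (\<forall>k. (k, 0) \<in> c \<longrightarrow> i \<le> k)}"

lemma bern_avoid:
  assumes "finite G" "I \<subseteq> G"
  shows "bern G P (\<lambda>c. of_bool (c \<inter> I = {})) = (\<Prod>i\<in>I. 1 - P i)"
proof -
  have fI: "finite I" using assms finite_subset by auto
  have "bern G P (\<lambda>c. of_bool (c \<inter> I = {})) = bern I P (\<lambda>c. of_bool (c \<inter> I = {}))"
    by (rule bern_subset) (use assms in auto)
  also have "\<dots> = bern I P (\<lambda>c. of_bool (c = {}))"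
    by (rule bern_cong) auto
  also have "\<dots> = (\<Prod>i\<in>I. 1 - P i)"
    using fI by (induction I rule: finite_induct) (simp_all add: bern_insert bern_const)
  finally show ?thesis .
qed

text \<open>Stripping the columns to the left of the source turns it into one in the first
  column.\<close>

lemma flip_le_1:
  assumes "1 \<le> i" "i \<le> n"
  shows "flip (i, 0) (lpp n m) c \<le> 1"
  using assms
proof (induction i arbitrary: n c rule: nat_induct_at_least)
  case (Suc i)
  then obtain n' where n: "n = Suc n'" by (cases n) auto
  then show ?case using Suc flip_strip[of i 0 n' m c] by simp
qed (simp add: flip_source_bounds(2)[simplified])

text \<open>Deleting the leftmost source is without effect when the dual particle has left the
  rectangle. Then either the first \<open>k\<close> columns contain no source, or one of them
  contains a source whose effect is zero. Presence and effect are independent, and the effect is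
  smallest for the source nearest to the right edge, at distance at least
  \<open>n - k\<close>.\<close>

lemma drop_first_bound:
  assumes pos: "r > 0" "s > 0" and rs: "r * s \<le> 1" and k: "k < n"
  shows "bern (grid n m) (lat r s) (\<lambda>c. of_bool (lpp n m (drop_first c) = lpp n m c))
     \<le> k * (r / (1 + r)) * (1 - survive r s (n - k) m) + (1 - r / (1 + r)) ^ k"
proof -
  let ?E = "bern (grid n m) (lat r s)"
  let ?I = "{1..k} \<times> {0::nat}"
  define f where "f = (\<lambda>i c. of_bool ((i, 0) \<in> c) * (1 - flip (i, 0) (lpp n m) c))"
  have "?E (\<lambda>c. of_bool (lpp n m (drop_first c) = lpp n m c)) \<le> ?E (\<lambda>c. (\<Sum>i=1..k. f i c) + of_bool (c \<inter> ?I = {}))"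
  proof (intro bern_mono lat_prob pos rs)
    fix c assume c: "c \<subseteq> grid n m"
    have f0: "0 \<le> f i c" if "i \<in> {1..k}" for i
      using that k flip_le_1[of i n m c] by (auto simp: f_def)
    show "of_bool (lpp n m (drop_first c) = lpp n m c) \<le> (\<Sum>i=1..k. f i c) + of_bool (c \<inter> ?I = {})"
    proof (cases "c \<inter> ?I = {} \<or> lpp n m (drop_first c) \<noteq> lpp n m c")
      case False
      then have "c \<inter> ?I \<noteq> {}" by blast
      then obtain i where i: "(i, 0) \<in> c" "1 \<le> i" "i \<le> k" by auto
      define i0 where "i0 = (LEAST i. (i, 0) \<in> c)"
      have i0: "(i0, 0) \<in> c" "(j, 0) \<in> c \<Longrightarrow> i0 \<le> j" for j
        unfolding i0_def using i(1) by (rule LeastI) (rule Least_le)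
      moreover have "i0 \<noteq> 0" using i0(1) c by (auto simp: grid_def)
      ultimately have i0k: "i0 \<in> {1..k}" using order_trans[OF i0(2)[OF i(1)] i(3)] by simp
      have "drop_first c = c - {(i0, 0)}"
      proof -
        have "{(i, 0) |i. (i, 0) \<in> c \<and> (\<forall>k. (k, 0) \<in> c \<longrightarrow> i \<le> k)} = {(i0, 0::nat)}"
        proof (intro equalityI subsetI)
          fix x assume "x \<in> {(i, 0) |i. (i, 0) \<in> c \<and> (\<forall>k. (k, 0) \<in> c \<longrightarrow> i \<le> k)}"
          then obtain i where x: "x = (i, 0)" "(i, 0) \<in> c" "i \<le> i0" using i0(1) by blast
          then have "i = i0" using i0(2)[of i] by (simp add: le_antisym)
          then show "x \<in> {(i0, 0)}" using x by simp
        next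
          fix x assume "x \<in> {(i0, 0::nat)}"
          then show "x \<in> {(i, 0) |i. (i, 0) \<in> c \<and> (\<forall>k. (k, 0) \<in> c \<longrightarrow> i \<le> k)}"
            using i0 by blast
        qed
        then show ?thesis by (simp only: drop_first_def)
      qed
      moreover have "lpp n m (drop_first c) = lpp n m c" using False by blast
      ultimately have "f i0 c = 1" using i0(1) by (simp add: f_def flip_def insert_absorb)
      moreover have "f i0 c \<le> (\<Sum>i=1..k. f i c)"
        by (rule member_le_sum[OF i0k]) (use f0 in auto)
      ultimately have "1 \<le> (\<Sum>i=1..k. f i c)" by (simp only:)
      then show ?thesis by (simp add: add_increasing2)
    next
      case True
      have "0 \<le> (\<Sum>i=1..k. f i c)" using f0 by (rule sum_nonneg)
      then show ?thesis using True by (cases "c \<inter> ?I = {}") (simp_all add: add_increasing)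
    qed
  qed
  also have "\<dots> = (\<Sum>i=1..k. ?E (f i)) + ?E (\<lambda>c. of_bool (c \<inter> ?I = {}))"
    by (simp only: bern_add bern_sum)
  also have "(\<Sum>i=1..k. ?E (f i)) \<le> (\<Sum>i=1..k. r / (1 + r) * (1 - survive r s (n - k) m))"
  proof (intro sum_mono)
    fix i assume i: "i \<in> {1..k}"
    then have g: "(i, 0) \<in> grid n m" "lat r s (i, 0) = r / (1 + r)" using k by (auto simp: grid_def lat_def)
    have "?E (f i) = r / (1 + r) * (1 - survive r s (n + 1 - i) m)"
    proof -
      have "?E (f i) = lat r s (i, 0) * ?E (\<lambda>c. 1 - flip (i, 0) (lpp n m) c)"
        unfolding f_def by (rule bern_flip_indep[OF finite_grid g(1), where h="\<lambda>x. 1 - x"])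
      also have "?E (\<lambda>c. 1 - flip (i, 0) (lpp n m) c) = 1 - survive r s (n + 1 - i) m"
        unfolding bern_diff using bern_flip_source[OF pos, of i n m] i k by (simp add: bern_const)
      finally show ?thesis unfolding g(2) .
    qed
    also have "\<dots> \<le> r / (1 + r) * (1 - survive r s (n - k) m)"
      using pos i k survive_mono[OF pos rs, of "n - k" "n + 1 - i" m] by (intro mult_left_mono) auto
    finally show "?E (f i) \<le> r / (1 + r) * (1 - survive r s (n - k) m)" .
  qed
  also have "\<dots> = k * (r / (1 + r)) * (1 - survive r s (n - k) m)" by simp
  also have "?E (\<lambda>c. of_bool (c \<inter> ?I = {})) = (1 - r / (1 + r)) ^ k"
  proof -
    have "?I \<subseteq> grid n m" using k by (auto simp: grid_def)
    then have "?E (\<lambda>c. of_bool (c \<inter> ?I = {})) = (\<Prod>i\<in>?I. 1 - lat r s i)"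
      by (rule bern_avoid[OF finite_grid])
    also have "\<dots> = (\<Prod>i\<in>?I. 1 - r / (1 + r))" by (intro prod.cong) (auto simp: lat_def)
    finally show ?thesis by (simp add: card_cartesian_product)
  qed
  finally show ?thesis by simp
qed

section \<open>Coupled particle configurations\<close>

text \<open>The particles from which a mark at \<open>u\<close> takes the leftmost one; a sink
  chooses among all of them.\<close>

definition up :: "real \<Rightarrow> real set \<Rightarrow> real set" where
  "up u C = (if u = 0 then C else C \<inter> {u<..})"

lemma step_up: "step u C = (if u = 0 then {} else {u}) \<union> (C - leftmost (up u C))"
  by (simp add: step_def up_def)

lemma leftmost_empty [simp]: "leftmost {} = {}"
  by (simp add: leftmost_def)

lemma leftmost_eqI: "y \<in> U \<Longrightarrow> (\<And>z. z \<in> U \<Longrightarrow> y \<le> z) \<Longrightarrow> leftmost U = {y}"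
  by (auto simp: leftmost_def intro: antisym)

lemma finite_up [simp]: "finite C \<Longrightarrow> finite (up u C)"
  by (simp add: up_def)

lemma leftmost_Min: "finite U \<Longrightarrow> U \<noteq> {} \<Longrightarrow> leftmost U = {Min U}"
  by (rule leftmost_eqI) auto

lemma finite_step [simp]: "finite C \<Longrightarrow> finite (step u C)"
  by (simp add: step_def)

text \<open>If the particle taken lies beyond \<open>R\<close>, then the window contains no
  candidate, and otherwise both configurations take the same one. Hence the evolutions in different
  windows are consistent.\<close>

lemma step_restrict:
  assumes "finite C" "0 \<le> u" "0 \<le> R"
  shows "step u C \<inter> {..R} = (if u \<le> R then step u (C \<inter> {..R}) else C \<inter> {..R})"
proof (cases "up u C = {}")
  case True
  then have "up u (C \<inter> {..R}) = {}" by (auto simp: up_def split: if_splits)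
  then show ?thesis using True \<open>0 \<le> u\<close> by (auto simp: step_up)
next
  case False
  define y where "y = Min (up u C)"
  have y: "y \<in> up u C" "\<And>z. z \<in> up u C \<Longrightarrow> y \<le> z" "leftmost (up u C) = {y}"
    using False assms by (auto simp: y_def leftmost_Min)
  show ?thesis
  proof (cases "y \<le> R")
    case True
    then have "leftmost (up u (C \<inter> {..R})) = {y}"
      using y by (intro leftmost_eqI) (auto simp: up_def split: if_splits)
    moreover have "u \<le> R" using True y(1) \<open>0 \<le> R\<close> by (auto simp: up_def split: if_splits)
    ultimately show ?thesis using y True by (auto simp: step_up)
  next
    case False
    then have "up u (C \<inter> {..R}) = {}" using y(2) by (fastforce simp: up_def split: if_splits)
    then show ?thesis using y(3) False \<open>0 \<le> u\<close> by (auto simp: step_up)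
  qed
qed

lemma sorted_list_of_set_append:
  fixes A B :: "'a::linorder set"
  assumes "finite A" "finite B" "\<And>a b. a \<in> A \<Longrightarrow> b \<in> B \<Longrightarrow> a < b"
  shows "sorted_list_of_set (A \<union> B) = sorted_list_of_set A @ sorted_list_of_set B"
proof (rule sorted_distinct_set_unique)
  show "sorted (sorted_list_of_set A @ sorted_list_of_set B)"
    using assms by (auto simp: sorted_append intro: less_imp_le)
  show "distinct (sorted_list_of_set A @ sorted_list_of_set B)"
    using assms by auto
qed (use assms in auto)

text \<open>The almost sure properties on which all pathwise arguments rest. Those of the times make
  the mark at a given time unique; those of the positions ensure that no particle jumps onto an
  occupied location.\<close>

locale configuration =
  fixes S K :: "real set" and A :: "(real \<times> real) set"
  assumes S_pos: "S \<subseteq> {0<..}" and K_pos: "K \<subseteq> {0<..}" and A_pos: "A \<subseteq> {0<..} \<times> {0<..}"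
    and S_finite: "\<And>R. finite (S \<inter> {..R})" and K_finite: "\<And>T. finite (K \<inter> {..T})"
    and A_finite: "\<And>R T. finite (A \<inter> {..R} \<times> {..T})"
    and fst_inj: "inj_on fst A" and snd_inj: "inj_on snd A"
    and fst_S: "S \<inter> fst ` A = {}" and snd_K: "K \<inter> snd ` A = {}"
begin

abbreviation E :: "(real \<times> real) set" where "E \<equiv> marks K A"

definition W :: "real \<Rightarrow> real \<Rightarrow> real \<Rightarrow> (real \<times> real) set" where
  "W R s t = {(u, r) \<in> E. u \<le> R \<and> s < r \<and> r \<le> t}"

definition flow :: "real \<Rightarrow> real \<Rightarrow> real \<Rightarrow> real set \<Rightarrow> real set" where
  "flow R s t = fold (\<lambda>r. step (THE u. (u, r) \<in> W R s t)) (sorted_list_of_set (snd ` W R s t))"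

abbreviation H :: "real \<Rightarrow> real set \<Rightarrow> real \<Rightarrow> real set" where
  "H R \<equiv> hammersley_upto R E"

lemma H_flow: "H R C t = flow R 0 t (C \<inter> {0..R})"
  by (simp add: hammersley_upto_def flow_def W_def Let_def)

lemma E_inj: "(u, r) \<in> E \<Longrightarrow> (u', r) \<in> E \<Longrightarrow> u = u'"
proof -
  have "r \<notin> K" if "(u, r) \<in> A" for u r using snd_K that by force
  moreover have "u = u'" if "(u, r) \<in> A" "(u', r) \<in> A" for u u' r
    using inj_onD[OF snd_inj _ that] by simp
  ultimately show "(u, r) \<in> E \<Longrightarrow> (u', r) \<in> E \<Longrightarrow> u = u'"
    unfolding marks_def by blast
qed

lemma E_nonneg: "(u, r) \<in> E \<Longrightarrow> 0 \<le> u \<and> 0 < r"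
  using A_pos K_pos by (auto simp: marks_def)

lemma W_finite [simp]: "finite (W R s t)"
proof (rule finite_subset)
  show "W R s t \<subseteq> {0} \<times> (K \<inter> {..t}) \<union> A \<inter> {..R} \<times> {..t}" by (auto simp: W_def marks_def)
qed (use K_finite A_finite in auto)

lemma the_W: "(u, r) \<in> W R s t \<Longrightarrow> (THE u. (u, r) \<in> W R s t) = u"
  using E_inj by (intro the_equality) (auto simp: W_def)

lemma W_split: "s \<le> r \<Longrightarrow> r \<le> t \<Longrightarrow> W R s t = W R s r \<union> W R r t"
  by (auto simp: W_def)

lemma flow_compose:
  assumes "s \<le> r" "r \<le> t"
  shows "flow R s t C = flow R r t (flow R s r C)"
proof -
  have "sorted_list_of_set (snd ` W R s t) =
      sorted_list_of_set (snd ` W R s r) @ sorted_list_of_set (snd ` W R r t)"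
    unfolding W_split[OF assms] image_Un
    by (rule sorted_list_of_set_append, simp, simp, auto simp: W_def)
  moreover have "(THE u. (u, q) \<in> W R s t) = (THE u. (u, q) \<in> W R s r)" if "q \<in> snd ` W R s r" for q
  proof -
    obtain u where u: "(u, q) \<in> W R s r" using \<open>q \<in> snd ` W R s r\<close> by auto
    then have "(u, q) \<in> W R s t" using W_split[OF assms] by simp
    then show ?thesis using the_W[OF u] the_W[of u q R s t] by simp
  qed
  then have "fold (\<lambda>q. step (THE u. (u, q) \<in> W R s t)) (sorted_list_of_set (snd ` W R s r)) C = flow R s r C" for C
    unfolding flow_def by (intro fold_cong refl) simp
  moreover have "(THE u. (u, q) \<in> W R s t) = (THE u. (u, q) \<in> W R r t)" if "q \<in> snd ` W R r t" for q
  proof -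
    obtain u where u: "(u, q) \<in> W R r t" using \<open>q \<in> snd ` W R r t\<close> by auto
    then have "(u, q) \<in> W R s t" using W_split[OF assms] by simp
    then show ?thesis using the_W[OF u] the_W[of u q R s t] by simp
  qed
  then have "fold (\<lambda>q. step (THE u. (u, q) \<in> W R s t)) (sorted_list_of_set (snd ` W R r t)) C = flow R r t C" for C
    unfolding flow_def by (intro fold_cong refl) simp
  ultimately show ?thesis
    unfolding flow_def[of R s t] by simp
qed

lemma flow_empty: "W R s t = {} \<Longrightarrow> flow R s t C = C"
  by (simp add: flow_def)

lemma flow_single: "W R s t = {(u, r)} \<Longrightarrow> flow R s t C = step u C"
  using the_W[of u r R s t] by (simp add: flow_def)

lemma H_empty: "0 \<le> s \<Longrightarrow> s \<le> t \<Longrightarrow> W R s t = {} \<Longrightarrow> H R C t = H R C s"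
  by (simp add: H_flow flow_compose[of 0 s t] flow_empty)

lemma H_single: "0 \<le> s \<Longrightarrow> s \<le> t \<Longrightarrow> W R s t = {(u, r)} \<Longrightarrow> H R C t = step u (H R C s)"
  by (simp add: H_flow flow_compose[of 0 s t] flow_single)

lemma H_0: "H R C 0 = C \<inter> {0..R}"
proof -
  have "W R 0 0 = {}" by (auto simp: W_def)
  then show ?thesis by (simp add: H_flow flow_empty)
qed

lemma H_eq_later: "0 \<le> s \<Longrightarrow> s \<le> t \<Longrightarrow> H R C s = H R D s \<Longrightarrow> H R C t = H R D t"
  by (simp add: H_flow flow_compose[of 0 s t])

text \<open>A window contains finitely many marks up to time \<open>s\<close>. It therefore suffices
  to pass over intervals without marks and over intervals whose only mark is at the right
  end.\<close>

lemma mark_induct [consumes 1, case_names start idle mark]: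
  assumes "0 \<le> s" "P 0"
    and const: "\<And>s t. 0 \<le> s \<Longrightarrow> s < t \<Longrightarrow> P s \<Longrightarrow> W R s t = {} \<Longrightarrow> P t"
    and mark: "\<And>s t u. 0 \<le> s \<Longrightarrow> s < t \<Longrightarrow> P s \<Longrightarrow> W R s t = {(u, t)} \<Longrightarrow> P t"
  shows "P s"
  using assms(1)
proof (induction "card (W R 0 s)" arbitrary: s rule: less_induct)
  case less
  show ?case
  proof (cases "W R 0 s = {}")
    case True
    then show ?thesis using const[of 0 s] assms(2) less.prems by (cases "s = 0") auto
  next
    case False
    define r where "r = Max (snd ` W R 0 s)"
    have "r \<in> snd ` W R 0 s" unfolding r_def using False by (intro Max_in) auto
    then obtain u where ur: "(u, r) \<in> W R 0 s" by auto
    have r_max: "q \<le> r" if "(v, q) \<in> W R 0 s" for v q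
      unfolding r_def using that by (intro Max_ge) force+
    \<comment> \<open>\<open>r'\<close> will be the time of the mark before the last one, or
      \<open>0\<close> if there is none.\<close>
    define B where "B = insert 0 (snd ` W R 0 s - {r})"
    define r' where "r' = Max B"
    have B: "finite B" "0 \<in> B" by (auto simp: B_def)
    have r'B: "r' \<in> B" unfolding r'_def using B by (intro Max_in) auto
    have r'_max: "q \<le> r'" if "q \<in> B" for q
      unfolding r'_def using that B by (intro Max_ge) auto
    have r: "0 < r" "r \<le> s" using ur by (auto simp: W_def)
    have r': "0 \<le> r'" "r' < r"
    proof -
      show "0 \<le> r'" using r'_max B by auto
      have "q < r" if "q \<in> B" for q
        using that r r_max unfolding B_def by (fastforce simp: less_le)
      then show "r' < r" using r'B by auto
    qed
    have 1: "W R r' r = {(u, r)}"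
    proof (intro equalityI subsetI)
      fix p assume p: "p \<in> W R r' r"
      then have p': "p \<in> W R 0 s" using r r' by (auto simp: W_def)
      have "snd p = r"
      proof (rule ccontr)
        assume "snd p \<noteq> r"
        then have "snd p \<in> B" using p' by (auto simp: B_def)
        then show False using r'_max p by (fastforce simp: W_def)
      qed
      then show "p \<in> {(u, r)}" using p' ur E_inj by (cases p) (auto simp: W_def)
    qed (use ur r r' in \<open>auto simp: W_def\<close>)
    have 2: "W R r s = {}" using r_max r by (fastforce simp: W_def)
    have "W R 0 r' \<subset> W R 0 s"
    proof
      show "W R 0 r' \<subseteq> W R 0 s" using r r' by (auto simp: W_def)
      have "(u, r) \<notin> W R 0 r'" using r' by (auto simp: W_def)
      then show "W R 0 r' \<noteq> W R 0 s" using ur by auto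
    qed
    then have "P r'" using less.hyps r' by (simp add: psubset_card_mono)
    then have "P r" using mark r' 1 by blast
    then show ?thesis using const[of r s] 2 r by (cases "r = s") auto
  qed
qed

lemma H_restrict:
  assumes "\<And>R. finite (C \<inter> {0..R})" "0 \<le> R" "R \<le> R'" "0 \<le> s"
  shows "H R' C s \<inter> {..R} = H R C s \<and> finite (H R' C s)"
  using assms(4)
proof (induction s rule: mark_induct[where R=R'])
  case start
  then show ?case using assms by (auto simp: H_0)
next
  case (idle s t)
  then have "W R s t = {}" using \<open>R \<le> R'\<close> by (fastforce simp: W_def)
  then show ?case using idle by (simp add: H_empty[of s t])
next
  case (mark s t u)
  have "(u, t) \<in> W R' s t" using mark(3) by simp
  then have "0 \<le> u" "u \<le> R'" using E_nonneg[of u t] by (auto simp: W_def)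
  have W: "W R s t = W R' s t \<inter> {..R} \<times> UNIV" using \<open>R \<le> R'\<close> by (auto simp: W_def)
  have "H R C t = (if u \<le> R then step u (H R C s) else H R C s)"
  proof (cases "u \<le> R")
    case True
    then have "W R s t = {(u, t)}" using W mark(3) by simp
    then show ?thesis using mark(1,2) True by (simp add: H_single[of s t R u t])
  next
    case False
    then have "W R s t = {}" using W mark(3) by simp
    then show ?thesis using mark(1,2) False by (simp add: H_empty[of s t])
  qed
  then show ?case
    using mark step_restrict[of "H R' C s" u R] \<open>0 \<le> u\<close> \<open>0 \<le> R\<close> by (simp add: H_single[of s t R' u t])
qed

end

lemma in_up: "z \<in> up u C \<longleftrightarrow> z \<in> C \<and> (u = 0 \<or> u < z)"
  by (simp add: up_def)

lemma leftmost_up_new: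
  assumes "u = 0 \<or> u < X" "\<forall>z\<in>up u C. X \<le> z"
  shows "leftmost (up u (insert X C)) = {X}"
  by (rule leftmost_eqI) (use assms in \<open>auto simp: in_up\<close>)

lemma leftmost_up_old:
  assumes "y \<in> up u C" "\<forall>z\<in>up u C. y \<le> z" "\<not> ((u = 0 \<or> u < X) \<and> X < y)"
  shows "leftmost (up u (insert X C)) = {y}"
  by (rule leftmost_eqI) (use assms in \<open>auto simp: in_up\<close>)

text \<open>A surplus of one particle persists, possibly at another place. It disappears from the
  window exactly when the mark takes the surplus particle and the smaller configuration has no
  candidate.\<close>

lemma step_insert:
  assumes "finite C" "y \<notin> C" "u = 0 \<or> u \<notin> insert y C"
  shows "step u (insert y C) = step u C \<or> (\<exists>y'. y' \<notin> step u C \<and> step u (insert y C) = insert y' (step u C))"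
proof (cases "up u C = {}")
  case e: True
  show ?thesis
  proof (cases "u = 0 \<or> u < y")
    case True
    then have "leftmost (up u (insert y C)) = {y}" using e by (intro leftmost_up_new) auto
    then have "step u (insert y C) = step u C" using e assms by (auto simp: step_up)
    then show ?thesis ..
  next
    case False
    then have "up u (insert y C) = {}" using e by (auto simp: in_up)
    then have "y \<notin> step u C \<and> step u (insert y C) = insert y (step u C)"
      using e assms False by (auto simp: step_up)
    then show ?thesis by blast
  qed
next
  case False
  define z where "z = Min (up u C)"
  have z: "z \<in> up u C" "\<forall>w\<in>up u C. z \<le> w" using False assms(1) by (auto simp: z_def)
  have L: "leftmost (up u C) = {z}" using z by (intro leftmost_eqI) auto
  have zC: "z \<in> C" "u \<noteq> 0 \<Longrightarrow> z \<noteq> u" "z \<noteq> y" using z assms(2) by (auto simp: in_up)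
  show ?thesis
  proof (cases "(u = 0 \<or> u < y) \<and> y < z")
    case True
    have "leftmost (up u (insert y C)) = {y}"
      using True z(2) by (intro leftmost_up_new) (meson less_imp_le order_trans)+
    then have "z \<notin> step u C \<and> step u (insert y C) = insert z (step u C)"
      using zC L assms by (auto simp: step_up)
    then show ?thesis by blast
  next
    case False
    then have "leftmost (up u (insert y C)) = {z}" using z by (intro leftmost_up_old)
    then have "y \<notin> step u C \<and> step u (insert y C) = insert y (step u C)"
      using zC L assms by (auto simp: step_up)
    then show ?thesis by blast
  qed
qed

text \<open>\<open>C\<close> is the configuration, \<open>X\<close> and \<open>X'\<close> are the two second class particles; they
  annihilate if the particle at \<open>X'\<close> jumps over \<open>X\<close>.\<close>

lemma step_pair:
  assumes fin: "finite C" and X: "X \<notin> C" "X' \<in> C" "X < X'" "0 \<le> X"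
    and u: "0 \<le> u" "u = 0 \<or> (u \<notin> C \<and> u \<noteq> X)"
    and alive: "step u (C - {X'}) \<noteq> step u C"
  obtains Y Y' where "Y \<notin> step u C" "step u (insert X C) = insert Y (step u C)"
    "Y' \<in> step u C" "step u (C - {X'}) = step u C - {Y'}" "Y < Y'"
    "step u (insert X (C - {X'})) = (if Y = X' then step u C else insert Y (step u C - {Y'}))"
proof -
  let ?I = "if u = 0 then {} else {u}"
  show ?thesis
  proof (cases "up u C = {}")
    \<comment> \<open>The mark lies to the right of all particles and of \<open>X\<close>: nothing
      is taken and both second class particles stay.\<close>
    case True
    then have u0: "u \<noteq> 0" using X by (auto simp: up_def)
    have lt: "c < u" if "c \<in> C" for c
    proof -
      have "\<not> u < c" using True u0 that by (auto simp: up_def)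
      moreover have "c \<noteq> u" using u u0 that by auto
      ultimately show ?thesis by simp
    qed
    then have "X < u" using X by force
    then have e: "up u C = {}" "up u (insert X C) = {}" "up u (C - {X'}) = {}" "up u (insert X (C - {X'})) = {}"
      using u0 lt \<open>X < u\<close> by (force simp: up_def)+
    show ?thesis
      by (rule that[of X X']) (use e u0 lt[OF X(2)] X \<open>X < u\<close> in \<open>auto simp: step_up\<close>)
  next
    case False
    define y where "y = Min (up u C)"
    have y: "y \<in> up u C" "\<And>z. z \<in> up u C \<Longrightarrow> y \<le> z" using False fin by (auto simp: y_def)
    have yC: "y \<in> C" "y \<notin> ?I" "y \<noteq> X" using y X by (auto simp: up_def split: if_splits)
    have L: "leftmost (up u C) = {y}" using y by (rule leftmost_eqI)
    have Xup: "X \<in> up u (insert X C) \<longleftrightarrow> u = 0 \<or> u < X" by (auto simp: up_def)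
    have min: "\<forall>z\<in>up u C. y \<le> z" "\<forall>z\<in>up u (C - {X'}). y \<le> z" using y by (auto simp: in_up)
    show ?thesis
    proof (cases "y = X'")
      case False
      have yB: "y \<in> up u (C - {X'})" using y False by (auto simp: in_up)
      have LB: "leftmost (up u (C - {X'})) = {y}"
        using yB min by (intro leftmost_eqI) auto
      show ?thesis
      proof (cases "(u = 0 \<or> u < X) \<and> X < y")
        \<comment> \<open>A particle other than the one at \<open>X'\<close> jumps over
          \<open>X\<close>, which moves to its former place \<open>y\<close>.\<close>
        case True
        have X'up: "X' \<in> up u C" using True X by (auto simp: in_up)
        have yX': "y < X'" using y(2)[OF X'up] False by simp
        have le: "\<forall>z\<in>up u C. X \<le> z" "\<forall>z\<in>up u (C - {X'}). X \<le> z"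
          using min True by (meson less_imp_le order_trans)+
        have LD: "leftmost (up u (insert X C)) = {X}"
          using True le(1) by (intro leftmost_up_new) auto
        have LZ: "leftmost (up u (insert X (C - {X'}))) = {X}"
          using True le(2) by (intro leftmost_up_new) auto
        show ?thesis
          by (rule that[of y X']; use False yC yX' X u in \<open>auto simp: step_up L LB LD LZ\<close>)
      next
        case nX: False
        have LD: "leftmost (up u (insert X C)) = {y}"
          by (rule leftmost_up_old[OF y(1) min(1) nX])
        have LZ: "leftmost (up u (insert X (C - {X'}))) = {y}"
          by (rule leftmost_up_old[OF yB min(2) nX])
        show ?thesis
          by (rule that[of X X']; use False yC X u in \<open>auto simp: step_up L LB LD LZ\<close>)
      qed
    next
      \<comment> \<open>The particle at \<open>X'\<close> is taken, so the dual particle moves on to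
        the next candidate \<open>y2\<close>; \<open>alive\<close> guarantees that the window
        contains one.\<close>
      case True
      have upB: "up u (C - {X'}) = up u C - {X'}" by (auto simp: in_up)
      have ne: "up u (C - {X'}) \<noteq> {}"
      proof
        assume "up u (C - {X'}) = {}"
        then have "step u (C - {X'}) = step u C" using L True by (simp add: step_up)
        then show False using alive by simp
      qed
      define y2 where "y2 = Min (up u (C - {X'}))"
      have y2: "y2 \<in> up u (C - {X'})" "\<forall>z\<in>up u (C - {X'}). y2 \<le> z"
        using ne fin by (auto simp: y2_def)
      have LB: "leftmost (up u (C - {X'})) = {y2}" using y2 by (intro leftmost_eqI) auto
      have y2C: "y2 \<in> C" "y2 \<noteq> X'" "u \<noteq> 0 \<Longrightarrow> y2 \<noteq> u" using y2(1) by (auto simp: in_up)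
      have "y2 \<in> up u C" using y2(1) by (auto simp: upB)
      then have y2X: "X' < y2" using y(2)[of y2] True y2C by simp
      then have y2nX: "y2 \<noteq> X" using X by simp
      show ?thesis
      proof (cases "u = 0 \<or> u < X")
        \<comment> \<open>The same jump passes over \<open>X\<close>, which moves to
          \<open>X'\<close>: this is the meeting, after which the doubly modified configuration
          coincides with the original one.\<close>
        case uX: True
        have le: "\<forall>z\<in>up u C. X \<le> z" "\<forall>z\<in>up u (C - {X'}). X \<le> z"
          using min True X by (meson less_imp_le order_trans)+
        have LD: "leftmost (up u (insert X C)) = {X}"
          using uX le(1) by (intro leftmost_up_new) auto
        have LZ: "leftmost (up u (insert X (C - {X'}))) = {X}"
          using uX le(2) by (intro leftmost_up_new) auto
        show ?thesis
          by (rule that[of X' y2]; use True yC X u y2C y2X y2nX in \<open>auto simp: step_up L LB LD LZ\<close>)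
      next
        case uX: False
        have LD: "leftmost (up u (insert X C)) = {X'}"
          using leftmost_up_old[OF y(1) min(1), of X] uX True by simp
        have LZ: "leftmost (up u (insert X (C - {X'}))) = {y2}"
          using leftmost_up_old[OF y2, of X] uX by simp
        show ?thesis
          by (rule that[of X y2]; use True yC X u y2C y2X y2nX in \<open>auto simp: step_up L LB LD LZ\<close>)
      qed
    qed
  qed
qed

section \<open>Second class particles as discrepancies of coupled configurations\<close>

context configuration
begin

text \<open>Contains every location that can have been occupied by time \<open>s\<close>. Later
  \<alpha>-points have positions outside it, and for a fixed \<open>s\<close> it meets each bounded
  set in finitely many points.\<close>

definition coords :: "real \<Rightarrow> real set" where
  "coords s = insert 0 (S \<union> fst ` (A \<inter> UNIV \<times> {..s}))"

lemma coords_mono: "s \<le> t \<Longrightarrow> coords s \<subseteq> coords t"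
  by (force simp: coords_def)

lemma W_fresh:
  assumes "(u, r) \<in> W R s t" "u \<noteq> 0"
  shows "u \<notin> coords s"
proof
  assume "u \<in> coords s"
  have uA: "(u, r) \<in> A" using assms by (auto simp: W_def marks_def)
  then have "u \<notin> S" using fst_S by force
  then obtain q where "(u, q) \<in> A" "q \<le> s" using \<open>u \<in> coords s\<close> assms by (auto simp: coords_def)
  then have "q = r" using inj_onD[OF fst_inj _ _ uA, of "(u, q)"] by auto
  then show False using assms \<open>q \<le> s\<close> by (auto simp: W_def)
qed

lemma W_coords: "(u, r) \<in> W R s t \<Longrightarrow> u \<in> coords t"
  by (force simp: W_def marks_def coords_def)

lemma W_nonneg: "(u, r) \<in> W R s t \<Longrightarrow> 0 \<le> u"
  using E_nonneg by (auto simp: W_def)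

lemma initial_finite: "C \<subseteq> insert 0 S \<Longrightarrow> finite (C \<inter> {0..R})"
  by (rule finite_subset[of _ "insert 0 (S \<inter> {..R})"]) (use S_finite in auto)

lemma H_finite: "C \<subseteq> insert 0 S \<Longrightarrow> 0 \<le> R \<Longrightarrow> 0 \<le> s \<Longrightarrow> finite (H R C s)"
  using H_restrict[of C R R s] initial_finite by simp

lemma H_coords:
  assumes "C \<subseteq> insert 0 S" "0 \<le> R" "0 \<le> s"
  shows "H R C s \<subseteq> coords s \<inter> {0..R}"
  using assms(3)
proof (induction s rule: mark_induct[where R=R])
  case start
  then show ?case using assms by (auto simp: H_0 coords_def)
next
  case (idle s t)
  then show ?case using coords_mono[of s t] by (auto simp: H_empty[of s t])
next
  case (mark s t u)
  have "(u, t) \<in> W R s t" using mark by simp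
  then have "u \<in> coords t" "0 \<le> u" "u \<le> R" using W_coords[of u t R s t] W_nonneg[of u t R s t] by (auto simp: W_def)
  then show ?case using mark coords_mono[of s t] by (auto simp: H_single[of s t R u t] step_up split: if_splits)
qed

lemma H_insert:
  assumes "D \<subseteq> insert 0 S" "D = insert z C" "z \<notin> C" "0 \<le> R" "0 \<le> s"
  shows "H R D s = H R C s \<or> (\<exists>y. y \<notin> H R C s \<and> H R D s = insert y (H R C s))"
  using assms(5)
proof (induction s rule: mark_induct[where R=R])
  case start
  show ?case using assms(2,3) by (cases "z \<in> {0..R}") (auto simp: H_0)
next
  case (idle s t)
  then show ?case by (simp add: H_empty[of s t])
next
  case (mark s t u)
  have C: "C \<subseteq> insert 0 S" using assms by auto
  have u: "u = 0 \<or> u \<notin> coords s" using W_fresh[of u t R s t] mark by auto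
  show ?case
  proof (cases "H R D s = H R C s")
    case True
    then show ?thesis using mark by (simp add: H_single[of s t R u t])
  next
    case False
    then obtain y where y: "y \<notin> H R C s" "H R D s = insert y (H R C s)" using mark by auto
    then have "insert y (H R C s) \<subseteq> coords s" using H_coords[OF assms(1,4) mark(1)] by auto
    then show ?thesis
      using step_insert[of "H R C s" y u] y u mark H_finite[OF C assms(4) mark(1)]
      by (auto simp: H_single[of s t R u t])
  qed
qed

text \<open>By \<open>H_insert\<close> larger windows contain at most one discrepancy, and by
  consistency they contain the one seen in \<open>[0, R]\<close>. So a discrepancy found in a finite
  window is the one on the whole half-line, and the definite description is settled there.\<close>

lemma the_second_class:
  assumes D: "D \<subseteq> insert 0 S" "D = insert z C" "z \<notin> C" "0 < R" "0 \<le> s"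
    and y: "y \<notin> H R C s" "H R D s = insert y (H R C s)"
  shows "(THE y. y \<notin> hammersley E C s \<and> hammersley E D s = insert y (hammersley E C s)) = y"
proof -
  have C: "C \<subseteq> insert 0 S" using D by auto
  have yR: "y \<le> R" using H_coords[of D R s] D y by auto
  have res: "H R' F s \<inter> {..R} = H R F s" if "R \<le> R'" "F \<subseteq> insert 0 S" for R' F
    using H_restrict[of F R R' s] initial_finite that D by simp
  have ham: "hammersley E F s = (\<Union>R'\<in>{R..}. H R' F s)" if F: "F \<subseteq> insert 0 S" for F
  proof -
    have "H R' F s \<subseteq> H R F s" if "0 < R'" "R' \<le> R" for R'
      using H_restrict[of F R' R s] initial_finite[OF F] that D by auto
    then show ?thesis unfolding hammersley_def using D(4)
      by (intro equalityI UN_least; force)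
  qed
  have big: "y \<notin> H R' C s \<and> H R' D s = insert y (H R' C s)" if R': "R \<le> R'" for R'
  proof -
    have CD: "H R' C s \<inter> {..R} = H R C s" "H R' D s \<inter> {..R} = insert y (H R C s)"
      using res R' C D y by auto
    then have ne: "H R' D s \<noteq> H R' C s" using y by auto
    then obtain y' where y': "y' \<notin> H R' C s" "H R' D s = insert y' (H R' C s)"
      using H_insert[OF D(1,2,3), of R' s] R' D by auto
    have "y \<in> H R' D s" "y \<notin> H R' C s" using CD y yR by auto
    then have "y' = y" using y' by auto
    then show ?thesis using y' by simp
  qed
  have hC: "y \<notin> hammersley E C s" and hD: "hammersley E D s = insert y (hammersley E C s)"
    unfolding ham[OF C] ham[OF D(1)] using big by auto
  then show ?thesis by (intro the_equality) auto
qed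

definition sc :: "real \<Rightarrow> real" where "sc = second_class S K A"
definition dsc :: "real \<Rightarrow> real" where "dsc = dual_second_class S K A"
text \<open>Agrees with \<open>meeting_time sc dsc \<le> s\<close> except possibly when both sides
  are equal, and can be followed from mark to mark.\<close>

definition met :: "real \<Rightarrow> bool" where "met s \<longleftrightarrow> (\<exists>r. 0 < r \<and> r \<le> s \<and> (dsc \<longlongrightarrow> sc r) (at_left r))"

abbreviation "S0 \<equiv> insert 0 S"
abbreviation "S1 \<equiv> S - leftmost S"
text \<open>Both changes of the initial configuration at once. This is what a point in the corner
  cell amounts to, by \<open>cnt_corner\<close>.\<close>

abbreviation "S2 \<equiv> insert 0 (S - leftmost S)"

definition pair :: "real \<Rightarrow> real \<Rightarrow> real \<Rightarrow> real \<Rightarrow> bool" where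
  "pair R s X X' \<longleftrightarrow> X \<notin> H R S s \<and> H R S0 s = insert X (H R S s) \<and>
     X' \<in> H R S s \<and> H R S1 s = H R S s - {X'} \<and> X < X'"

lemma zero_notin_S: "0 \<notin> S" using S_pos by auto

lemma leftmost_S: "S1 = S \<or> (\<exists>l\<in>S. leftmost S = {l} \<and> (\<forall>z\<in>S. l \<le> z))"
proof (cases "leftmost S = {}")
  case False
  then obtain l where l: "l \<in> S" "\<And>z. z \<in> S \<Longrightarrow> l \<le> z" by (auto simp: leftmost_def)
  then have "leftmost S = {l}" by (rule leftmost_eqI)
  then show ?thesis using l by blast
qed simp

lemma pair_eq:
  assumes "pair R s X X'" "0 < R" "0 \<le> s"
  shows "sc s = X" "dsc s = X'"
proof -
  have p: "X \<notin> H R S s" "H R S0 s = insert X (H R S s)" "X' \<notin> H R S1 s" "H R S s = insert X' (H R S1 s)" "S1 \<noteq> S"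
    using assms(1) by (auto simp: pair_def)
  show "sc s = X" unfolding sc_def second_class_def
    by (rule the_second_class[OF _ refl zero_notin_S assms(2,3) p(1,2)]) simp
  obtain l where l: "l \<in> S" "leftmost S = {l}" using leftmost_S p(5) by blast
  have "S = insert l S1" "l \<notin> S1" using l by (simp_all add: insert_absorb)
  then show "dsc s = X'" unfolding dsc_def dual_second_class_def
    by (rule the_second_class[OF subset_insertI _ _ assms(2,3) p(3,4)])
qed

lemma tendsto_left_const:
  fixes f :: "real \<Rightarrow> real" and s t :: real
  assumes "s < t" "\<And>r. s \<le> r \<Longrightarrow> r < t \<Longrightarrow> f r = d"
  shows "(f \<longlongrightarrow> l) (at_left t) \<longleftrightarrow> l = d"
proof -
  have "eventually (\<lambda>r. f r = d) (at_left t)"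
    unfolding eventually_at_left_field by (intro exI[of _ s]) (use assms in auto)
  then have "(f \<longlongrightarrow> l) (at_left t) \<longleftrightarrow> ((\<lambda>_. d) \<longlongrightarrow> l) (at_left t)"
    by (rule tendsto_cong)
  also have "\<dots> \<longleftrightarrow> l = d" by (auto simp: tendsto_const_iff)
  finally show ?thesis .
qed

text \<open>As long as the window still shows the dual particle, the three modified evolutions are
  described by the original one and two locations. Starting from \<open>S2\<close> gives the
  original configuration with \<open>X'\<close> replaced by \<open>X\<close>, until the meeting
  cancels both changes.\<close>

lemma pair_invariant:
  assumes "0 < R" "0 \<le> s" "H R S1 s \<noteq> H R S s"
  shows "pair R s (sc s) (dsc s) \<and> H R S2 s = (if met s then H R S s else insert (sc s) (H R S s - {dsc s}))"
  using assms(2,3)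
proof (induction s rule: mark_induct[where R=R])
  case start
  have "S1 \<noteq> S" using start by auto
  then obtain l where l: "l \<in> S" "leftmost S = {l}" "\<forall>z\<in>S. l \<le> z" using leftmost_S by auto
  then have lpos: "0 < l" using S_pos by auto
  have lR: "l \<le> R"
  proof (rule ccontr)
    assume "\<not> l \<le> R"
    then have "S1 \<inter> {0..R} = S \<inter> {0..R}" using l by auto
    then show False using start by (simp add: H_0)
  qed
  have p: "pair R 0 0 l" using l lpos lR assms(1) zero_notin_S by (auto simp: pair_def H_0)
  then have "sc 0 = 0" "dsc 0 = l" using pair_eq assms(1) by auto
  then show ?case using p l lpos lR assms(1) by (auto simp: H_0 met_def)
next
  case (idle s t)
  have eq: "H R C r = H R C s" if "s \<le> r" "r \<le> t" for r C
  proof (rule H_empty)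
    have "W R s r \<subseteq> W R s t" using that by (auto simp: W_def)
    then show "W R s r = {}" using idle(3) by simp
  qed (use idle that in auto)
  have ps: "pair R s (sc s) (dsc s)" using idle eq[of t] by auto
  have const: "sc r = sc s" "dsc r = dsc s" if "s \<le> r" "r \<le> t" for r
  proof -
    have "pair R r (sc s) (dsc s)" using ps eq[OF that] by (simp add: pair_def)
    then show "sc r = sc s" "dsc r = dsc s" using pair_eq assms(1) idle that by auto
  qed
  have "\<not> (dsc \<longlongrightarrow> sc r) (at_left r)" if "s < r" "r \<le> t" for r
  proof -
    have "(dsc \<longlongrightarrow> sc r) (at_left r) \<longleftrightarrow> sc r = dsc s"
      using that by (intro tendsto_left_const[OF _ const(2)]) auto
    then show ?thesis using const[of r] that ps by (auto simp: pair_def)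
  qed
  then have no: "r \<le> s" if "r \<le> t" "(dsc \<longlongrightarrow> sc r) (at_left r)" for r
    using that by (meson not_le)
  have "met t = met s"
  proof
    assume "met t"
    then show "met s" using no unfolding met_def by blast
  next
    assume "met s"
    then show "met t" using idle(2) unfolding met_def by (meson less_imp_le order_trans)
  qed
  then show ?case using idle eq[of t] const[of t] by (simp add: pair_def)
next
  case (mark s t u)
  have eq: "H R C r = H R C s" if "s \<le> r" "r < t" for r C
  proof (rule H_empty)
    have "W R s r \<subseteq> W R s t" using that by (auto simp: W_def)
    moreover have "(u, t) \<notin> W R s r" using that by (simp add: W_def)
    ultimately show "W R s r = {}" unfolding mark(3) by blast
  qed (use mark that in auto)
  have Ht: "H R C t = step u (H R C s)" for C
    using mark by (intro H_single) auto
  have alive: "H R S1 s \<noteq> H R S s" using mark(5) by (auto simp: Ht)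
  then have ps: "pair R s (sc s) (dsc s)"
    and Z: "H R S2 s = (if met s then H R S s else insert (sc s) (H R S s - {dsc s}))"
    using mark(4) by auto
  have const: "dsc r = dsc s" "sc r = sc s" if "s \<le> r" "r < t" for r
  proof -
    have "pair R r (sc s) (dsc s)" using ps eq[OF that] by (simp add: pair_def)
    then show "dsc r = dsc s" "sc r = sc s" using pair_eq assms(1) mark(1) that by auto
  qed
  \<comment> \<open>\<open>dsc\<close> is constant on \<open>[s, t)\<close>, so its left limit is
    the value before the mark. The meeting condition thus becomes the annihilation case of
    \<open>step_pair\<close>.\<close>
  have lim: "(dsc \<longlongrightarrow> sc t) (at_left t) \<longleftrightarrow> sc t = dsc s"
    by (rule tendsto_left_const[OF mark(2) const(1)])
  have no: "\<not> (dsc \<longlongrightarrow> sc r) (at_left r)" if "s < r" "r < t" for r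
  proof -
    have "(dsc \<longlongrightarrow> sc r) (at_left r) \<longleftrightarrow> sc r = dsc s"
      using that by (intro tendsto_left_const[OF _ const(1)]) auto
    then show ?thesis using const[of r] that ps by (auto simp: pair_def)
  qed
  have met: "met t \<longleftrightarrow> met s \<or> sc t = dsc s"
  proof
    assume "met t"
    then obtain r where r: "0 < r" "r \<le> t" "(dsc \<longlongrightarrow> sc r) (at_left r)" by (auto simp: met_def)
    then consider "r \<le> s" | "r = t" using no[of r] by linarith
    then show "met s \<or> sc t = dsc s" using r lim by cases (auto simp: met_def)
  next
    assume "met s \<or> sc t = dsc s"
    then show "met t"
    proof
      assume "met s"
      then show "met t" using mark(2) unfolding met_def by (meson less_imp_le order_trans)
    next
      assume "sc t = dsc s"
      then show "met t" using lim mark(1,2) unfolding met_def by (intro exI[of _ t]) simp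
    qed
  qed
  have uW: "(u, t) \<in> W R s t" using mark(3) by simp
  have co: "H R S0 s \<subseteq> coords s \<inter> {0..R}" using assms(1) mark(1) by (intro H_coords) auto
  have u: "u = 0 \<or> u \<notin> insert (sc s) (H R S s)"
    using W_fresh[OF uW] co ps by (auto simp: pair_def)
  have fin: "finite (H R S s)" using assms(1) mark(1) by (intro H_finite) auto
  have p: "sc s \<notin> H R S s" "dsc s \<in> H R S s" "sc s < dsc s" "H R S0 s = insert (sc s) (H R S s)"
    "H R S1 s = H R S s - {dsc s}"
    using ps by (auto simp: pair_def)
  have sc0: "0 \<le> sc s" using co p(4) by auto
  have u': "u = 0 \<or> (u \<notin> H R S s \<and> u \<noteq> sc s)" using u by auto
  have alive': "step u (H R S s - {dsc s}) \<noteq> step u (H R S s)"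
    using mark(5) by (simp add: Ht p(5))
  obtain Y Y' where Y: "Y \<notin> step u (H R S s)" "step u (insert (sc s) (H R S s)) = insert Y (step u (H R S s))"
    "Y' \<in> step u (H R S s)" "step u (H R S s - {dsc s}) = step u (H R S s) - {Y'}" "Y < Y'"
    "step u (insert (sc s) (H R S s - {dsc s})) = (if Y = dsc s then step u (H R S s) else insert Y (step u (H R S s) - {Y'}))"
    by (rule step_pair[OF fin p(1-3) sc0 W_nonneg[OF uW] u' alive'])
  have pt: "pair R t Y Y'" using Y p unfolding pair_def Ht by metis
  then have e: "sc t = Y" "dsc t = Y'" using pair_eq[OF pt assms(1)] mark(1,2) by auto
  have "H R S2 t = (if met t then H R S t else insert Y (H R S t - {Y'}))"
    using Y(6) Z unfolding Ht met e by (cases "met s") simp_all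
  then show ?case using pt e by simp
qed

lemma sub_S0: "S \<subseteq> insert 0 S" "S1 \<subseteq> insert 0 S" "S2 \<subseteq> insert 0 S" "S0 \<subseteq> insert 0 S"
  by auto

lemma H_count:
  assumes "0 \<le> s" "s \<le> s'" "card (W R 0 s) = card (W R 0 s')"
  shows "H R C s = H R C s'"
proof -
  have "W R 0 s' = W R 0 s \<union> W R s s'" using assms by (intro W_split) auto
  moreover have "W R 0 s = W R 0 s'" using assms by (intro card_subset_eq) (auto simp: W_split[of 0 s s'])
  moreover have "W R 0 s \<inter> W R s s' = {}" by (auto simp: W_def)
  ultimately have "W R s s' = {}" by blast
  then show ?thesis using assms by (simp add: H_empty)
qed

lemma H_cut:
  assumes "C \<subseteq> insert 0 S" "0 \<le> x" "x \<le> R" "y \<le> x" "0 \<le> s"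
  shows "H R C s \<inter> {..y} = H x C s \<inter> {..y}"
  using H_restrict[of C x R s] initial_finite[OF assms(1)] assms by auto

lemma alive_before:
  assumes "0 \<le> s" "s \<le> t" "H R S1 t \<noteq> H R S t"
  shows "H R S1 s \<noteq> H R S s"
  using H_eq_later[of s t R S1 S] assms by auto

context
  fixes R s :: real
  assumes R: "0 < R" and s: "0 \<le> s" and alive: "H R S1 s \<noteq> H R S s"
begin

lemma alive_pair: "pair R s (sc s) (dsc s)"
  using pair_invariant[OF R s alive] by blast

lemma sc_coords: "sc s \<in> coords s" "0 \<le> sc s" "dsc s \<in> coords s"
  using alive_pair H_coords[of S0 R s] R s sub_S0 by (auto simp: pair_def)

lemma count_X: "card (H R S0 s \<inter> {..y}) = card (H R S s \<inter> {..y}) + of_bool (sc s \<le> y)"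
proof -
  have p: "sc s \<notin> H R S s" "H R S0 s = insert (sc s) (H R S s)" using alive_pair by (auto simp: pair_def)
  have fin: "finite (H R S s)" using R s by (intro H_finite) auto
  show ?thesis using fin p(1) unfolding p(2) by (cases "sc s \<le> y") auto
qed

text \<open>Replacing the particle at \<open>dsc s\<close> by one further left changes the count up
  to \<open>y\<close> exactly when \<open>y\<close> lies between the two places.\<close>

lemma count_pair:
  "real (card (H R S2 s \<inter> {..y})) - real (card (H R S s \<inter> {..y})) =
    of_bool (\<not> met s \<and> sc s \<le> y \<and> y < dsc s)"
proof (cases "met s")
  case False
  then have Z: "H R S2 s = insert (sc s) (H R S s - {dsc s})" using pair_invariant[OF R s alive] by simp
  have p: "sc s \<notin> H R S s" "dsc s \<in> H R S s" "sc s < dsc s" using alive_pair by (auto simp: pair_def)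
  have fin: "finite (H R S s \<inter> {..y})" using H_finite[of S R s] R s by auto
  consider "y < sc s" | "sc s \<le> y" "y < dsc s" | "dsc s \<le> y" by linarith
  then show ?thesis
  proof cases
    case 1
    then have "H R S2 s \<inter> {..y} = H R S s \<inter> {..y}" unfolding Z using p(3) by auto
    then show ?thesis using 1 by simp
  next
    case 2
    have nin: "sc s \<notin> H R S s \<inter> {..y}" using p(1) by simp
    have e: "H R S2 s \<inter> {..y} = insert (sc s) (H R S s \<inter> {..y})" unfolding Z using 2 by auto
    have "card (H R S2 s \<inter> {..y}) = Suc (card (H R S s \<inter> {..y}))"
      unfolding e using fin nin by (rule card_insert_disjoint)
    then show ?thesis using 2 False by simp
  next
    case 3
    then have e: "H R S2 s \<inter> {..y} = insert (sc s) (H R S s \<inter> {..y} - {dsc s})" unfolding Z using p(3) by auto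
    have "dsc s \<in> H R S s \<inter> {..y}" using 3 p by auto
    then have "card (H R S s \<inter> {..y} - {dsc s}) = card (H R S s \<inter> {..y}) - 1" "card (H R S s \<inter> {..y}) > 0"
      using fin by (auto simp: card_gt_0_iff)
    then have "card (H R S2 s \<inter> {..y}) = card (H R S s \<inter> {..y})"
      unfolding e using fin p(1) by simp
    then show ?thesis using 3 by simp
  qed
next
  case True
  then show ?thesis using pair_invariant[OF R s alive] by simp
qed

end

text \<open>Excluding the particle positions and the meeting time removes the differences between
  strict and weak inequalities; these exceptions form a null set in each bounded rectangle.\<close>

lemma region_iff:
  assumes "0 < R" "0 < s" "H R S1 s \<noteq> H R S s" "y \<notin> coords s" "ereal s \<noteq> meeting_time sc dsc"
  shows "(y, s) \<in> enclosed_region sc dsc \<longleftrightarrow> \<not> met s \<and> sc s \<le> y \<and> y < dsc s"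
proof -
  have y: "y \<noteq> sc s" using sc_coords(1)[OF assms(1) _ assms(3)] assms(2,4) by auto
  have 1: "\<not> met s" if "ereal s < meeting_time sc dsc"
  proof
    assume "met s"
    then obtain r where "0 < r" "r \<le> s" "(dsc \<longlongrightarrow> sc r) (at_left r)" by (auto simp: met_def)
    then have "meeting_time sc dsc \<le> ereal r" unfolding meeting_time_def by (intro INF_lower) auto
    then show False using that \<open>r \<le> s\<close> by (meson ereal_less_eq(3) leD order_trans)
  qed
  have 2: "ereal s < meeting_time sc dsc" if "\<not> met s"
  proof -
    have "ereal s \<le> meeting_time sc dsc" unfolding meeting_time_def
      using that by (intro INF_greatest) (force simp: met_def not_le)
    then show ?thesis using assms(5) by (simp add: less_le)
  qed
  have "sc s \<le> y \<longleftrightarrow> sc s < y" using y by auto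
  then show ?thesis using 1 2 assms(2) by (auto simp: enclosed_region_def)
qed

text \<open>Both trajectories depend on time only through the number of marks so far, which is a
  monotone and hence Borel function of time.\<close>

lemma region_measurable:
  assumes "0 < R" "H R S1 t \<noteq> H R S t"
  shows "enclosed_region sc dsc \<inter> ({0..x} \<times> {0..t}) \<in> sets borel"
proof -
  define k where "k = (\<lambda>s. card (W R 0 s))"
  have mono: "k s \<le> k s'" if "s \<le> s'" for s s'
    unfolding k_def by (rule card_mono[OF W_finite]) (use that in \<open>auto simp: W_def\<close>)
  have k: "k \<in> measurable borel (count_space UNIV)"
  proof -
    have "(\<lambda>s. real (k s)) \<in> borel_measurable borel" using mono by (intro borel_measurable_mono monoI) auto
    then have "(\<lambda>s. nat \<lfloor>real (k s)\<rfloor>) \<in> measurable borel (count_space UNIV)" by measurable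
    then show ?thesis by simp
  qed
  have const: "sc s = sc s' \<and> dsc s = dsc s'" if "s \<in> {0..t}" "s' \<in> {0..t}" "k s = k s'" for s s'
  proof -
    have le: "sc s = sc s' \<and> dsc s = dsc s'" if "0 \<le> s" "s \<le> s'" "s' \<le> t" "k s = k s'" for s s'
    proof -
      have al: "H R S1 s \<noteq> H R S s" using alive_before[of s t R] that assms by auto
      have "H R C s = H R C s'" for C using that by (intro H_count) (auto simp: k_def)
      then have "pair R s' (sc s) (dsc s)" using alive_pair[OF assms(1) that(1) al] unfolding pair_def by simp
      then have "sc s' = sc s" "dsc s' = dsc s" by (rule pair_eq[OF _ assms(1)]; use that in simp)+
      then show ?thesis by simp
    qed
    show ?thesis
    proof (cases "s \<le> s'")
      case True
      then show ?thesis using le[of s s'] that by simp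
    next
      case False
      then show ?thesis using le[of s' s] that by simp
    qed
  qed
  \<comment> \<open>The value of a trajectory after \<open>m\<close> marks, read off at any time in
    \<open>[0, t]\<close> with that count.\<close>
  define \<xi> where "\<xi> = (\<lambda>f m. f (SOME s. s \<in> {0..t} \<and> k s = m) :: real)"
  have \<xi>: "\<xi> sc (k s) = sc s" "\<xi> dsc (k s) = dsc s" if "s \<in> {0..t}" for s
  proof -
    define s' where "s' = (SOME s'. s' \<in> {0..t} \<and> k s' = k s)"
    have "s' \<in> {0..t} \<and> k s' = k s" unfolding s'_def by (rule someI[of _ s]) (use that in auto)
    then show "\<xi> sc (k s) = sc s" "\<xi> dsc (k s) = dsc s"
      unfolding \<xi>_def s'_def[symmetric] using const[of s' s] that by blast+
  qed
  have m: "(\<lambda>s. \<xi> f (k s)) \<in> borel_measurable borel" for f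
    by (rule measurable_compose[OF k]) simp
  have "enclosed_region sc dsc \<inter> ({0..x} \<times> {0..t}) =
    {p \<in> space (borel \<Otimes>\<^sub>M borel). fst p \<in> {0..x} \<and> snd p \<in> {0..t} \<and> 0 < snd p \<and> ereal (snd p) < meeting_time sc dsc \<and>
       \<xi> sc (k (snd p)) < fst p \<and> fst p < \<xi> dsc (k (snd p))}"
    by (intro set_eqI iffI; clarsimp simp: enclosed_region_def space_pair_measure; simp add: \<xi>)
  also have "\<dots> \<in> sets (borel \<Otimes>\<^sub>M borel)"
  proof -
    have [measurable]: "(\<lambda>p. \<xi> f (k (snd p))) \<in> borel_measurable (borel \<Otimes>\<^sub>M borel)" for f
      by (rule measurable_compose[OF measurable_snd m])
    show ?thesis by measurable
  qed
  finally show ?thesis unfolding borel_prod .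
qed

end

section \<open>Discretization\<close>

text \<open>The left endpoint \<open>-1\<close> of the first column puts the location \<open>0\<close> into that column.\<close>

definition gridpt :: "real \<Rightarrow> nat \<Rightarrow> nat \<Rightarrow> real" where
  "gridpt x n i = (if i = 0 then -1 else x * i / n)"

definition slot :: "real \<Rightarrow> nat \<Rightarrow> nat \<Rightarrow> real set" where
  "slot x n i = {gridpt x n (i - 1)<..gridpt x n i}"

definition conf :: "real \<Rightarrow> real \<Rightarrow> nat \<Rightarrow> real set \<Rightarrow> real set \<Rightarrow> (real \<times> real) set \<Rightarrow> (nat \<times> nat) set" where
  "conf x t n C K A = {(i, j) \<in> grid n n.
     if j = 0 then C \<inter> slot x n i \<noteq> {} else if i = 0 then K \<inter> slot t n j \<noteq> {}
     else A \<inter> slot x n i \<times> slot t n j \<noteq> {}}"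

text \<open>Since \<open>0\<close> is included, a slot containing it contains no point of
  \<open>P\<close>. This keeps the first column of sources and the first row free for the added
  points.\<close>

definition resolves :: "real \<Rightarrow> nat \<Rightarrow> real set \<Rightarrow> bool" where
  "resolves x n P \<longleftrightarrow> (\<forall>i\<in>{1..n}. \<forall>p\<in>insert 0 P. \<forall>q\<in>insert 0 P. p \<in> slot x n i \<longrightarrow> q \<in> slot x n i \<longrightarrow> p = q)"

lemma gridpt_mono: "0 < x \<Longrightarrow> i \<le> j \<Longrightarrow> gridpt x n i \<le> gridpt x n j"
proof -
  assume a: "0 < x" "i \<le> j"
  have "-1 \<le> x * real j / real n" using a(1) by (intro order_trans[of "-1" 0 "x * real j / real n"]) auto
  moreover have "x * real i / real n \<le> x * real j / real n"
    using a by (intro divide_right_mono mult_left_mono) auto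
  ultimately show ?thesis using a(2) by (simp add: gridpt_def)
qed

lemma eventually_resolves:
  assumes "finite P" "\<forall>p\<in>P. 0 < p" "0 < x"
  shows "eventually (\<lambda>n. resolves x n P) sequentially"
proof -
  define D where "D = insert 1 ((\<lambda>(p, q). \<bar>p - q\<bar>) ` {(p, q) \<in> insert 0 P \<times> insert 0 P. p \<noteq> q})"
  have "finite {(p, q) \<in> insert 0 P \<times> insert 0 P. p \<noteq> q}"
    by (rule finite_subset[of _ "insert 0 P \<times> insert 0 P"]) (use assms(1) in auto)
  then have "finite D" unfolding D_def by blast
  define d where "d = Min D"
  have "d \<in> D" unfolding d_def using \<open>finite D\<close> by (intro Min_in) (auto simp: D_def)
  then have "d > 0" by (auto simp: D_def)
  have d: "p = q" if "p \<in> insert 0 P" "q \<in> insert 0 P" "\<bar>p - q\<bar> < d" for p q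
  proof (rule ccontr)
    assume "p \<noteq> q"
    then have "\<bar>p - q\<bar> \<in> D" using that by (auto simp: D_def)
    then have "d \<le> \<bar>p - q\<bar>" unfolding d_def using \<open>finite D\<close> by (intro Min_le)
    then show False using that by simp
  qed
  have "eventually (\<lambda>n. x / d < real n) sequentially"
    using filterlim_real_sequentially by (simp add: filterlim_at_top_dense)
  then show ?thesis
  proof eventually_elim
    case (elim n)
    have "0 < x / d" using assms(3) \<open>d > 0\<close> by simp
    then have "0 < real n" using elim by (rule less_trans)
    then have n: "n > 0" "x / n < d" using elim \<open>d > 0\<close> by (simp_all add: divide_less_eq mult.commute)
    show ?case unfolding resolves_def
    proof (intro ballI impI)
      fix i p q assume i: "i \<in> {1..n}" and pq: "p \<in> insert 0 P" "q \<in> insert 0 P" "p \<in> slot x n i" "q \<in> slot x n i"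
      \<comment> \<open>The first slot is longer, as it starts at \<open>-1\<close>, but the points
        in question are nonnegative.\<close>
      have "\<bar>p - q\<bar> \<le> x / n"
      proof (cases "i = 1")
        case True
        then have "p \<le> x / n" "q \<le> x / n" using pq by (auto simp: slot_def gridpt_def)
        moreover have "0 \<le> p" "0 \<le> q" using pq(1,2) assms(2) by (auto intro: less_imp_le)
        ultimately show ?thesis by linarith
      next
        case False
        then have "x * real (i - 1) / n = x * i / n - x / n" using i
          by (simp add: of_nat_diff right_diff_distrib diff_divide_distrib)
        moreover have "p \<le> x * i / n" "q \<le> x * i / n" "x * real (i - 1) / n < p" "x * real (i - 1) / n < q"
          using pq(3,4) False i by (auto simp: slot_def gridpt_def split: if_splits)
        ultimately show ?thesis by linarith
      qed
      then show "p = q" using d[OF pq(1,2)] n by linarith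
    qed
  qed
qed

text \<open>\<open>v u C i\<close> means that the jump caused by \<open>u\<close> crosses the border
  \<open>g i\<close>. It also holds if there is no candidate at all: then the particle comes from
  beyond the window. With at most one location per slot, crossing and occupation obey the recursion
  of \<open>vinc\<close> and \<open>hinc\<close>.\<close>

lemma row_step:
  fixes g :: "nat \<Rightarrow> real"
  defines "v \<equiv> \<lambda>u C i. (u = 0 \<or> u \<le> g i) \<and> (\<forall>d\<in>up u C. g i < d)"
  assumes fin: "finite C" and g: "g (i - 1) \<le> g i"
    and uC: "u = 0 \<or> u \<notin> C" and i: "1 \<le> i"
    and uniq: "\<And>p q. p \<in> C \<union> (if u = 0 then {} else {u}) \<Longrightarrow> q \<in> C \<union> (if u = 0 then {} else {u}) \<Longrightarrow>
      g (i - 1) < p \<Longrightarrow> p \<le> g i \<Longrightarrow> g (i - 1) < q \<Longrightarrow> q \<le> g i \<Longrightarrow> p = q"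
  shows "v u C i \<longleftrightarrow> (v u C (i - 1) \<or> (u \<noteq> 0 \<and> u \<in> {g (i - 1)<..g i})) \<and> C \<inter> {g (i - 1)<..g i} = {}"
    and "step u C \<inter> {g (i - 1)<..g i} \<noteq> {} \<longleftrightarrow>
       (C \<inter> {g (i - 1)<..g i} \<noteq> {} \<or> (u \<noteq> 0 \<and> u \<in> {g (i - 1)<..g i})) \<and> \<not> v u C (i - 1)"
proof -
  show "v u C i \<longleftrightarrow> (v u C (i - 1) \<or> (u \<noteq> 0 \<and> u \<in> {g (i - 1)<..g i})) \<and> C \<inter> {g (i - 1)<..g i} = {}"
    (is "_ \<longleftrightarrow> ?r")
  proof
    assume v: "v u C i"
    have "C \<inter> {g (i - 1)<..g i} = {}"
    proof (rule ccontr)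
      assume "C \<inter> {g (i - 1)<..g i} \<noteq> {}"
      then obtain c where c: "c \<in> C" "g (i - 1) < c" "c \<le> g i" by auto
      have "c \<notin> up u C" using v c by (auto simp: v_def)
      then have u: "u \<noteq> 0" "c \<le> u" using c by (auto simp: in_up)
      then have "u \<le> g i" using v by (auto simp: v_def)
      then have "c = u" using uniq[of c u] u c by auto
      then show False using uC u c by auto
    qed
    moreover have "v u C (i - 1) \<or> (u \<noteq> 0 \<and> u \<in> {g (i - 1)<..g i})"
    proof -
      have "\<forall>d\<in>up u C. g (i - 1) < d" using v g unfolding v_def by (meson order_le_less_trans)
      then show ?thesis using v by (auto simp: v_def)
    qed
    ultimately show ?r by simp
  next
    assume r: ?r
    have "g i < d" if d: "d \<in> up u C" for d
    proof -
      have "g (i - 1) < d"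
        using r
      proof (elim conjE disjE)
        assume "v u C (i - 1)"
        then show ?thesis using d by (auto simp: v_def)
      next
        assume "u \<noteq> 0" "u \<in> {g (i - 1)<..g i}"
        then show ?thesis using d by (auto simp: in_up)
      qed
      then show ?thesis using r d by (auto simp: in_up)
    qed
    moreover have "u = 0 \<or> u \<le> g i" using r g by (auto simp: v_def)
    ultimately show "v u C i" by (auto simp: v_def)
  qed
  show "step u C \<inter> {g (i - 1)<..g i} \<noteq> {} \<longleftrightarrow>
       (C \<inter> {g (i - 1)<..g i} \<noteq> {} \<or> (u \<noteq> 0 \<and> u \<in> {g (i - 1)<..g i})) \<and> \<not> v u C (i - 1)"
    (is "?l \<longleftrightarrow> ?r")
  proof
    assume ?l
    then obtain d where d: "d \<in> step u C" "g (i - 1) < d" "d \<le> g i" by auto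
    have "C \<inter> {g (i - 1)<..g i} \<noteq> {} \<or> (u \<noteq> 0 \<and> u \<in> {g (i - 1)<..g i})"
      using d by (auto simp: step_up split: if_splits)
    moreover have "\<not> v u C (i - 1)"
    proof
      assume v: "v u C (i - 1)"
      then have ud: "u = 0 \<or> u < d" using d by (auto simp: v_def)
      then have dC: "d \<in> C" "d \<notin> leftmost (up u C)" using d by (auto simp: step_up split: if_splits)
      then have dU: "d \<in> up u C" using ud by (simp add: in_up)
      define y where "y = Min (up u C)"
      have y: "y \<in> up u C" "y \<le> d" using dU fin by (auto simp: y_def intro: Min_in)
      have "leftmost (up u C) = {y}" unfolding y_def using fin dU by (intro leftmost_Min) auto
      moreover have "y \<in> C" "g (i - 1) < y" using y v by (auto simp: v_def in_up)
      ultimately show False using uniq[of y d] y d dC by auto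
    qed
    ultimately show ?r by simp
  next
    assume r: ?r
    show ?l
    proof (cases "u \<noteq> 0 \<and> u \<in> {g (i - 1)<..g i}")
      case True
      then show ?thesis by (auto simp: step_up)
    next
      case False
      then obtain c where c: "c \<in> C" "g (i - 1) < c" "c \<le> g i" using r by auto
      have "c \<notin> leftmost (up u C)"
      proof
        assume lm: "c \<in> leftmost (up u C)"
        then have "\<forall>d\<in>up u C. g (i - 1) < d" using c by (auto simp: leftmost_def)
        then have u: "u \<noteq> 0" "g (i - 1) < u" using r by (auto simp: v_def)
        moreover have "u < c" using lm u by (auto simp: leftmost_def in_up)
        ultimately show False using False c by auto
      qed
      then show ?thesis using c by (auto simp: step_up)
    qed
  qed
qed

lemma slot_exists:
  assumes "0 < p" "p \<le> x" "n > 0"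
  obtains i where "i \<in> {1..n}" "p \<in> slot x n i"
proof -
  define i where "i = (LEAST i. p \<le> gridpt x n i)"
  have n: "p \<le> gridpt x n n" using assms by (simp add: gridpt_def)
  have i: "p \<le> gridpt x n i" "i \<le> n" unfolding i_def using n by (auto intro: LeastI Least_le)
  have "i \<noteq> 0" using i(1) assms(1) by (auto simp: gridpt_def intro: ccontr)
  moreover have "\<not> p \<le> gridpt x n (i - 1)"
    using not_less_Least[of "i - 1" "\<lambda>i. p \<le> gridpt x n i"] \<open>i \<noteq> 0\<close> by (simp add: i_def[symmetric])
  ultimately show thesis using that[of i] i by (auto simp: slot_def)
qed

lemma slot_le: "0 < x \<Longrightarrow> p \<in> slot x n i \<Longrightarrow> i \<le> n \<Longrightarrow> n > 0 \<Longrightarrow> p \<le> x"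
proof -
  assume "0 < x" "p \<in> slot x n i" "i \<le> n" "n > 0"
  then have "p \<le> gridpt x n i" "gridpt x n i \<le> gridpt x n n" by (auto simp: slot_def intro: gridpt_mono)
  then show ?thesis using \<open>n > 0\<close> by (simp add: gridpt_def)
qed

lemma slot_order:
  assumes "0 < x" "p \<in> slot x n i" "q \<in> slot x n k" "p \<le> q"
  shows "i \<le> k"
proof (rule ccontr)
  assume "\<not> i \<le> k"
  then have "gridpt x n k \<le> gridpt x n (i - 1)" using assms(1) by (intro gridpt_mono) auto
  then show False using assms by (auto simp: slot_def)
qed

text \<open>After the first row, a point in the corner cell swallows the leftmost source and leaves a particle
  in the first column.\<close>

lemma cnt_corner:
  assumes c: "\<And>k. (k, 1) \<notin> c" "(0, 0) \<notin> c" "(1, 0) \<notin> c" and ij: "1 \<le> j"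
  shows "cnt (insert (1, 1) c) i j = cnt (insert (1, 0) (drop_first c)) i j"
proof -
  define d where "d = insert (1, 0) (drop_first c)"
  define e where "e = insert (1, 1) c"
  have d0: "(k, l) \<in> d \<longleftrightarrow> (k, l) \<in> c" if "l \<noteq> 0" for k l using that by (auto simp: d_def drop_first_def)
  have e0: "(k, l) \<in> e \<longleftrightarrow> (k, l) \<in> c" if "l \<noteq> 1" for k l using that by (auto simp: e_def)
  have e1: "(k, 1) \<in> e \<longleftrightarrow> k = 1" for k using c by (auto simp: e_def)
  have v1: "vinc e k 1 \<longleftrightarrow> k \<ge> 1 \<and> (\<forall>l. 1 \<le> l \<and> l \<le> k \<longrightarrow> (l, 0) \<notin> c)" for k
  proof (induction k)
    case 0
    then show ?case using e1 by (simp add: hinc_vinc_axis)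
  next
    case (Suc k)
    have "vinc e (Suc k) 1 \<longleftrightarrow> (vinc e k 1 \<or> k = 0) \<and> (Suc k, 0) \<notin> c"
      using e1[of "Suc k"] e0[of 0 "Suc k"] by simp
    then show ?case using Suc by (auto simp: le_Suc_eq)
  qed
  have dk: "(k, 0) \<in> d \<longleftrightarrow> k = 1 \<or> ((k, 0) \<in> c \<and> (\<exists>l<k. (l, 0) \<in> c))" for k
  proof -
    have "(k, 0) \<in> drop_first c \<longleftrightarrow> (k, 0) \<in> c \<and> \<not> (\<forall>l. (l, 0) \<in> c \<longrightarrow> k \<le> l)"
      by (auto simp: drop_first_def)
    then show ?thesis by (auto simp: d_def not_le)
  qed
  have h1: "hinc e k 1 \<longleftrightarrow> k \<ge> 1 \<and> (k, 0) \<in> d" for k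
  proof (cases k)
    case (Suc k')
    have "hinc e (Suc k') 1 \<longleftrightarrow> ((Suc k', 0) \<in> c \<or> k' = 0) \<and> \<not> vinc e k' 1"
      using e1[of "Suc k'"] e0[of 0 "Suc k'"] by simp
    also have "\<dots> \<longleftrightarrow> (Suc k', 0) \<in> d"
    proof (cases "k' = 0")
      case True
      then show ?thesis using e1[of 0] by (simp add: d_def)
    next
      case False
      have "(\<exists>l<Suc k'. (l, 0) \<in> c) \<longleftrightarrow> \<not> (\<forall>l. 1 \<le> l \<and> l \<le> k' \<longrightarrow> (l, 0) \<notin> c)"
        using c(2) by (metis One_nat_def Suc_leI less_Suc_eq_le neq0_conv)
      then show ?thesis using False v1[of k'] dk[of "Suc k'"] by auto
    qed
    finally show ?thesis using Suc by simp
  qed simp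
  have vd1: "\<not> vinc d k 1" for k
    by (induction k) (use c d0[of 1] in auto)
  have hd1: "hinc d k 1 \<longleftrightarrow> k \<ge> 1 \<and> (k, 0) \<in> d" for k
    using c d0[of 1] vd1 by (cases k) auto
  \<comment> \<open>After row \<open>1\<close> both configurations have the same occupied columns
    and the same points above, so they agree from then on.\<close>
  have "(\<forall>k. hinc e k (Suc j) = hinc d k (Suc j))" for j
  proof (induction j)
    case 0
    then show ?case using h1 hd1 by simp
  next
    case (Suc j)
    have ed: "(k, Suc (Suc j)) \<in> e \<longleftrightarrow> (k, Suc (Suc j)) \<in> d" for k
      using d0[of "Suc (Suc j)" k] e0[of "Suc (Suc j)" k] by simp
    have v: "vinc e k (Suc (Suc j)) = vinc d k (Suc (Suc j))" for k
    proof (induction k)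
      case 0
      then show ?case using ed[of 0] by simp
    next
      case (Suc k)
      then show ?case using ed[of "Suc k"] \<open>\<forall>k. hinc e k (Suc j) = hinc d k (Suc j)\<close>
        by (simp only: vinc.simps(3))
    qed
    show ?case
    proof
      fix k
      show "hinc e k (Suc (Suc j)) = hinc d k (Suc (Suc j))"
      proof (cases k)
        case (Suc k')
        have "hinc e (Suc k') (Suc j) = hinc d (Suc k') (Suc j)"
          using \<open>\<forall>k. hinc e k (Suc j) = hinc d k (Suc j)\<close> by blast
        then show ?thesis
          using ed[of "Suc k'"] v[of k']
          unfolding Suc hinc.simps(3)[of e k' "Suc j"] hinc.simps(3)[of d k' "Suc j"] by blast
      qed simp
    qed
  qed
  then have "hinc e k j = hinc d k j" for k using ij by (cases j) auto
  then show ?thesis unfolding cnt_def d_def[symmetric] e_def[symmetric] by simp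
qed

section \<open>The particle system obeys the lattice recursion\<close>

context configuration
begin

context
  fixes x t :: real and n :: nat
  assumes x: "0 < x" and t: "0 < t" and n: "0 < n"
    and rx: "resolves x n (S \<inter> {..x} \<union> fst ` (A \<inter> {..x} \<times> {..t}))"
    and rt: "resolves t n (K \<inter> {..t} \<union> snd ` (A \<inter> {..x} \<times> {..t}))"
begin

abbreviation level :: "nat \<Rightarrow> real" where "level j \<equiv> t * j / n"

lemma level_mono: "i \<le> j \<Longrightarrow> level i \<le> level j"
  using t by (intro divide_right_mono mult_left_mono) auto

lemma level_le: "j \<le> n \<Longrightarrow> level j \<le> t"
  using level_mono[of j n] n by simp

lemma level_nonneg: "0 \<le> level j"
  using t by simp

lemma coords_unique:
  assumes "p \<in> coords t" "q \<in> coords t" "i \<in> {1..n}" "p \<in> slot x n i" "q \<in> slot x n i"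
  shows "p = q"
proof -
  have "p \<le> x" "q \<le> x" using slot_le[OF x] assms n by auto
  then have "p \<in> insert 0 (S \<inter> {..x} \<union> fst ` (A \<inter> {..x} \<times> {..t}))" "q \<in> insert 0 (S \<inter> {..x} \<union> fst ` (A \<inter> {..x} \<times> {..t}))"
    using assms(1,2) by (force simp: coords_def)+
  then show ?thesis using rx assms unfolding resolves_def by blast
qed

lemma slot_level: "0 < r \<Longrightarrow> 1 \<le> j \<Longrightarrow> r \<in> slot t n j \<longleftrightarrow> level (j - 1) < r \<and> r \<le> level j"
  by (auto simp: slot_def gridpt_def)

lemma mark_times:
  assumes "(u, r) \<in> W x 0 t"
  shows "r \<in> K \<inter> {..t} \<union> snd ` (A \<inter> {..x} \<times> {..t})"
  using assms by (force simp: W_def marks_def)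

lemma row_marks:
  assumes j: "j \<in> {1..n}" and p: "p \<in> W x (level (j - 1)) (level j)"
  shows "W x (level (j - 1)) (level j) = {p}"
proof -
  have "q = p" if "q \<in> W x (level (j - 1)) (level j)" for q
  proof -
    obtain u r u' r' where pq: "p = (u, r)" "q = (u', r')" by fastforce
    have "p \<in> W x 0 t" "q \<in> W x 0 t"
      using that p level_nonneg[of "j - 1"] level_le[of j] j unfolding W_def by force+
    then have "r \<in> K \<inter> {..t} \<union> snd ` (A \<inter> {..x} \<times> {..t})" "r' \<in> K \<inter> {..t} \<union> snd ` (A \<inter> {..x} \<times> {..t})"
      using mark_times pq by auto
    moreover have "r \<in> slot t n j" "r' \<in> slot t n j"
      using that p pq j E_nonneg[of u r] E_nonneg[of u' r'] by (auto simp: slot_level W_def)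
    ultimately have "r = r'" using rt j unfolding resolves_def by blast
    then show ?thesis using that p pq E_inj[of u r u'] by (auto simp: W_def)
  qed
  then show ?thesis using p by blast
qed

context
  fixes C assumes C: "C \<subseteq> insert 0 S"
begin

abbreviation "cc \<equiv> conf x t n C K A"

lemma conf_alpha:
  assumes "i \<in> {1..n}" "j \<in> {1..n}"
  shows "(i, j) \<in> cc \<longleftrightarrow> (\<exists>u r. (u, r) \<in> W x (level (j - 1)) (level j) \<and> u \<noteq> 0 \<and> u \<in> slot x n i)"
proof
  assume "(i, j) \<in> cc"
  then obtain u r where ur: "(u, r) \<in> A" "u \<in> slot x n i" "r \<in> slot t n j"
    using assms by (auto simp: conf_def)
  moreover have "0 < u" "0 < r" "u \<le> x" using ur A_pos slot_le[OF x ur(2)] n assms by auto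
  ultimately show "\<exists>u r. (u, r) \<in> W x (level (j - 1)) (level j) \<and> u \<noteq> 0 \<and> u \<in> slot x n i"
    using assms by (intro exI[of _ u] exI[of _ r]) (auto simp: W_def marks_def slot_level)
next
  assume "\<exists>u r. (u, r) \<in> W x (level (j - 1)) (level j) \<and> u \<noteq> 0 \<and> u \<in> slot x n i"
  then obtain u r where ur: "(u, r) \<in> W x (level (j - 1)) (level j)" "u \<noteq> 0" "u \<in> slot x n i" by blast
  then have "(u, r) \<in> A" by (auto simp: W_def marks_def)
  moreover have "0 < r" using A_pos calculation by auto
  then have "r \<in> slot t n j" using ur assms by (auto simp: W_def slot_level)
  ultimately show "(i, j) \<in> cc" using ur(3) assms by (auto simp: conf_def grid_def)
qed

lemma conf_sink:
  assumes "j \<in> {1..n}"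
  shows "(0, j) \<in> cc \<longleftrightarrow> (\<exists>r. (0, r) \<in> W x (level (j - 1)) (level j))"
proof -
  have "(0, j) \<in> cc \<longleftrightarrow> (\<exists>r\<in>K. r \<in> slot t n j)" using assms by (auto simp: conf_def grid_def)
  also have "\<dots> \<longleftrightarrow> (\<exists>r\<in>K. level (j - 1) < r \<and> r \<le> level j)"
    using assms K_pos by (intro bex_cong refl slot_level) auto
  also have "\<dots> \<longleftrightarrow> (\<exists>r. (0, r) \<in> W x (level (j - 1)) (level j))"
    using x A_pos by (auto simp: W_def marks_def)
  finally show ?thesis .
qed

definition occupied :: "nat \<Rightarrow> nat \<Rightarrow> bool" where
  "occupied i j \<longleftrightarrow> H x C (level j) \<inter> slot x n i \<noteq> {}"

definition crossing :: "nat \<Rightarrow> nat \<Rightarrow> bool" where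
  "crossing i j \<longleftrightarrow> (\<exists>u r. (u, r) \<in> W x (level (j - 1)) (level j) \<and>
     (u = 0 \<or> u \<le> gridpt x n i) \<and> (\<forall>d\<in>up u (H x C (level (j - 1))). gridpt x n i < d))"

lemma H_coords_t:
  assumes "j \<le> n"
  shows "H x C (level j) \<subseteq> coords t \<inter> {0..x}"
  using H_coords[OF C, of x "level j"] x level_nonneg coords_mono[OF level_le[OF assms]] by auto

lemma link_step:
  assumes i: "i \<in> {1..n}" and j: "j \<in> {1..n}"
  shows "crossing i j \<longleftrightarrow> (crossing (i - 1) j \<or> (i, j) \<in> cc) \<and> \<not> occupied i (j - 1)"
    and "occupied i j \<longleftrightarrow> (occupied i (j - 1) \<or> (i, j) \<in> cc) \<and> \<not> crossing (i - 1) j"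
proof -
  let ?W = "W x (level (j - 1)) (level j)"
  have lev: "0 \<le> level (j - 1)" "level (j - 1) \<le> level j" using level_nonneg level_mono by auto
  have "(crossing i j \<longleftrightarrow> (crossing (i - 1) j \<or> (i, j) \<in> cc) \<and> \<not> occupied i (j - 1)) \<and>
    (occupied i j \<longleftrightarrow> (occupied i (j - 1) \<or> (i, j) \<in> cc) \<and> \<not> crossing (i - 1) j)"
  proof (cases "?W = {}")
    case True
    then have "H x C (level j) = H x C (level (j - 1))" using lev by (intro H_empty)
    then show ?thesis using True conf_alpha[OF i j] by (auto simp: crossing_def occupied_def)
  next
    case False
    then obtain u r where W: "?W = {(u, r)}" using row_marks[OF j] by (metis all_not_in_conv surj_pair)
    have ur: "(u, r) \<in> ?W" using W by simp
    let ?C = "H x C (level (j - 1))"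
    have Hj: "H x C (level j) = step u ?C" using lev W by (rule H_single)
    have fin: "finite ?C" using H_finite[OF C] x lev by auto
    have "j - 1 \<le> n" using j by auto
    then have sub: "?C \<subseteq> coords t" using H_coords_t by blast
    have ut: "u \<in> coords t" using W_coords[OF ur] coords_mono[of "level j" t] level_le j by auto
    have uC: "u = 0 \<or> u \<notin> ?C"
      using W_fresh[OF ur] H_coords[OF C, of x "level (j - 1)"] x lev by auto
    have g: "gridpt x n (i - 1) \<le> gridpt x n i" using x by (intro gridpt_mono) auto
    have uniq: "p = q" if "p \<in> ?C \<union> (if u = 0 then {} else {u})" "q \<in> ?C \<union> (if u = 0 then {} else {u})"
      "gridpt x n (i - 1) < p" "p \<le> gridpt x n i" "gridpt x n (i - 1) < q" "q \<le> gridpt x n i" for p q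
    proof (rule coords_unique[OF _ _ i])
      show "p \<in> coords t" "q \<in> coords t" using that(1,2) sub ut by (auto split: if_splits)
      show "p \<in> slot x n i" "q \<in> slot x n i" using that by (auto simp: slot_def)
    qed
    have cr: "crossing k j \<longleftrightarrow> (u = 0 \<or> u \<le> gridpt x n k) \<and> (\<forall>d\<in>up u ?C. gridpt x n k < d)" for k
      unfolding crossing_def W by auto
    have al: "(i, j) \<in> cc \<longleftrightarrow> u \<noteq> 0 \<and> u \<in> {gridpt x n (i - 1)<..gridpt x n i}"
      unfolding conf_alpha[OF i j] W slot_def by auto
    have "1 \<le> i" using i by simp
    note rs = row_step[of ?C "gridpt x n" i u, OF fin g uC this uniq]
    show ?thesis
      unfolding cr al occupied_def Hj slot_def using rs by blast
  qed
  then show "crossing i j \<longleftrightarrow> (crossing (i - 1) j \<or> (i, j) \<in> cc) \<and> \<not> occupied i (j - 1)"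
    "occupied i j \<longleftrightarrow> (occupied i (j - 1) \<or> (i, j) \<in> cc) \<and> \<not> crossing (i - 1) j" by blast+
qed

text \<open>Both sides satisfy the recursion of \<open>link_step\<close> and agree on the axes.
  Within a row the crossings are treated first, from left to right, because the occupation of a
  column depends on the crossing at its left border.\<close>

lemma link:
  assumes "j \<le> n"
  shows "(\<forall>i\<in>{1..n}. hinc cc i j = occupied i j) \<and> (1 \<le> j \<longrightarrow> (\<forall>i\<le>n. vinc cc i j = crossing i j))"
  using assms
proof (induction j)
  case 0
  have "occupied i 0 \<longleftrightarrow> C \<inter> slot x n i \<noteq> {}" if i: "i \<in> {1..n}" for i
  proof -
    have "C \<inter> slot x n i = (C \<inter> {0..x}) \<inter> slot x n i"
      using C S_pos slot_le[OF x] n i by force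
    then show ?thesis by (simp add: occupied_def H_0)
  qed
  then show ?case by (auto simp: hinc_vinc_axis conf_def grid_def)
next
  case (Suc j)
  then have j: "Suc j \<in> {1..n}" by auto
  have hj: "hinc cc i j = occupied i j" if "i \<in> {1..n}" for i using Suc that by auto
  have v: "vinc cc i (Suc j) = crossing i (Suc j)" if "i \<le> n" for i
    using that
  proof (induction i)
    case 0
    have pos: "-1 < d" if "d \<in> H x C (level j)" for d
      using H_coords_t[of j] j that by force
    \<comment> \<open>The border \<open>0\<close> lies at \<open>-1\<close>, to the left of all
      particles and \<alpha>-points, so only a sink crosses it.\<close>
    have "crossing 0 (Suc j) \<longleftrightarrow> (\<exists>r. (0, r) \<in> W x (level j) (level (Suc j)))"
    proof
      assume "crossing 0 (Suc j)"
      then obtain u r where ur: "(u, r) \<in> W x (level j) (level (Suc j))" and "u = 0 \<or> u \<le> -1"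
        by (auto simp: crossing_def gridpt_def)
      moreover have "0 \<le> u" by (rule W_nonneg[OF ur])
      ultimately have "u = 0" by linarith
      then show "\<exists>r. (0, r) \<in> W x (level j) (level (Suc j))" using ur by blast
    next
      assume "\<exists>r. (0, r) \<in> W x (level j) (level (Suc j))"
      then show "crossing 0 (Suc j)" using pos by (auto simp: crossing_def gridpt_def up_def)
    qed
    then show ?case using conf_sink[OF j] by simp
  next
    case (Suc i)
    then show ?case using link_step(1)[of "Suc i", OF _ j] hj[of "Suc i"] by auto
  qed
  moreover have "hinc cc i (Suc j) = occupied i (Suc j)" if "i \<in> {1..n}" for i
  proof -
    have "i = Suc (i - 1)" using that by auto
    then have "hinc cc i (Suc j) \<longleftrightarrow> (hinc cc i j \<or> (i, Suc j) \<in> cc) \<and> \<not> vinc cc (i - 1) (Suc j)"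
      by (metis hinc.simps(3))
    moreover have "i - 1 \<le> n" using that by auto
    moreover have "crossing (i - 1) (Suc j) = vinc cc (i - 1) (Suc j)" using v calculation(2) by blast
    ultimately show ?thesis using link_step(2)[OF that j] hj[OF that] by simp
  qed
  ultimately show ?case by blast
qed

text \<open>No slot contains two particles, so counting occupied columns counts particles.\<close>

lemma link_cnt:
  assumes "i \<le> n" "j \<le> n"
  shows "cnt cc i j = card (H x C (level j) \<inter> {..gridpt x n i})"
  using assms(1)
proof (induction i)
  case 0
  have "H x C (level j) \<inter> {..gridpt x n 0} = {}" using H_coords_t[OF assms(2)] by (force simp: gridpt_def)
  then show ?case by simp
next
  case (Suc i)
  have fin: "finite (H x C (level j))" using H_finite[OF C] x level_nonneg by auto
  have "{..gridpt x n (Suc i)} = {..gridpt x n i} \<union> slot x n (Suc i)"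
    using gridpt_mono[OF x, of i "Suc i" n] by (auto simp: slot_def)
  then have "H x C (level j) \<inter> {..gridpt x n (Suc i)} =
      (H x C (level j) \<inter> {..gridpt x n i}) \<union> (H x C (level j) \<inter> slot x n (Suc i))" by auto
  moreover have "card \<dots> = card (H x C (level j) \<inter> {..gridpt x n i}) + card (H x C (level j) \<inter> slot x n (Suc i))"
    using fin by (intro card_Un_disjoint) (auto simp: slot_def)
  moreover have "card (H x C (level j) \<inter> slot x n (Suc i)) = of_bool (occupied (Suc i) j)"
  proof (cases "occupied (Suc i) j")
    case True
    then obtain p where p: "p \<in> H x C (level j) \<inter> slot x n (Suc i)" by (auto simp: occupied_def)
    have "q = p" if "q \<in> H x C (level j) \<inter> slot x n (Suc i)" for q
      using coords_unique[of q p "Suc i"] p that H_coords_t[OF assms(2)] Suc by auto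
    then have "H x C (level j) \<inter> slot x n (Suc i) = {p}" using p by blast
    then show ?thesis using True by simp
  next
    case False
    then show ?thesis by (simp add: occupied_def)
  qed
  ultimately show ?case using Suc link[OF assms(2)] by (simp add: cnt_Suc)
qed

end

end

end

section \<open>Lattice counterparts of the modified initial configurations\<close>

context configuration
begin

context
  fixes x t :: real and n :: nat
  assumes x: "0 < x" and t: "0 < t" and n: "0 < n"
    and rx: "resolves x n (S \<inter> {..x} \<union> fst ` (A \<inter> {..x} \<times> {..t}))"
    and rt: "resolves t n (K \<inter> {..t} \<union> snd ` (A \<inter> {..x} \<times> {..t}))"
begin

lemma zero_slot: "i \<in> {1..n} \<Longrightarrow> 0 \<in> slot x n i \<longleftrightarrow> i = 1"
  using x n by (auto simp: slot_def gridpt_def zero_less_mult_iff not_less)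

lemma conf_insert_0: "conf x t n (insert 0 C) K A = insert (1, 0) (conf x t n C K A)"
proof (intro set_eqI)
  fix p :: "nat \<times> nat"
  obtain i j where p: "p = (i, j)" by fastforce
  show "p \<in> conf x t n (insert 0 C) K A \<longleftrightarrow> p \<in> insert (1, 0) (conf x t n C K A)"
  proof (cases "j = 0 \<and> i \<in> {1..n}")
    case True
    then show ?thesis using zero_slot[of i] by (auto simp: p conf_def grid_def)
  next
    case False
    then show ?thesis using n by (auto simp: p conf_def grid_def)
  qed
qed

lemma conf_first_column: "(1, 0) \<notin> conf x t n S K A"
proof
  assume "(1, 0) \<in> conf x t n S K A"
  then obtain p where p: "p \<in> S" "p \<in> slot x n 1" by (auto simp: conf_def)
  have "p \<le> x" using slot_le[OF x p(2)] n by simp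
  then have "p = 0" using rx p zero_slot[of 1] n unfolding resolves_def by force
  then show False using p zero_notin_S by simp
qed

lemma conf_first_row: "(k, 1) \<notin> conf x t n S K A"
proof
  assume c: "(k, 1) \<in> conf x t n S K A"
  have z: "0 \<in> slot t n 1" using t n by (auto simp: slot_def gridpt_def)
  have "\<exists>r \<in> K \<inter> {..t} \<union> snd ` (A \<inter> {..x} \<times> {..t}). r \<in> slot t n 1 \<and> 0 < r"
  proof (cases "k = 0")
    case True
    then obtain r where "r \<in> K" "r \<in> slot t n 1" using c by (auto simp: conf_def)
    then show ?thesis using slot_le[OF t, of r n 1] n K_pos by auto
  next
    case False
    then obtain u r where ur: "(u, r) \<in> A" "u \<in> slot x n k" "r \<in> slot t n 1" "k \<le> n"
      using c by (auto simp: conf_def grid_def)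
    then have "u \<le> x" "r \<le> t" "0 < r"
      using slot_le[OF t, of r n 1] slot_le[OF x, of u n k] n A_pos by auto
    then show ?thesis using ur by force
  qed
  then obtain r where r: "r \<in> K \<inter> {..t} \<union> snd ` (A \<inter> {..x} \<times> {..t})" "r \<in> slot t n 1" "0 < r" by blast
  have "1 \<in> {1..n}" using n by simp
  then have "r = 0" using rt r z unfolding resolves_def by blast
  then show False using r by simp
qed

lemma conf_zero: "(0, 0) \<notin> conf x t n C K A"
  by (simp add: conf_def grid_def)

lemma conf_drop_first: "conf x t n S1 K A = drop_first (conf x t n S K A)"
proof (cases "\<exists>l\<in>S. l \<le> x")
  case False
  then have "C \<inter> slot x n i = {}" if "C \<subseteq> S" "i \<le> n" for C i
    using that slot_le[OF x _ that(2) n] by blast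
  then have no: "(i, 0) \<notin> conf x t n C K A" if "C \<subseteq> S" for C i
    using that by (auto simp: conf_def grid_def)
  then have "drop_first (conf x t n S K A) = conf x t n S K A" by (auto simp: drop_first_def)
  also have "\<dots> = conf x t n S1 K A"
    using no[of S] no[of S1] by (auto simp: conf_def split: if_splits)
  finally show ?thesis by simp
next
  case True
  define l where "l = Min (S \<inter> {..x})"
  have l: "l \<in> S" "l \<le> x" "\<And>z. z \<in> S \<Longrightarrow> l \<le> z"
  proof -
    have "l \<in> S \<inter> {..x}" unfolding l_def using True S_finite by (intro Min_in) auto
    then show "l \<in> S" "l \<le> x" by auto
    show "l \<le> z" if "z \<in> S" for z
      using that S_finite[of x] \<open>l \<le> x\<close> by (cases "z \<le> x") (auto simp: l_def intro: Min_le)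
  qed
  have lm: "leftmost S = {l}" using l by (intro leftmost_eqI) auto
  have "0 < l" using l S_pos by auto
  then obtain i0 where i0: "i0 \<in> {1..n}" "l \<in> slot x n i0" using slot_exists l n by blast
  have only: "p = l" if "p \<in> S" "p \<in> slot x n i0" for p
  proof -
    have "p \<le> x" using slot_le[OF x that(2)] i0 n by simp
    then show ?thesis using rx that i0 l unfolding resolves_def by blast
  qed
  have i0c: "(i0, 0) \<in> conf x t n S K A" using i0 l by (auto simp: conf_def grid_def)
  have least: "i0 \<le> k" if k: "(k, 0) \<in> conf x t n S K A" for k
  proof -
    obtain p where "p \<in> S" "p \<in> slot x n k" using k by (auto simp: conf_def)
    then show ?thesis using slot_order[OF x i0(2)] l by blast
  qed
  have "{(i, 0) |i. (i, 0) \<in> conf x t n S K A \<and> (\<forall>k. (k, 0) \<in> conf x t n S K A \<longrightarrow> i \<le> k)} = {(i0, 0::nat)}"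
    (is "?L = _")
  proof (intro equalityI subsetI)
    fix p assume "p \<in> ?L"
    then obtain i where "p = (i, 0)" "(i, 0) \<in> conf x t n S K A" "i \<le> i0" using i0c by blast
    then show "p \<in> {(i0, 0)}" using least[of i] by simp
  qed (use i0c least in blast)
  then have d: "drop_first (conf x t n S K A) = conf x t n S K A - {(i0, 0)}" by (simp only: drop_first_def)
  have "S1 \<inter> slot x n i \<noteq> {} \<longleftrightarrow> S \<inter> slot x n i \<noteq> {} \<and> i \<noteq> i0" for i
  proof (cases "i = i0")
    case True
    then show ?thesis using only lm by auto
  next
    case False
    then have "l \<notin> slot x n i" using slot_order[OF x i0(2), of l i] slot_order[OF x _ i0(2), of l i] by auto
    then show ?thesis using False lm by auto
  qed
  then show ?thesis unfolding d by (auto simp: conf_def split: if_splits)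
qed

lemma gridpt_pos: "1 \<le> i \<Longrightarrow> gridpt x n i = x * i / n"
  by (simp add: gridpt_def)

lemma level_n: "t * n / n = t" using n by simp

text \<open>The first column has no source of its own, so the point \<open>(1, 0)\<close> is the
  extra source at the origin.\<close>

lemma flip_source_conf:
  assumes i: "i \<le> n" "1 \<le> i"
  shows "flip (1, 0) (lpp i n) (conf x t n S K A) =
    real (card (H x S0 t \<inter> {..x * i / n})) - real (card (H x S t \<inter> {..x * i / n}))"
proof -
  have "conf x t n S K A - {(1, 0)} = conf x t n S K A" using conf_first_column by simp
  then have "flip (1, 0) (lpp i n) (conf x t n S K A) = cnt (conf x t n S0 K A) i n - cnt (conf x t n S K A) i n"
    by (simp only: flip_source_cnt conf_insert_0)
  then show ?thesis
    using link_cnt[OF x t n rx rt sub_S0(1) i(1) order_refl] link_cnt[OF x t n rx rt sub_S0(4) i(1) order_refl] i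
    by (simp only: level_n gridpt_pos)
qed

text \<open>The corner cell is empty and the left edge is unaffected by it, so
  \<open>cnt_corner\<close> turns the added point into the passage from \<open>S\<close> to
  \<open>S2\<close>.\<close>

lemma flip_alpha_conf:
  assumes i: "i \<le> n" "1 \<le> i" and j: "j \<le> n" "1 \<le> j"
  shows "flip (1, 1) (lpp i j) (conf x t n S K A) =
    real (card (H x S2 (t * j / n) \<inter> {..x * i / n})) - real (card (H x S (t * j / n) \<inter> {..x * i / n}))"
proof -
  let ?c = "conf x t n S K A"
  have "?c - {(1, 1)} = ?c" using conf_first_row[of 1] by simp
  moreover have "flux (insert (1, 1) ?c) 0 j = flux ?c 0 j" by (simp add: flux_def hinc_vinc_axis)
  ultimately have "flip (1, 1) (lpp i j) ?c = cnt (insert (1, 1) ?c) i j - cnt ?c i j"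
    by (simp add: flip_def lpp_def)
  also have "cnt (insert (1, 1) ?c) i j = cnt (conf x t n S2 K A) i j"
    unfolding conf_insert_0 conf_drop_first
    by (rule cnt_corner[OF conf_first_row conf_zero conf_first_column j(2)])
  finally show ?thesis
    using link_cnt[OF x t n rx rt sub_S0(1) i(1) j(1)] link_cnt[OF x t n rx rt sub_S0(3) i(1) j(1)] i
    by (simp only: gridpt_pos)
qed

text \<open>Without the leftmost source the configuration can only lose a particle, so equal counts
  mean equal sets.\<close>

lemma drop_first_conf:
  "lpp n n (drop_first (conf x t n S K A)) = lpp n n (conf x t n S K A) \<longleftrightarrow> H x S1 t = H x S t"
proof -
  let ?c = "conf x t n S K A"
  have "flux (drop_first ?c) 0 n = flux ?c 0 n"
    unfolding flux_def by (intro sum.cong refl) (auto simp: hinc_vinc_axis drop_first_def)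
  moreover have cut: "H x C t \<inter> {..gridpt x n n} = H x C t" if "C \<subseteq> insert 0 S" for C
    using H_coords[OF that, of x t] x t n by (auto simp: gridpt_def)
  moreover have "cnt (drop_first ?c) n n = card (H x S1 t)" "cnt ?c n n = card (H x S t)"
    using link_cnt[OF x t n rx rt sub_S0(1) order_refl order_refl] link_cnt[OF x t n rx rt sub_S0(2) order_refl order_refl]
    unfolding conf_drop_first level_n cut[OF sub_S0(1)] cut[OF sub_S0(2)] by auto
  ultimately have "lpp n n (drop_first ?c) = lpp n n ?c \<longleftrightarrow> card (H x S1 t) = card (H x S t)"
    by (simp add: lpp_def)
  also have "\<dots> \<longleftrightarrow> H x S1 t = H x S t"
  proof (cases "S1 = S")
    case True
    then show ?thesis by simp
  next
    case False
    then obtain l where l: "l \<in> S" "leftmost S = {l}" using leftmost_S by blast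
    have eq: "S = insert l S1" and nin: "l \<notin> S1" using l by (simp_all add: insert_absorb)
    have fin: "finite (H x S1 t)" using H_finite[OF sub_S0(2)] x t by simp
    from H_insert[OF sub_S0(1) eq nin, of x t] x t
    consider "H x S t = H x S1 t" | y where "y \<notin> H x S1 t" "H x S t = insert y (H x S1 t)" by auto
    then show ?thesis
    proof cases
      case 2
      then have "card (H x S t) = Suc (card (H x S1 t))" using fin by simp
      then show ?thesis using 2 by auto
    qed simp
  qed
  finally show ?thesis .
qed

end

end

section \<open>From Poisson to Bernoulli points\<close>

lemma prod_grid:
  "(\<Prod>g\<in>grid n m. F g) = (\<Prod>i=1..n. F (i, 0)) * (\<Prod>j=1..m. F (0, j)) * (\<Prod>i=1..n. \<Prod>j=1..m. F (i, j) :: real)"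
proof -
  have g: "grid n m = ({1..n} \<times> {0} \<union> {0} \<times> {1..m}) \<union> {1..n} \<times> {1..m}" by (auto simp: grid_def)
  have "prod F (A \<times> B) = (\<Prod>i\<in>A. \<Prod>j\<in>B. F (i, j))" for A B :: "nat set"
    by (simp add: prod.cartesian_product)
  moreover have "prod F (grid n m) = prod F ({1..n} \<times> {0}) * prod F ({0} \<times> {1..m}) * prod F ({1..n} \<times> {1..m})"
    unfolding g by (subst prod.union_disjoint, simp, simp, force, subst prod.union_disjoint) auto
  ultimately show ?thesis by simp
qed

context prob_space
begin

lemma poisson_event:
  assumes "poisson_process M D c N" "B \<in> sets borel" "bounded B"
  shows "{\<omega>\<in>space M. card (N \<omega> \<inter> B) = k} \<in> events"
    and "prob {\<omega>\<in>space M. card (N \<omega> \<inter> B) = k} =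
      exp (- (c * measure lborel (B \<inter> D))) * (c * measure lborel (B \<inter> D)) ^ k / fact k"
proof -
  have m: "(\<lambda>\<omega>. card (N \<omega> \<inter> B)) \<in> measurable M (count_space UNIV)"
    using assms unfolding poisson_process_def by blast
  show "{\<omega>\<in>space M. card (N \<omega> \<inter> B) = k} \<in> events"
    using measurable_sets[OF m, of "{k}"] by (simp add: vimage_def Int_def conj_commute)
  show "prob {\<omega>\<in>space M. card (N \<omega> \<inter> B) = k} =
      exp (- (c * measure lborel (B \<inter> D))) * (c * measure lborel (B \<inter> D)) ^ k / fact k"
    using assms unfolding poisson_process_def by blast
qed

lemma process_eventsI:
  "B \<in> sets borel \<Longrightarrow> bounded B \<Longrightarrow> {\<omega>\<in>space M. card (N \<omega> \<inter> B) = k} \<in> process_events M N"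
  unfolding process_events_def by (intro sigma_sets.Basic) blast

lemma process_events_algebra: "sigma_algebra (space M) (process_events M N)"
  unfolding process_events_def by (rule sigma_algebra_sigma_sets) auto

lemma process_events_sub:
  assumes "poisson_process M D c N" shows "process_events M N \<subseteq> events"
  unfolding process_events_def
  by (rule sets.sigma_sets_subset) (use poisson_event(1)[OF assms] in auto)

lemma poisson_nonempty_event:
  assumes "poisson_process M D c N" "B \<in> sets borel" "bounded B"
    and \<mu>_def: "\<mu> = c * measure lborel (B \<inter> D)"
  shows "{\<omega>\<in>space M. (card (N \<omega> \<inter> B) \<noteq> 0) = b} \<in> process_events M N"
    and "prob {\<omega>\<in>space M. (card (N \<omega> \<inter> B) \<noteq> 0) = b} = (if b then 1 - exp (- \<mu>) else exp (- \<mu>))"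
proof -
  interpret P: sigma_algebra "space M" "process_events M N" by (rule process_events_algebra)
  have E: "{\<omega>\<in>space M. card (N \<omega> \<inter> B) = 0} \<in> process_events M N"
    using assms by (intro process_eventsI)
  have p0: "prob {\<omega>\<in>space M. card (N \<omega> \<inter> B) = 0} = exp (- \<mu>)"
    using poisson_event(2)[OF assms(1-3), of 0] by (simp add: \<mu>_def)
  have "{\<omega>\<in>space M. (card (N \<omega> \<inter> B) \<noteq> 0) = b} =
      (if b then space M - {\<omega>\<in>space M. card (N \<omega> \<inter> B) = 0} else {\<omega>\<in>space M. card (N \<omega> \<inter> B) = 0})"
    by auto
  then show "{\<omega>\<in>space M. (card (N \<omega> \<inter> B) \<noteq> 0) = b} \<in> process_events M N"
    "prob {\<omega>\<in>space M. (card (N \<omega> \<inter> B) \<noteq> 0) = b} = (if b then 1 - exp (- \<mu>) else exp (- \<mu>))"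
    using E p0 process_events_sub[OF assms(1)] prob_compl[of "{\<omega>\<in>space M. card (N \<omega> \<inter> B) = 0}"] by auto
qed

text \<open>The enumeration \<open>\<phi>\<close> is there because independence of a Poisson process is only stated for
  families of sets indexed by natural numbers.\<close>

lemma poisson_pattern:
  fixes B :: "'i \<Rightarrow> 'b::euclidean_space set" and \<phi> :: "'i \<Rightarrow> nat"
  assumes N: "poisson_process M D c N" and J: "finite J" "J \<noteq> {}" "inj_on \<phi> J"
    and B: "disjoint_family_on B J" "\<And>j. j \<in> J \<Longrightarrow> B j \<in> sets borel \<and> bounded (B j)"
    and E_def: "E = {\<omega>\<in>space M. \<forall>j\<in>J. (card (N \<omega> \<inter> B j) \<noteq> 0) = T j}"
  shows "E \<in> process_events M N"
    and "prob E = (\<Prod>j\<in>J. if T j then 1 - exp (- (c * measure lborel (B j \<inter> D))) else exp (- (c * measure lborel (B j \<inter> D))))"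
proof -
  interpret P: sigma_algebra "space M" "process_events M N" by (rule process_events_algebra)
  define F where "F = (\<lambda>j. {\<omega>\<in>space M. (card (N \<omega> \<inter> B j) \<noteq> 0) = T j})"
  have E: "E = (\<Inter>j\<in>J. F j)" using J by (auto simp: E_def F_def)
  show "E \<in> process_events M N"
    unfolding E using J B poisson_nonempty_event(1)[OF N] by (intro P.finite_INT) (auto simp: F_def)
  define \<psi> where "\<psi> = the_inv_into J \<phi>"
  have \<psi>: "\<psi> (\<phi> j) = j" if "j \<in> J" for j
    unfolding \<psi>_def using J(3) that by (rule the_inv_into_f_f)
  have indep: "indep_vars (\<lambda>_. count_space UNIV) (\<lambda>i \<omega>. card (N \<omega> \<inter> B (\<psi> i))) (\<phi> ` J)"
  proof -
    have "disjoint_family_on (\<lambda>i. B (\<psi> i)) (\<phi> ` J)"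
      unfolding disjoint_family_on_def
    proof (intro ballI impI)
      fix m n assume "m \<in> \<phi> ` J" "n \<in> \<phi> ` J" "m \<noteq> n"
      then obtain a b where "a \<in> J" "b \<in> J" "m = \<phi> a" "n = \<phi> b" "a \<noteq> b" by auto
      then show "B (\<psi> m) \<inter> B (\<psi> n) = {}" using B(1) \<psi> by (simp add: disjoint_family_on_def)
    qed
    moreover have "\<forall>i\<in>\<phi> ` J. B (\<psi> i) \<in> sets borel \<and> bounded (B (\<psi> i))" using B(2) \<psi> by auto
    moreover have "finite (\<phi> ` J)" using J by simp
    ultimately show ?thesis using N unfolding poisson_process_def by blast
  qed
  define A where "A = (\<lambda>i. {k. (k \<noteq> (0::nat)) = T (\<psi> i)})"
  have "prob (\<Inter>i\<in>\<phi> ` J. F (\<psi> i)) = (\<Prod>i\<in>\<phi> ` J. prob (F (\<psi> i)))"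
  proof (rule indep_setsD)
    show "indep_sets (\<lambda>i. {(\<lambda>\<omega>. card (N \<omega> \<inter> B (\<psi> i))) -` A \<inter> space M |A. A \<in> sets (count_space UNIV)}) (\<phi> ` J)"
      using indep unfolding indep_vars_def2 by blast
    show "\<forall>i\<in>\<phi> ` J. F (\<psi> i) \<in> {(\<lambda>\<omega>. card (N \<omega> \<inter> B (\<psi> i))) -` A \<inter> space M |A. A \<in> sets (count_space UNIV)}"
    proof
      fix i assume "i \<in> \<phi> ` J"
      have "F (\<psi> i) = (\<lambda>\<omega>. card (N \<omega> \<inter> B (\<psi> i))) -` A i \<inter> space M" by (auto simp: F_def A_def)
      then show "F (\<psi> i) \<in> {(\<lambda>\<omega>. card (N \<omega> \<inter> B (\<psi> i))) -` A \<inter> space M |A. A \<in> sets (count_space UNIV)}"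
        by (intro CollectI exI[of _ "A i"]) simp
    qed
  qed (use J in auto)
  moreover have "(\<Inter>i\<in>\<phi> ` J. F (\<psi> i)) = E" unfolding E using \<psi> by auto
  moreover have "(\<Prod>i\<in>\<phi> ` J. prob (F (\<psi> i))) = (\<Prod>j\<in>J. prob (F j))"
    using J(3) \<psi> by (simp add: prod.reindex)
  ultimately have "prob E = (\<Prod>j\<in>J. prob (F j))" by simp
  also have "\<dots> = (\<Prod>j\<in>J. if T j then 1 - exp (- (c * measure lborel (B j \<inter> D))) else exp (- (c * measure lborel (B j \<inter> D))))"
    unfolding F_def using B(2) by (intro prod.cong refl poisson_nonempty_event(2)[OF N]) auto
  finally show "prob E = (\<Prod>j\<in>J. if T j then 1 - exp (- (c * measure lborel (B j \<inter> D))) else exp (- (c * measure lborel (B j \<inter> D))))" .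
qed

lemma indep_three:
  assumes "indep_sets (\<lambda>i. [F0, F1, F2] ! i) {..<3}" "A \<in> F0" "B \<in> F1" "C \<in> F2"
  shows "prob (A \<inter> B \<inter> C) = prob A * prob B * prob C"
    and "prob (A \<inter> C) = prob A * prob C" "prob (B \<inter> C) = prob B * prob C"
proof -
  let ?A = "\<lambda>i. [A, B, C] ! i"
  have ABC: "?A j \<in> [F0, F1, F2] ! j" if "j \<in> {0, 1, 2}" for j :: nat using that assms by auto
  have "prob (\<Inter>j\<in>{0, 1, 2}. ?A j) = (\<Prod>j\<in>{0, 1, 2}. prob (?A j))"
    by (rule indep_setsD[OF assms(1)]) (use assms in auto)
  then show "prob (A \<inter> B \<inter> C) = prob A * prob B * prob C" by (simp add: Int_assoc mult.assoc numeral_2_eq_2)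
  have "prob (\<Inter>j\<in>{0, 2}. ?A j) = (\<Prod>j\<in>{0, 2}. prob (?A j))"
    by (rule indep_setsD[OF assms(1)]) (use assms in auto)
  then show "prob (A \<inter> C) = prob A * prob C" by (simp add: numeral_2_eq_2)
  have "prob (\<Inter>j\<in>{1, 2}. ?A j) = (\<Prod>j\<in>{1, 2}. prob (?A j))"
    by (rule indep_setsD[OF assms(1)]) (use assms in auto)
  then show "prob (B \<inter> C) = prob B * prob C" by (simp add: numeral_2_eq_2)
qed

end

section \<open>The law of the discretized Poisson points\<close>

lemma slot_borel: "slot x n i \<in> sets borel" "bounded (slot x n i)"
  by (auto simp: slot_def)

lemma slot_disjoint:
  assumes "0 < x"
  shows "disjoint_family_on (slot x n) I"
  unfolding disjoint_family_on_def
proof (intro ballI impI)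
  fix i k :: nat assume "i \<noteq> k"
  show "slot x n i \<inter> slot x n k = {}"
  proof (rule ccontr)
    assume "slot x n i \<inter> slot x n k \<noteq> {}"
    then obtain p where "p \<in> slot x n i" "p \<in> slot x n k" by auto
    then have "i \<le> k" "k \<le> i" using slot_order[OF assms] by blast+
    then show False using \<open>i \<noteq> k\<close> by simp
  qed
qed

lemma slot_pos:
  assumes "0 < x" "1 \<le> i"
  shows "slot x n i \<inter> {0<..} = {x * (i - 1) / n<..x * i / n}"
proof -
  have "0 \<le> x * real (i - 1) / real n" using assms by simp
  then have "p > 0" if "x * real (i - 1) / real n < p" for p using that by (rule le_less_trans)
  then show ?thesis using assms by (auto simp: slot_def gridpt_def)
qed

lemma slot_measure:
  assumes "0 < x" "1 \<le> i" "0 < n"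
  shows "measure lborel (slot x n i \<inter> {0<..}) = x / n"
proof -
  have "x * i / n - x * (i - 1) / n = x / n"
    using assms by (simp add: diff_divide_distrib[symmetric] right_diff_distrib[symmetric] of_nat_diff)
  moreover have "x * (i - 1) / n \<le> x * i / n" using assms by (intro divide_right_mono mult_left_mono) auto
  ultimately show ?thesis unfolding slot_pos[OF assms(1,2)] by simp
qed

lemma measure_rectangle:
  fixes A B :: "real set"
  assumes "A \<in> sets borel" "B \<in> sets borel"
  shows "measure lborel (A \<times> B) = measure lborel A * measure lborel B"
proof -
  have "emeasure lborel (A \<times> B) = emeasure lborel A * emeasure lborel B"
    unfolding lborel_prod[symmetric] using assms by (intro sigma_finite_measure.emeasure_pair_measure_Times lborel.sigma_finite_measure_axioms) auto
  then show ?thesis by (simp add: measure_def enn2real_mult)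
qed

locale hammersley_model = prob_space M for M :: "'w measure" +
  fixes \<tau> :: real and sources sinks :: "'w \<Rightarrow> real set" and alpha :: "'w \<Rightarrow> (real \<times> real) set"
  assumes tau: "\<tau> > 0"
    and sources: "poisson_process M {0<..} \<tau> sources"
    and sinks: "poisson_process M {0<..} \<tau> sinks"
    and alpha: "poisson_process M ({0<..} \<times> {0<..}) (\<tau>\<^sup>2) alpha"
    and independent: "indep_sets (\<lambda>i. [process_events M sources, process_events M sinks, process_events M alpha] ! i) {..<3}"
begin

text \<open>Like \<open>conf\<close>, but stated through cardinalities, since
  \<open>process_events\<close> is generated by them. An infinite set has cardinality
  \<open>0\<close>, so the two agree only where the point sets are locally finite, which is almost
  surely.\<close>

definition cfg :: "real \<Rightarrow> real \<Rightarrow> nat \<Rightarrow> 'w \<Rightarrow> (nat \<times> nat) set" where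
  "cfg x t n \<omega> = {(i, j) \<in> grid n n.
     if j = 0 then card (sources \<omega> \<inter> slot x n i) \<noteq> 0 else if i = 0 then card (sinks \<omega> \<inter> slot t n j) \<noteq> 0
     else card (alpha \<omega> \<inter> slot x n i \<times> slot t n j) \<noteq> 0}"

definition intensity :: "real \<Rightarrow> real \<Rightarrow> nat \<Rightarrow> nat \<times> nat \<Rightarrow> real" where
  "intensity x t n = (\<lambda>(i, j). if j = 0 then \<tau> * (x / n) else if i = 0 then \<tau> * (t / n) else \<tau> * (x / n) * (\<tau> * (t / n)))"

lemma cell_measure:
  assumes "0 < x" "0 < t" "0 < n" "1 \<le> i" "1 \<le> j"
  shows "measure lborel ((slot x n i \<times> slot t n j) \<inter> ({0<..} \<times> {0<..})) = x / n * (t / n)"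
  unfolding Sigma_Int_distrib1[symmetric] Times_Int_Times
  using assms by (subst measure_rectangle) (auto simp: slot_measure slot_borel)

lemma cfg_law:
  assumes x: "0 < x" and t: "0 < t" and n: "0 < n" and c: "c \<subseteq> grid n n"
  shows "{\<omega>\<in>space M. cfg x t n \<omega> = c} \<in> events"
    and "prob {\<omega>\<in>space M. cfg x t n \<omega> = c} =
      (\<Prod>g\<in>grid n n. if g \<in> c then 1 - exp (- intensity x t n g) else 1 - (1 - exp (- intensity x t n g)))"
proof -
  define ES where "ES = {\<omega>\<in>space M. \<forall>i\<in>{1..n}. (card (sources \<omega> \<inter> slot x n i) \<noteq> 0) = ((i, 0) \<in> c)}"
  define EK where "EK = {\<omega>\<in>space M. \<forall>j\<in>{1..n}. (card (sinks \<omega> \<inter> slot t n j) \<noteq> 0) = ((0, j) \<in> c)}"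
  define EA where "EA = {\<omega>\<in>space M. \<forall>g\<in>{1..n} \<times> {1..n}. (card (alpha \<omega> \<inter> (\<lambda>(i, j). slot x n i \<times> slot t n j) g) \<noteq> 0) = (g \<in> c)}"
  have ne: "{1..n} \<noteq> {}" using n by auto
  note pS = poisson_pattern[OF sources _ ne _ slot_disjoint[OF x] _ ES_def, where \<phi>=id]
  note pK = poisson_pattern[OF sinks _ ne _ slot_disjoint[OF t] _ EK_def, where \<phi>=id]
  have dj: "disjoint_family_on (\<lambda>(i, j). slot x n i \<times> slot t n j) ({1..n} \<times> {1..n})"
    using slot_disjoint[OF x, of n UNIV] slot_disjoint[OF t, of n UNIV]
    unfolding disjoint_family_on_def by (auto simp: Times_Int_Times) blast+
  have bb: "(\<lambda>(i, j). slot x n i \<times> slot t n j) g \<in> sets borel \<and> bounded ((\<lambda>(i, j). slot x n i \<times> slot t n j) g)" for g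
    by (cases g) (auto intro!: borel_Times bounded_Times slot_borel)
  have neA: "{1..n} \<times> {1..n} \<noteq> {}" using n by auto
  note pA = poisson_pattern[OF alpha _ neA inj_on_subset[OF inj_prod_encode subset_UNIV] dj bb EA_def]
  have mS: "ES \<in> process_events M sources" and mK: "EK \<in> process_events M sinks" and mA: "EA \<in> process_events M alpha"
    using pS(1) pK(1) pA(1) slot_borel by auto
  have eq: "{\<omega>\<in>space M. cfg x t n \<omega> = c} = ES \<inter> EK \<inter> EA"
  proof (intro set_eqI iffI)
    fix \<omega> assume "\<omega> \<in> {\<omega>\<in>space M. cfg x t n \<omega> = c}"
    then show "\<omega> \<in> ES \<inter> EK \<inter> EA" by (auto simp: cfg_def ES_def EK_def EA_def grid_def)
  next
    fix \<omega> assume w: "\<omega> \<in> ES \<inter> EK \<inter> EA"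
    have "(i, j) \<in> cfg x t n \<omega> \<longleftrightarrow> (i, j) \<in> c" for i j
    proof (cases "(i, j) \<in> grid n n")
      case False
      then show ?thesis using c by (auto simp: cfg_def)
    next
      case True
      then consider "j = 0" "i \<in> {1..n}" | "i = 0" "j \<in> {1..n}" | "i \<in> {1..n}" "j \<in> {1..n}"
        by (fastforce simp: grid_def)
      then show ?thesis
        using w True by cases (auto simp: cfg_def ES_def EK_def EA_def)
    qed
    then show "\<omega> \<in> {\<omega>\<in>space M. cfg x t n \<omega> = c}" using w by (auto simp: ES_def)
  qed
  show "{\<omega>\<in>space M. cfg x t n \<omega> = c} \<in> events"
    unfolding eq
    using mS mK mA process_events_sub[OF sources] process_events_sub[OF sinks] process_events_sub[OF alpha]
    by (intro sets.Int) blast+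
  let ?p = "\<lambda>g. if g \<in> c then 1 - exp (- intensity x t n g) else 1 - (1 - exp (- intensity x t n g))"
  have "prob {\<omega>\<in>space M. cfg x t n \<omega> = c} = prob ES * prob EK * prob EA"
    unfolding eq by (rule indep_three(1)[OF independent mS mK mA])
  also have "prob ES = (\<Prod>i=1..n. ?p (i, 0))"
  proof -
    have "prob ES = (\<Prod>i=1..n. if (i, 0) \<in> c then 1 - exp (- (\<tau> * measure lborel (slot x n i \<inter> {0<..})))
        else exp (- (\<tau> * measure lborel (slot x n i \<inter> {0<..}))))"
      using pS(2) slot_borel by simp
    also have "\<dots> = (\<Prod>i=1..n. ?p (i, 0))"
      by (intro prod.cong refl) (use x n in \<open>auto simp: intensity_def slot_measure\<close>)
    finally show ?thesis .
  qed
  also have "prob EK = (\<Prod>j=1..n. ?p (0, j))"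
  proof -
    have "prob EK = (\<Prod>j=1..n. if (0, j) \<in> c then 1 - exp (- (\<tau> * measure lborel (slot t n j \<inter> {0<..})))
        else exp (- (\<tau> * measure lborel (slot t n j \<inter> {0<..}))))"
      using pK(2) slot_borel by simp
    also have "\<dots> = (\<Prod>j=1..n. ?p (0, j))"
      by (intro prod.cong refl) (use t n in \<open>auto simp: intensity_def slot_measure\<close>)
    finally show ?thesis .
  qed
  also have "prob EA = (\<Prod>g\<in>{1..n} \<times> {1..n}. ?p g)"
  proof -
    have m: "\<tau>\<^sup>2 * measure lborel ((\<lambda>(i, j). slot x n i \<times> slot t n j) g \<inter> {0<..} \<times> {0<..}) = intensity x t n g"
      if g: "g \<in> {1..n} \<times> {1..n}" for g
    proof -
      obtain i j where ij: "g = (i, j)" "1 \<le> i" "1 \<le> j" using g by auto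
      have "\<tau>\<^sup>2 * measure lborel ((slot x n i \<times> slot t n j) \<inter> ({0<..} \<times> {0<..})) = \<tau>\<^sup>2 * (x / n * (t / n))"
        by (simp only: cell_measure[OF x t n ij(2,3)])
      also have "\<dots> = intensity x t n g" using ij by (simp add: intensity_def power2_eq_square)
      finally show ?thesis by (simp add: ij)
    qed
    have "prob EA = (\<Prod>g\<in>{1..n} \<times> {1..n}. if g \<in> c
        then 1 - exp (- (\<tau>\<^sup>2 * measure lborel ((\<lambda>(i, j). slot x n i \<times> slot t n j) g \<inter> {0<..} \<times> {0<..})))
        else exp (- (\<tau>\<^sup>2 * measure lborel ((\<lambda>(i, j). slot x n i \<times> slot t n j) g \<inter> {0<..} \<times> {0<..}))))"
      by (rule pA(2)) simp
    also have "\<dots> = (\<Prod>g\<in>{1..n} \<times> {1..n}. ?p g)"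
      by (intro prod.cong refl) (simp only: m, simp)
    finally show ?thesis .
  qed
  also have "\<dots> = (\<Prod>i=1..n. \<Prod>j=1..n. ?p (i, j))"
    by (simp add: prod.cartesian_product)
  finally show "prob {\<omega>\<in>space M. cfg x t n \<omega> = c} = (\<Prod>g\<in>grid n n. ?p g)"
    unfolding prod_grid .
qed

lemma cfg_expectation:
  assumes "0 < x" "0 < t" "0 < n"
  shows "(\<lambda>\<omega>. F (cfg x t n \<omega>)) \<in> borel_measurable M"
    and "(\<integral>\<omega>. F (cfg x t n \<omega>) \<partial>M) = bern (grid n n) (\<lambda>g. 1 - exp (- intensity x t n g)) F"
proof -
  let ?X = "\<lambda>c. {\<omega>\<in>space M. cfg x t n \<omega> = c}"
  have eq: "F (cfg x t n \<omega>) = (\<Sum>c\<in>Pow (grid n n). F c * indicator (?X c) \<omega>)" if "\<omega> \<in> space M" for \<omega>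
  proof -
    have "cfg x t n \<omega> \<in> Pow (grid n n)" by (auto simp: cfg_def)
    moreover have "(\<Sum>c\<in>Pow (grid n n). F c * indicator (?X c) \<omega>) = (\<Sum>c\<in>Pow (grid n n). if c = cfg x t n \<omega> then F c else 0)"
      using that by (intro sum.cong refl) (auto simp: indicator_def)
    ultimately show ?thesis by simp
  qed
  have ev: "?X c \<in> events" if "c \<in> Pow (grid n n)" for c using cfg_law(1)[OF assms, of c] that by auto
  show "(\<lambda>\<omega>. F (cfg x t n \<omega>)) \<in> borel_measurable M"
    by (subst measurable_cong[OF eq], assumption,
        intro borel_measurable_sum borel_measurable_times borel_measurable_const borel_measurable_indicator ev)
  have "(\<integral>\<omega>. F (cfg x t n \<omega>) \<partial>M) = (\<integral>\<omega>. (\<Sum>c\<in>Pow (grid n n). F c * indicator (?X c) \<omega>) \<partial>M)"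
    using eq by (intro Bochner_Integration.integral_cong) auto
  also have "\<dots> = (\<Sum>c\<in>Pow (grid n n). F c * prob (?X c))"
    using ev by (subst Bochner_Integration.integral_sum) (auto simp: emeasure_eq_measure)
  also have "\<dots> = bern (grid n n) (\<lambda>g. 1 - exp (- intensity x t n g)) F"
    unfolding bern_def using cfg_law(2)[OF assms] by (intro sum.cong refl) (simp add: mult.commute)
  finally show "(\<integral>\<omega>. F (cfg x t n \<omega>) \<partial>M) = bern (grid n n) (\<lambda>g. 1 - exp (- intensity x t n g)) F" .
qed

text \<open>Compares the probability that a Poisson cell of mean \<open>u\<close> is nonempty with
  the lattice probabilities \<open>u\<close> in the interior and \<open>u / (1 + u)\<close> on the
  axes; both errors are of second order.\<close>

lemma exp_bounds:
  fixes u :: real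
  assumes "0 \<le> u"
  shows "\<bar>1 - exp (- u) - u\<bar> \<le> u\<^sup>2" "\<bar>1 - exp (- u) - u / (1 + u)\<bar> \<le> u\<^sup>2"
proof -
  have 1: "1 - u \<le> exp (- u)" using exp_ge_add_one_self[of "- u"] by simp
  have 2: "exp (- u) \<le> 1 / (1 + u)"
    using assms exp_ge_add_one_self[of u] by (simp add: exp_minus inverse_eq_divide frac_le)
  have 3: "1 / (1 + u) \<le> 1 - u + u\<^sup>2"
  proof -
    have "1 \<le> (1 - u + u\<^sup>2) * (1 + u)" using assms by (simp add: algebra_simps power2_eq_square power3_eq_cube)
    then show ?thesis using assms by (simp add: pos_divide_le_eq)
  qed
  have 4: "1 - 1 / (1 + u) = u / (1 + u)" using assms by (simp add: field_simps)
  show "\<bar>1 - exp (- u) - u\<bar> \<le> u\<^sup>2" "\<bar>1 - exp (- u) - u / (1 + u)\<bar> \<le> u\<^sup>2"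
    using 1 2 3 4 by linarith+
qed

text \<open>There are \<open>2 * n\<close> axis cells of mean \<open>O(1 / n)\<close> and
  \<open>n\<^sup>2\<close> interior cells of mean \<open>O(1 / n\<^sup>2)\<close>, so the squared
  means, which bound the errors, sum to \<open>O(1 / n)\<close>.\<close>

lemma cfg_lattice:
  assumes x: "0 < x" and t: "0 < t" and F: "\<And>n c. \<bar>F n c\<bar> \<le> B"
    and lim: "(\<lambda>n. \<integral>\<omega>. F n (cfg x t n \<omega>) \<partial>M) \<longlonglongrightarrow> l"
  shows "(\<lambda>n. bern (grid n n) (lat (\<tau> * (x / n)) (\<tau> * (t / n))) (F n)) \<longlonglongrightarrow> l"
proof -
  define a b where "a = \<tau> * x" and "b = \<tau> * t"
  have ab: "a > 0" "b > 0" using tau x t by (auto simp: a_def b_def)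
  have B: "0 \<le> B" using F[of 0 "{}"] by simp
  define bound where "bound = (\<lambda>n::nat. 2 * B * (n * (a / n)\<^sup>2 + n * (b / n)\<^sup>2 + n * (n * (a / n * (b / n))\<^sup>2)))"
  have "eventually (\<lambda>n. a * b < real n) sequentially"
    using filterlim_real_sequentially by (simp add: filterlim_at_top_dense)
  then have ev: "eventually (\<lambda>n. \<bar>bern (grid n n) (lat (\<tau> * (x / n)) (\<tau> * (t / n))) (F n) - (\<integral>\<omega>. F n (cfg x t n \<omega>) \<partial>M)\<bar> \<le> bound n) sequentially"
    using eventually_gt_at_top[of 0]
  proof eventually_elim
    case (elim n)
    let ?r = "\<tau> * (x / n)" and ?s = "\<tau> * (t / n)"
    have rs: "?r > 0" "?s > 0" "?r = a / n" "?s = b / n" using elim tau x t by (auto simp: a_def b_def)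
    have rs0: "0 \<le> ?r * ?s" using rs(1,2) by (intro mult_nonneg_nonneg less_imp_le)
    have "a * b \<le> real n * real n"
    proof -
      have "1 \<le> real n" using elim(2) by simp
      then have "real n * 1 \<le> real n * real n" by (intro mult_left_mono) auto
      then show ?thesis using elim(1) by simp
    qed
    then have "?r * ?s \<le> 1" using elim unfolding rs by (simp add: divide_le_eq)
    then have "\<bar>bern (grid n n) (lat ?r ?s) (F n) - bern (grid n n) (\<lambda>g. 1 - exp (- intensity x t n g)) (F n)\<bar>
        \<le> 2 * B * (\<Sum>g\<in>grid n n. \<bar>lat ?r ?s g - (1 - exp (- intensity x t n g))\<bar>)"
      using lat_prob rs F tau x t
      by (intro bern_change_prob) (auto simp: intensity_def split: prod.splits)
    also have "\<dots> \<le> 2 * B * (\<Sum>g\<in>grid n n. (intensity x t n g)\<^sup>2)"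
    proof (intro mult_left_mono sum_mono)
      fix g assume "g \<in> grid n n"
      show "\<bar>lat ?r ?s g - (1 - exp (- intensity x t n g))\<bar> \<le> (intensity x t n g)\<^sup>2"
        using exp_bounds(2)[of ?r] exp_bounds(2)[of ?s] exp_bounds(1)[OF rs0] rs(1,2)
        by (cases g) (auto simp: lat_def intensity_def abs_minus_commute)
    qed (use B in auto)
    also have "\<dots> = bound n"
      unfolding sum_grid bound_def rs(3,4)[symmetric] by (simp add: intensity_def)
    finally show ?case using cfg_expectation(2)[OF x t elim(2), of "F n"] by simp
  qed
  have b0: "bound \<longlonglongrightarrow> 0"
  proof -
    have "(\<lambda>n. 2 * B * (a\<^sup>2 * inverse (real n) + b\<^sup>2 * inverse (real n) + (a * b)\<^sup>2 * (inverse (real n) * inverse (real n))))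
        \<longlonglongrightarrow> 2 * B * (a\<^sup>2 * 0 + b\<^sup>2 * 0 + (a * b)\<^sup>2 * (0 * 0))"
      by (intro tendsto_intros lim_inverse_n)
    moreover have "bound = (\<lambda>n. 2 * B * (a\<^sup>2 * inverse (real n) + b\<^sup>2 * inverse (real n) + (a * b)\<^sup>2 * (inverse (real n) * inverse (real n))))"
    proof
      show "bound n = 2 * B * (a\<^sup>2 * inverse (real n) + b\<^sup>2 * inverse (real n) + (a * b)\<^sup>2 * (inverse (real n) * inverse (real n)))" for n
      proof (cases "n = 0")
        case False
        then have "n * (y / n)\<^sup>2 = y\<^sup>2 * inverse (real n)" for y :: real
          by (simp add: power2_eq_square divide_inverse)
        moreover have "n * (n * (a / n * (b / n))\<^sup>2) = (a * b)\<^sup>2 * (inverse (real n) * inverse (real n))"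
        proof -
          have "m * (m * (a * i * (b * i))\<^sup>2) = (a * b)\<^sup>2 * ((m * i) * (m * i)) * (i * i)" for m i :: real
            by (simp add: power2_eq_square mult_ac)
          from this[of n "inverse n"] show ?thesis using False by (simp add: divide_inverse)
        qed
        ultimately show ?thesis by (simp only: bound_def)
      qed (simp add: bound_def)
    qed
    ultimately show ?thesis by simp
  qed
  have "(\<lambda>n. bern (grid n n) (lat (\<tau> * (x / n)) (\<tau> * (t / n))) (F n) - (\<integral>\<omega>. F n (cfg x t n \<omega>) \<partial>M)) \<longlonglongrightarrow> 0"
    by (rule Lim_null_comparison[OF _ b0]) (use ev in \<open>simp only: real_norm_def\<close>)
  from tendsto_add[OF this lim] show ?thesis by (simp only: diff_add_cancel add_0)
qed

text \<open>As an almost sure limit of measurable functions, \<open>f\<close> agrees almost surely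
  with a measurable \<open>f'\<close>; this gives measurability for the completion. Dominated
  convergence and \<open>cfg_lattice\<close> then give the limit of the lattice
  expectations.\<close>

lemma transfer:
  assumes x: "0 < x" and t: "0 < t" and F: "\<And>n c. \<bar>F n c\<bar> \<le> B"
    and lim: "AE \<omega> in M. (\<lambda>n. F n (cfg x t n \<omega>)) \<longlonglongrightarrow> f \<omega>"
  shows "f \<in> borel_measurable (completion M)"
    and "(\<lambda>n. bern (grid n n) (lat (\<tau> * (x / n)) (\<tau> * (t / n))) (F n)) \<longlonglongrightarrow> (\<integral>\<omega>. f \<omega> \<partial>completion M)"
proof -
  \<comment> \<open>The shift by \<open>Suc\<close> avoids the subdivision into \<open>0\<close>
    cells, to which \<open>cfg_expectation\<close> does not apply.\<close>
  define G where "G = (\<lambda>n \<omega>. F (Suc n) (cfg x t (Suc n) \<omega>))"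
  have G: "G n \<in> borel_measurable M" for n
    unfolding G_def using x t by (intro cfg_expectation(1)) auto
  define f' where "f' = (\<lambda>\<omega>. lim (\<lambda>n. G n \<omega>))"
  have f': "f' \<in> borel_measurable M" unfolding f'_def using G by measurable
  have limG: "AE \<omega> in M. (\<lambda>n. G n \<omega>) \<longlonglongrightarrow> f \<omega>"
    using lim
  proof eventually_elim
    case (elim \<omega>)
    then show ?case using LIMSEQ_Suc[of "\<lambda>n. F n (cfg x t n \<omega>)"] by (simp add: G_def)
  qed
  then have ff': "AE \<omega> in M. f \<omega> = f' \<omega>"
    by eventually_elim (simp add: f'_def limI)
  show f: "f \<in> borel_measurable (completion M)"
  proof (rule measurableI)
    fix A :: "real set" assume "A \<in> sets borel"
    have A': "f' -` A \<inter> space M \<in> sets (completion M)"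
      using measurable_sets[OF f' \<open>A \<in> sets borel\<close>] by auto
    have ae: "AE \<omega> in completion M. \<omega> \<in> f' -` A \<inter> space M \<longleftrightarrow> \<omega> \<in> f -` A \<inter> space (completion M)"
      using AE_completion[OF ff'] by eventually_elim auto
    show "f -` A \<inter> space (completion M) \<in> sets (completion M)"
      by (rule completion.in_sets_AE[OF ae A']) auto
  qed simp
  have "(\<lambda>n. \<integral>\<omega>. G n \<omega> \<partial>M) \<longlonglongrightarrow> (\<integral>\<omega>. f' \<omega> \<partial>M)"
  proof (rule integral_dominated_convergence[where w="\<lambda>_. B"])
    show "AE \<omega> in M. (\<lambda>n. G n \<omega>) \<longlonglongrightarrow> f' \<omega>"
      using limG ff' by eventually_elim simp
  qed (use f' G F in \<open>auto simp: G_def\<close>)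
  also have "(\<integral>\<omega>. f' \<omega> \<partial>M) = (\<integral>\<omega>. f' \<omega> \<partial>completion M)" using f' by (simp add: integral_completion)
  also have "\<dots> = (\<integral>\<omega>. f \<omega> \<partial>completion M)"
    using f f' AE_completion[OF ff'] by (intro integral_cong_AE) (auto simp: measurable_completion)
  finally have "(\<lambda>n. \<integral>\<omega>. F n (cfg x t n \<omega>) \<partial>M) \<longlonglongrightarrow> (\<integral>\<omega>. f \<omega> \<partial>completion M)"
    unfolding G_def by (rule LIMSEQ_imp_Suc)
  then show "(\<lambda>n. bern (grid n n) (lat (\<tau> * (x / n)) (\<tau> * (t / n))) (F n)) \<longlonglongrightarrow> (\<integral>\<omega>. f \<omega> \<partial>completion M)"
    by (rule cfg_lattice[OF x t F])
qed

end

section \<open>Almost sure regularity of the configuration\<close>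

text \<open>The event that all the \<open>B n\<close> occur has probability at most
  \<open>C / n\<close> for every \<open>n\<close>, hence zero.\<close>

lemma (in prob_space) AE_exists_index:
  fixes B :: "nat \<Rightarrow> 'a set"
  assumes "\<And>n. n \<ge> 1 \<Longrightarrow> B n \<in> events" "\<And>n::nat. n \<ge> 1 \<Longrightarrow> prob (B n) \<le> C / n"
  shows "AE \<omega> in M. \<exists>n\<ge>1. \<omega> \<notin> B n"
proof -
  define N where "N = (\<Inter>n\<in>{1..}. B n)"
  have N: "N \<in> events" unfolding N_def using assms(1) by (intro sets.countable_INT' countableI_type) auto
  have "prob N \<le> C * inverse (real n)" if "n \<ge> 1" for n
  proof -
    have "prob N \<le> prob (B n)" using that assms(1) by (intro finite_measure_mono) (auto simp: N_def)
    then show ?thesis using assms(2)[OF that] by (simp add: divide_inverse)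
  qed
  moreover have "(\<lambda>n. C * inverse (real n)) \<longlonglongrightarrow> C * 0" by (intro tendsto_intros lim_inverse_n)
  ultimately have "prob N \<le> C * 0"
    by (intro tendsto_lowerbound[where F=sequentially]) (auto simp: eventually_sequentially)
  then have "prob N = 0" using measure_nonneg[of M N] by simp
  then have "AE \<omega> in M. \<omega> \<notin> N" using N by (subst (asm) prob_eq_0) auto
  then show ?thesis by eventually_elim (auto simp: N_def)
qed

text \<open>A Poisson variable of mean \<open>u\<close> exceeds one with probability at most
  \<open>u\<^sup>2\<close>, so among \<open>n\<close> cells of mean at most \<open>C / n\<close> a
  pair occurs with probability at most \<open>C\<^sup>2 / n\<close>. With thin strips as cells this
  excludes common coordinates.\<close>

lemma (in prob_space) AE_no_pair:
  fixes B :: "nat \<Rightarrow> nat \<Rightarrow> 'b::euclidean_space set"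
  assumes N: "poisson_process M D c N" and c: "0 \<le> c" and C: "0 \<le> C"
    and B: "\<And>n i. 1 \<le> n \<Longrightarrow> i \<in> {1..n} \<Longrightarrow> B n i \<in> sets borel \<and> bounded (B n i) \<and> c * measure lborel (B n i \<inter> D) \<le> C / n"
  shows "AE \<omega> in M. \<exists>n\<ge>1. \<forall>i\<in>{1..n}. card (N \<omega> \<inter> B n i) \<le> 1"
proof -
  define E where "E = (\<lambda>n i k. {\<omega>\<in>space M. card (N \<omega> \<inter> B n i) = k})"
  define X where "X = (\<lambda>n i. space M - E n i 0 - E n i (Suc 0))"
  have E: "E n i k \<in> events" if "1 \<le> n" "i \<in> {1..n}" for n i k
    unfolding E_def using poisson_event(1)[OF N] B[OF that] by blast
  have pX: "prob (X n i) \<le> (C / n)\<^sup>2" if ni: "1 \<le> n" "i \<in> {1..n}" for n i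
  proof -
    define u where "u = c * measure lborel (B n i \<inter> D)"
    have u: "0 \<le> u" "u \<le> C / n" unfolding u_def using B[OF ni] c by auto
    have pE: "prob (E n i 0) = exp (- u)" "prob (E n i (Suc 0)) = exp (- u) * u"
      unfolding E_def u_def using B[OF ni] by (subst poisson_event(2)[OF N]; simp)+
    have "prob (X n i) = prob (space M - E n i 0) - prob (E n i (Suc 0))"
      unfolding X_def using E[OF ni] by (intro finite_measure_Diff) (auto simp: E_def)
    also have "\<dots> = 1 - exp (- u) * (1 + u)" using E[OF ni] by (simp add: prob_compl pE algebra_simps)
    also have "\<dots> \<le> 1 - (1 - u) * (1 + u)"
      using u exp_ge_add_one_self[of "- u"] by (intro diff_left_mono mult_right_mono) auto
    also have "\<dots> = u\<^sup>2" by (simp add: algebra_simps power2_eq_square)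
    also have "\<dots> \<le> (C / n)\<^sup>2" using u by (intro power_mono)
    finally show ?thesis .
  qed
  have "AE \<omega> in M. \<exists>n\<ge>1. \<omega> \<notin> (\<Union>i\<in>{1..n}. X n i)"
  proof (rule AE_exists_index[where C="C\<^sup>2"])
    fix n :: nat assume n: "1 \<le> n"
    have Xe: "X n i \<in> events" if "i \<in> {1..n}" for i unfolding X_def using E[OF n that] by auto
    then show "(\<Union>i\<in>{1..n}. X n i) \<in> events" by auto
    have "prob (\<Union>i\<in>{1..n}. X n i) \<le> (\<Sum>i\<in>{1..n}. prob (X n i))"
      using Xe by (intro finite_measure_subadditive_finite) auto
    also have "\<dots> \<le> (\<Sum>i\<in>{1..n}. (C / n)\<^sup>2)" using pX[OF n] by (intro sum_mono)
    also have "\<dots> = C\<^sup>2 / n" using n by (simp add: power2_eq_square)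
    finally show "prob (\<Union>i\<in>{1..n}. X n i) \<le> C\<^sup>2 / n" .
  qed
  with AE_space show ?thesis
  proof eventually_elim
    case (elim \<omega>)
    then obtain n where n: "n \<ge> 1" "\<omega> \<notin> (\<Union>i\<in>{1..n}. X n i)" by auto
    have "card (N \<omega> \<inter> B n i) \<le> 1" if "i \<in> {1..n}" for i
    proof -
      have "\<omega> \<in> E n i 0 \<or> \<omega> \<in> E n i (Suc 0)" using n(2) that elim(1) unfolding X_def by blast
      then show ?thesis unfolding E_def by (elim disjE CollectE conjE) linarith+
    qed
    then show ?case using n(1) by (intro exI[of _ n] conjI ballI)
  qed
qed

text \<open>The same count for two processes: by independence both hit a given cell with probability
  at most \<open>(C / n)\<^sup>2\<close>.\<close>

lemma (in prob_space) AE_no_common: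
  fixes B :: "nat \<Rightarrow> nat \<Rightarrow> 'b::euclidean_space set" and B' :: "nat \<Rightarrow> nat \<Rightarrow> 'c::euclidean_space set"
  assumes N: "poisson_process M D c N" "poisson_process M D' c' N'"
    and ind: "\<And>A A'. A \<in> process_events M N \<Longrightarrow> A' \<in> process_events M N' \<Longrightarrow> prob (A \<inter> A') = prob A * prob A'"
    and c: "0 \<le> c" "0 \<le> c'" and C: "0 \<le> C"
    and B: "\<And>n i. 1 \<le> n \<Longrightarrow> i \<in> {1..n} \<Longrightarrow> B n i \<in> sets borel \<and> bounded (B n i) \<and> c * measure lborel (B n i \<inter> D) \<le> C / n"
    and B': "\<And>n i. 1 \<le> n \<Longrightarrow> i \<in> {1..n} \<Longrightarrow> B' n i \<in> sets borel \<and> bounded (B' n i) \<and> c' * measure lborel (B' n i \<inter> D') \<le> C / n"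
  shows "AE \<omega> in M. \<exists>n\<ge>1. \<forall>i\<in>{1..n}. card (N \<omega> \<inter> B n i) = 0 \<or> card (N' \<omega> \<inter> B' n i) = 0"
proof -
  define X where "X = (\<lambda>n i. {\<omega>\<in>space M. (card (N \<omega> \<inter> B n i) \<noteq> 0) = True})"
  define X' where "X' = (\<lambda>n i. {\<omega>\<in>space M. (card (N' \<omega> \<inter> B' n i) \<noteq> 0) = True})"
  have X: "X n i \<in> process_events M N" "prob (X n i) \<le> C / n" if ni: "1 \<le> n" "i \<in> {1..n}" for n i
  proof -
    show "X n i \<in> process_events M N" unfolding X_def using B[OF ni] poisson_nonempty_event(1)[OF N(1)] by blast
    have "prob (X n i) = 1 - exp (- (c * measure lborel (B n i \<inter> D)))"
      unfolding X_def using B[OF ni] poisson_nonempty_event(2)[OF N(1), of "B n i" _ True] by simp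
    also have "\<dots> \<le> c * measure lborel (B n i \<inter> D)" using exp_ge_add_one_self[of "- (c * measure lborel (B n i \<inter> D))"] by simp
    finally show "prob (X n i) \<le> C / n" using B[OF ni] by linarith
  qed
  have X': "X' n i \<in> process_events M N'" "prob (X' n i) \<le> C / n" if ni: "1 \<le> n" "i \<in> {1..n}" for n i
  proof -
    show "X' n i \<in> process_events M N'" unfolding X'_def using B'[OF ni] poisson_nonempty_event(1)[OF N(2)] by blast
    have "prob (X' n i) = 1 - exp (- (c' * measure lborel (B' n i \<inter> D')))"
      unfolding X'_def using B'[OF ni] poisson_nonempty_event(2)[OF N(2), of "B' n i" _ True] by simp
    also have "\<dots> \<le> c' * measure lborel (B' n i \<inter> D')" using exp_ge_add_one_self[of "- (c' * measure lborel (B' n i \<inter> D'))"] by simp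
    finally show "prob (X' n i) \<le> C / n" using B'[OF ni] by linarith
  qed
  have "AE \<omega> in M. \<exists>n\<ge>1. \<omega> \<notin> (\<Union>i\<in>{1..n}. X n i \<inter> X' n i)"
  proof (rule AE_exists_index[where C="C\<^sup>2"])
    fix n :: nat assume n: "1 \<le> n"
    have Xe: "X n i \<inter> X' n i \<in> events" if "i \<in> {1..n}" for i
      using X(1)[OF n that] X'(1)[OF n that] process_events_sub[OF N(1)] process_events_sub[OF N(2)] by blast
    then show "(\<Union>i\<in>{1..n}. X n i \<inter> X' n i) \<in> events" by auto
    have "prob (\<Union>i\<in>{1..n}. X n i \<inter> X' n i) \<le> (\<Sum>i\<in>{1..n}. prob (X n i \<inter> X' n i))"
      using Xe by (intro finite_measure_subadditive_finite) auto
    also have "\<dots> \<le> (\<Sum>i\<in>{1..n}. C / n * (C / n))"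
    proof (intro sum_mono)
      fix i assume i: "i \<in> {1..n}"
      show "prob (X n i \<inter> X' n i) \<le> C / n * (C / n)"
        unfolding ind[OF X(1)[OF n i] X'(1)[OF n i]]
        using X(2)[OF n i] X'(2)[OF n i] C by (intro mult_mono) auto
    qed
    also have "\<dots> = C\<^sup>2 / n" using n by (simp add: power2_eq_square)
    finally show "prob (\<Union>i\<in>{1..n}. X n i \<inter> X' n i) \<le> C\<^sup>2 / n" .
  qed
  with AE_space show ?thesis
  proof eventually_elim
    case (elim \<omega>)
    then obtain n where n: "n \<ge> 1" "\<omega> \<notin> (\<Union>i\<in>{1..n}. X n i \<inter> X' n i)" by auto
    have "card (N \<omega> \<inter> B n i) = 0 \<or> card (N' \<omega> \<inter> B' n i) = 0" if "i \<in> {1..n}" for i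
    proof -
      have "\<omega> \<notin> X n i \<or> \<omega> \<notin> X' n i" using n(2) that by blast
      then show ?thesis using elim(1) unfolding X_def X'_def mem_Collect_eq by argo
    qed
    then show ?case using n(1) by (intro exI[of _ n] conjI ballI)
  qed
qed

context hammersley_model
begin

abbreviation "window N \<equiv> {0<..real (Suc N)}"

text \<open>\<open>AE_no_common\<close> wants one constant for both processes. A slot has mean
  \<open>\<tau> * R / n\<close> and a strip of \<alpha>-points has mean
  \<open>(\<tau> * R)\<^sup>2 / n\<close>; the sum of the numerators serves for both.\<close>

lemma strip_bound:
  fixes R :: real
  assumes R: "0 < R" and "1 \<le> n" "i \<in> {1..n}"
  shows "slot R n i \<in> sets borel \<and> bounded (slot R n i) \<and>
      \<tau> * measure lborel (slot R n i \<inter> {0<..}) \<le> (\<tau> * R + (\<tau> * R)\<^sup>2) / n"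
    and "slot R n i \<times> {0<..R} \<in> sets borel \<and> bounded (slot R n i \<times> {0<..R}) \<and>
      \<tau>\<^sup>2 * measure lborel ((slot R n i \<times> {0<..R}) \<inter> ({0<..} \<times> {0<..})) \<le> (\<tau> * R + (\<tau> * R)\<^sup>2) / n"
    and "{0<..R} \<times> slot R n i \<in> sets borel \<and> bounded ({0<..R} \<times> slot R n i) \<and>
      \<tau>\<^sup>2 * measure lborel (({0<..R} \<times> slot R n i) \<inter> ({0<..} \<times> {0<..})) \<le> (\<tau> * R + (\<tau> * R)\<^sup>2) / n"
proof -
  have m: "measure lborel (slot R n i \<inter> {0<..}) = R / n"
    using assms by (intro slot_measure) auto
  have b: "{0<..R} \<inter> {0<..} = {0<..R}" by auto
  have a: "0 \<le> \<tau> * R" using tau R by simp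
  show "slot R n i \<in> sets borel \<and> bounded (slot R n i) \<and>
      \<tau> * measure lborel (slot R n i \<inter> {0<..}) \<le> (\<tau> * R + (\<tau> * R)\<^sup>2) / n"
    unfolding m using a by (auto simp: slot_borel intro!: divide_right_mono)
  have "\<tau>\<^sup>2 * (R / n * R) = (\<tau> * R)\<^sup>2 / n" by (simp add: power2_eq_square)
  also have "\<dots> \<le> (\<tau> * R + (\<tau> * R)\<^sup>2) / n" using a by (intro divide_right_mono) auto
  finally have le: "\<tau>\<^sup>2 * (R / n * R) \<le> (\<tau> * R + (\<tau> * R)\<^sup>2) / n" .
  have s0: "slot R n i \<inter> {0<..} \<in> sets borel" by (intro sets.Int slot_borel) simp
  have w: "measure lborel {0<..R} = R" "{0<..R} \<in> sets borel" using R by auto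
  have mm: "measure lborel ((slot R n i \<inter> {0<..}) \<times> {0<..R}) = R / n * R"
    "measure lborel ({0<..R} \<times> (slot R n i \<inter> {0<..})) = R / n * R"
    by (simp_all only: measure_rectangle[OF s0 w(2)] measure_rectangle[OF w(2) s0] m w(1) mult.commute)
  have bb: "bounded {0<..R}" by simp
  show "slot R n i \<times> {0<..R} \<in> sets borel \<and> bounded (slot R n i \<times> {0<..R}) \<and>
      \<tau>\<^sup>2 * measure lborel ((slot R n i \<times> {0<..R}) \<inter> ({0<..} \<times> {0<..})) \<le> (\<tau> * R + (\<tau> * R)\<^sup>2) / n"
    unfolding Times_Int_Times b mm
    by (intro conjI le borel_Times bounded_Times slot_borel w(2) bb)
  show "{0<..R} \<times> slot R n i \<in> sets borel \<and> bounded ({0<..R} \<times> slot R n i) \<and>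
      \<tau>\<^sup>2 * measure lborel (({0<..R} \<times> slot R n i) \<inter> ({0<..} \<times> {0<..})) \<le> (\<tau> * R + (\<tau> * R)\<^sup>2) / n"
    unfolding Times_Int_Times b mm
    by (intro conjI le borel_Times bounded_Times slot_borel w(2) bb)
qed

text \<open>Two points with a common coordinate would lie in matching strips of every subdivision of
  a large enough window; countably many windows exhaust the quadrant.\<close>

lemma AE_configuration: "AE \<omega> in M. configuration (sources \<omega>) (sinks \<omega>) (alpha \<omega>)"
proof -
  let ?C = "\<lambda>N. \<tau> * Suc N + (\<tau> * Suc N)\<^sup>2"
  have C: "0 \<le> ?C N" for N using tau by simp
  have sub: "\<forall>\<omega>\<in>space M. sources \<omega> \<subseteq> {0<..}" "\<forall>\<omega>\<in>space M. sinks \<omega> \<subseteq> {0<..}" "\<forall>\<omega>\<in>space M. alpha \<omega> \<subseteq> {0<..} \<times> {0<..}"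
    using sources sinks alpha unfolding poisson_process_def by auto
  have fin: "AE \<omega> in M. \<forall>B. bounded B \<longrightarrow> finite (sources \<omega> \<inter> B)" "AE \<omega> in M. \<forall>B. bounded B \<longrightarrow> finite (sinks \<omega> \<inter> B)"
    "AE \<omega> in M. \<forall>B. bounded B \<longrightarrow> finite (alpha \<omega> \<inter> B)"
    using sources sinks alpha unfolding poisson_process_def by auto
  have t2: "0 \<le> \<tau>\<^sup>2" "0 \<le> \<tau>" using tau by auto
  have top: "space M \<in> process_events M N" for N :: "'w \<Rightarrow> 'x::euclidean_space set"
    unfolding process_events_def by (rule sigma_sets_top)
  have iS: "prob (A \<inter> A') = prob A * prob A'"
    if "A \<in> process_events M sources" "A' \<in> process_events M alpha" for A A'
    by (rule indep_three(2)[OF independent that(1) top that(2)])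
  have iK: "prob (A \<inter> A') = prob A * prob A'"
    if "A \<in> process_events M sinks" "A' \<in> process_events M alpha" for A A'
    by (rule indep_three(3)[OF independent _ that]) (rule top)
  have Suc_pos: "0 < real (Suc N)" for N by simp
  have "AE \<omega> in M. \<exists>n\<ge>1. \<forall>i\<in>{1..n}. card (alpha \<omega> \<inter> (slot (Suc N) n i \<times> window N)) \<le> 1" for N
    by (rule AE_no_pair[OF alpha t2(1) C strip_bound(2)[OF Suc_pos]])
  then have "AE \<omega> in M. \<forall>N. \<exists>n\<ge>1. \<forall>i\<in>{1..n}. card (alpha \<omega> \<inter> (slot (Suc N) n i \<times> window N)) \<le> 1"
    by (subst AE_all_countable) blast
  moreover have "AE \<omega> in M. \<exists>n\<ge>1. \<forall>i\<in>{1..n}. card (alpha \<omega> \<inter> (window N \<times> slot (Suc N) n i)) \<le> 1" for N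
    by (rule AE_no_pair[OF alpha t2(1) C strip_bound(3)[OF Suc_pos]])
  then have "AE \<omega> in M. \<forall>N. \<exists>n\<ge>1. \<forall>i\<in>{1..n}. card (alpha \<omega> \<inter> (window N \<times> slot (Suc N) n i)) \<le> 1"
    by (subst AE_all_countable) blast
  moreover have "AE \<omega> in M. \<exists>n\<ge>1. \<forall>i\<in>{1..n}. card (sources \<omega> \<inter> slot (Suc N) n i) = 0 \<or> card (alpha \<omega> \<inter> (slot (Suc N) n i \<times> window N)) = 0" for N
    by (rule AE_no_common[OF sources alpha iS t2(2,1) C strip_bound(1,2)[OF Suc_pos]])
  then have "AE \<omega> in M. \<forall>N. \<exists>n\<ge>1. \<forall>i\<in>{1..n}. card (sources \<omega> \<inter> slot (Suc N) n i) = 0 \<or> card (alpha \<omega> \<inter> (slot (Suc N) n i \<times> window N)) = 0"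
    by (subst AE_all_countable) blast
  moreover have "AE \<omega> in M. \<exists>n\<ge>1. \<forall>i\<in>{1..n}. card (sinks \<omega> \<inter> slot (Suc N) n i) = 0 \<or> card (alpha \<omega> \<inter> (window N \<times> slot (Suc N) n i)) = 0" for N
    by (rule AE_no_common[OF sinks alpha iK t2(2,1) C strip_bound(1,3)[OF Suc_pos]])
  then have "AE \<omega> in M. \<forall>N. \<exists>n\<ge>1. \<forall>i\<in>{1..n}. card (sinks \<omega> \<inter> slot (Suc N) n i) = 0 \<or> card (alpha \<omega> \<inter> (window N \<times> slot (Suc N) n i)) = 0"
    by (subst AE_all_countable) blast
  ultimately show ?thesis using AE_space fin
  proof eventually_elim
    case (elim \<omega>)
    define S K A where "S = sources \<omega>" and "K = sinks \<omega>" and "A = alpha \<omega>"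
    have pos: "S \<subseteq> {0<..}" "K \<subseteq> {0<..}" "A \<subseteq> {0<..} \<times> {0<..}" using sub elim(5) by (auto simp: S_def K_def A_def)
    have finA: "finite (A \<inter> B)" if "bounded B" for B using elim(8) that by (simp add: A_def)
    have finS: "finite (S \<inter> B)" and finK: "finite (K \<inter> B)" if "bounded B" for B
      using elim(6,7) that by (auto simp: S_def K_def)
    have bd: "bounded (slot (Suc N) n i \<times> window N)" "bounded (window N \<times> slot (Suc N) n i)" for N n i
      by (auto intro!: bounded_Times slot_borel)
    have big: "\<exists>N. a \<in> window N \<and> b \<in> window N \<and> d \<in> window N" if "0 < a" "0 < b" "0 < d" for a b d :: real
    proof -
      obtain N where "max a (max b d) < real N" using reals_Archimedean2 by blast
      then show ?thesis using that by (intro exI[of _ N]) auto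
    qed
    have same: "p = q" if "finite (A \<inter> B)" "card (A \<inter> B) \<le> 1" "p \<in> A \<inter> B" "q \<in> A \<inter> B" for p q B
      using that by (auto simp: card_le_Suc0_iff_eq)
    show ?case unfolding S_def[symmetric] K_def[symmetric] A_def[symmetric]
    proof
      show "S \<subseteq> {0<..}" "K \<subseteq> {0<..}" "A \<subseteq> {0<..} \<times> {0<..}" by fact+
      show "finite (S \<inter> {..R})" for R
      proof (rule finite_subset)
        show "S \<inter> {..R} \<subseteq> S \<inter> {0<..R}" using pos(1) by auto
        show "finite (S \<inter> {0<..R})" by (intro finS) auto
      qed
      show "finite (K \<inter> {..R})" for R
      proof (rule finite_subset)
        show "K \<inter> {..R} \<subseteq> K \<inter> {0<..R}" using pos(2) by auto
        show "finite (K \<inter> {0<..R})" by (intro finK) auto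
      qed
      show "finite (A \<inter> {..R} \<times> {..T})" for R T
      proof (rule finite_subset)
        show "A \<inter> {..R} \<times> {..T} \<subseteq> A \<inter> ({0<..R} \<times> {0<..T})" using pos(3) by auto
        show "finite (A \<inter> ({0<..R} \<times> {0<..T}))" by (intro finA bounded_Times) auto
      qed
      show "inj_on fst A"
      proof (rule inj_onI)
        fix p q assume pq: "p \<in> A" "q \<in> A" "fst p = fst q"
        then obtain a b d where e: "p = (a, b)" "q = (a, d)" by (cases p, cases q) auto
        have "0 < a" "0 < b" "0 < d" using pq e pos by auto
        then obtain N where N: "a \<in> window N" "b \<in> window N" "d \<in> window N" using big by blast
        obtain n where n: "n \<ge> 1" "\<forall>i\<in>{1..n}. card (A \<inter> (slot (Suc N) n i \<times> window N)) \<le> 1"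
          using elim(1) by (auto simp: A_def)
        obtain i where "i \<in> {1..n}" "a \<in> slot (Suc N) n i" using slot_exists[of a "Suc N" n] N n by auto
        then show "p = q" using same[OF finA[OF bd(1)], of N n i p q] n pq e N by auto
      qed
      show "inj_on snd A"
      proof (rule inj_onI)
        fix p q assume pq: "p \<in> A" "q \<in> A" "snd p = snd q"
        then obtain a b d where e: "p = (b, a)" "q = (d, a)" by (cases p, cases q) auto
        have "0 < a" "0 < b" "0 < d" using pq e pos by auto
        then obtain N where N: "a \<in> window N" "b \<in> window N" "d \<in> window N" using big by blast
        obtain n where n: "n \<ge> 1" "\<forall>i\<in>{1..n}. card (A \<inter> (window N \<times> slot (Suc N) n i)) \<le> 1"
          using elim(2) by (auto simp: A_def)
        obtain i where "i \<in> {1..n}" "a \<in> slot (Suc N) n i" using slot_exists[of a "Suc N" n] N n by auto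
        then show "p = q" using same[OF finA[OF bd(2)], of N n i p q] n pq e N by auto
      qed
      show "S \<inter> fst ` A = {}"
      proof (rule ccontr)
        assume "S \<inter> fst ` A \<noteq> {}"
        then obtain a b where ab: "a \<in> S" "(a, b) \<in> A" by auto
        have "0 < a" "0 < b" using ab pos by auto
        then obtain N where N: "a \<in> window N" "b \<in> window N" using big by blast
        obtain n where n: "n \<ge> 1" "\<forall>i\<in>{1..n}. card (S \<inter> slot (Suc N) n i) = 0 \<or> card (A \<inter> (slot (Suc N) n i \<times> window N)) = 0"
          using elim(3) by (auto simp: A_def S_def)
        obtain i where i: "i \<in> {1..n}" "a \<in> slot (Suc N) n i" using slot_exists[of a "Suc N" n] N n by auto
        have "a \<in> S \<inter> slot (Suc N) n i" "(a, b) \<in> A \<inter> (slot (Suc N) n i \<times> window N)" using ab i N by auto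
        then have "card (S \<inter> slot (Suc N) n i) \<noteq> 0" "card (A \<inter> (slot (Suc N) n i \<times> window N)) \<noteq> 0"
          using finS[OF slot_borel(2)] finA[OF bd(1)] by (auto simp only: card_eq_0_iff)
        then show False using bspec[OF n(2) i(1)] by argo
      qed
      show "K \<inter> snd ` A = {}"
      proof (rule ccontr)
        assume "K \<inter> snd ` A \<noteq> {}"
        then obtain a b where ab: "a \<in> K" "(b, a) \<in> A" by auto
        have "0 < a" "0 < b" using ab pos by auto
        then obtain N where N: "a \<in> window N" "b \<in> window N" using big by blast
        obtain n where n: "n \<ge> 1" "\<forall>i\<in>{1..n}. card (K \<inter> slot (Suc N) n i) = 0 \<or> card (A \<inter> (window N \<times> slot (Suc N) n i)) = 0"
          using elim(4) by (auto simp: A_def K_def)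
        obtain i where i: "i \<in> {1..n}" "a \<in> slot (Suc N) n i" using slot_exists[of a "Suc N" n] N n by auto
        have "a \<in> K \<inter> slot (Suc N) n i" "(b, a) \<in> A \<inter> (window N \<times> slot (Suc N) n i)" using ab i N by auto
        then have "card (K \<inter> slot (Suc N) n i) \<noteq> 0" "card (A \<inter> (window N \<times> slot (Suc N) n i)) \<noteq> 0"
          using finK[OF slot_borel(2)] finA[OF bd(2)] by (auto simp only: card_eq_0_iff)
        then show False using bspec[OF n(2) i(1)] by argo
      qed
    qed
  qed
qed

lemma AE_conf: "AE \<omega> in M. \<forall>x t n. cfg x t n \<omega> = conf x t n (sources \<omega>) (sinks \<omega>) (alpha \<omega>)"
proof -
  have "AE \<omega> in M. \<forall>B. bounded B \<longrightarrow> finite (sources \<omega> \<inter> B)" "AE \<omega> in M. \<forall>B. bounded B \<longrightarrow> finite (sinks \<omega> \<inter> B)"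
    "AE \<omega> in M. \<forall>B. bounded B \<longrightarrow> finite (alpha \<omega> \<inter> B)"
    using sources sinks alpha unfolding poisson_process_def by auto
  then show ?thesis
  proof eventually_elim
    case (elim \<omega>)
    have "(card (sources \<omega> \<inter> slot x n i) \<noteq> 0) = (sources \<omega> \<inter> slot x n i \<noteq> {})"
      "(card (sinks \<omega> \<inter> slot x n i) \<noteq> 0) = (sinks \<omega> \<inter> slot x n i \<noteq> {})" for x n i
      using elim slot_borel by auto
    moreover have "(card (alpha \<omega> \<inter> slot x n i \<times> slot t n j) \<noteq> 0) = (alpha \<omega> \<inter> slot x n i \<times> slot t n j \<noteq> {})" for x t n i j
      using elim(3) bounded_Times[OF slot_borel(2) slot_borel(2), of x n i t n j] by auto
    ultimately show ?case unfolding cfg_def conf_def by simp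
  qed
qed

end

section \<open>Riemann sums\<close>

text \<open>In units of \<open>x / n\<close>, the sum counts the integers in \<open>[y, n]\<close>,
  which differs from the length of that interval by at most one.\<close>

lemma riemann_line:
  fixes x a :: real
  assumes x: "0 < x" and a: "0 \<le> a"
  shows "(\<lambda>n. x / real n * (\<Sum>k=1..n. (of_bool (a \<le> x * real k / real n) :: real))) \<longlonglongrightarrow> max (x - a) 0"
proof (rule LIM_zero_cancel, rule Lim_null_comparison[where g="\<lambda>n. x * inverse (real n)"])
  have "(\<lambda>n. x * inverse (real n)) \<longlonglongrightarrow> x * 0" by (intro tendsto_intros lim_inverse_n)
  then show "(\<lambda>n. x * inverse (real n)) \<longlonglongrightarrow> 0" by simp
  show "eventually (\<lambda>n. norm (x / n * (\<Sum>k=1..n. (of_bool (a \<le> x * real k / real n) :: real)) - max (x - a) 0) \<le> x * inverse (real n)) sequentially"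
    using eventually_gt_at_top[of "0::nat"]
  proof eventually_elim
    case (elim n)
    define y where "y = a * n / x"
    have iff: "a \<le> x * k / n \<longleftrightarrow> y \<le> k" for k :: nat
      using x elim by (simp add: y_def field_simps)
    have y0: "0 \<le> y" using a x by (simp add: y_def)
    have yx: "x / n * y = a" using x elim by (simp add: y_def)
    have s: "(\<Sum>k=1..n. (of_bool (a \<le> x * real k / real n) :: real)) = real (card {k\<in>{1..n}. y \<le> k})"
      unfolding iff by (simp add: Int_def)
    show ?case
    proof (cases "a \<le> x")
      case True
      then have yn: "y \<le> n" using x by (simp add: y_def divide_le_eq mult_right_mono mult.commute)
      \<comment> \<open>The first index counted; the maximum with \<open>1\<close> is needed for
        \<open>y = 0\<close>, because the sum starts at \<open>1\<close>.\<close>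
      define q where "q = max 1 (nat \<lceil>y\<rceil>)"
      have q: "y \<le> q" "q \<le> y + 1" "q \<le> n"
        using y0 yn elim unfolding q_def by (auto simp: max_def) linarith+
      have "{k\<in>{1..n}. y \<le> k} = {q..n}"
        using y0 unfolding q_def by (auto simp: nat_le_iff ceiling_le_iff)
      then have "real (card {k\<in>{1..n}. y \<le> k}) = n + 1 - real q" using q(3) by (simp add: of_nat_diff)
      then have "x / n * (\<Sum>k=1..n. (of_bool (a \<le> x * real k / real n) :: real)) - max (x - a) 0 = x / n * (n + 1 - real q) - (x / n * n - x / n * y)"
        unfolding s yx using True elim by simp
      also have "\<dots> = x / n * (1 + y - q)" by (simp add: right_diff_distrib distrib_left)
      also have "norm \<dots> \<le> x / n * 1"
        using q x unfolding real_norm_def abs_mult by (intro mult_mono) auto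
      finally show ?thesis by (simp add: divide_inverse)
    next
      case False
      then have "real n < y" using x elim by (simp add: y_def less_divide_eq mult.commute)
      then have e: "{k\<in>{1..n}. y \<le> k} = {}" by auto
      show ?thesis unfolding s e using False x by simp
    qed
  qed
qed

text \<open>Cuts off the artificial part of the first slot below \<open>0\<close>, so that all cells
  have width \<open>x / n\<close>.\<close>

definition cell :: "real \<Rightarrow> nat \<Rightarrow> nat \<Rightarrow> real set" where
  "cell x n k = slot x n k \<inter> {0<..}"

lemma cell_borel: "cell x n k \<in> sets borel"
  unfolding cell_def by (intro sets.Int slot_borel) simp

lemma cell_cases:
  assumes x: "0 < x" and n: "0 < n" and y: "0 < y" "y \<le> x"
  obtains k where "k \<in> {1..n}" "y \<le> x * k / n" "x * k / n \<le> y + x / n" "x * k / n \<le> x"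
    "\<And>k'. k' \<in> {1..n} \<Longrightarrow> y \<in> cell x n k' \<longleftrightarrow> k' = k"
proof -
  obtain k where k: "k \<in> {1..n}" "y \<in> slot x n k" using slot_exists[OF y n] by blast
  have u: "y \<in> cell x n k' \<longleftrightarrow> k' = k" for k'
  proof
    assume "y \<in> cell x n k'"
    then have "y \<in> slot x n k'" by (simp add: cell_def)
    then show "k' = k" using slot_order[OF x _ k(2) order_refl] slot_order[OF x k(2) _ order_refl] by (simp add: le_antisym)
  next
    assume "k' = k"
    then show "y \<in> cell x n k'" using k(2) y by (simp add: cell_def)
  qed
  have "1 \<le> k" using k(1) by simp
  have "y \<in> slot x n k \<inter> {0<..}" using k(2) y by simp
  then have m: "y \<in> {x * real (k - 1) / real n<..x * real k / real n}" unfolding slot_pos[OF x \<open>1 \<le> k\<close>] .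
  have e: "x * real (k - 1) / real n = x * real k / real n - x / real n"
    using \<open>1 \<le> k\<close> by (simp add: of_nat_diff right_diff_distrib diff_divide_distrib)
  have le: "x * real k / real n \<le> x" using k(1) x n by (simp add: divide_le_eq)
  have b: "y \<le> x * real k / real n" "x * real k / real n \<le> y + x / real n"
    using m unfolding e by (simp_all add: algebra_simps)
  show thesis by (rule that[OF k(1) b le u])
qed

lemma cell_outside:
  assumes "0 < x" "0 < n" "k \<in> {1..n}" "y \<in> cell x n k"
  shows "0 < y" "y \<le> x"
  using assms slot_le[of x y n k] by (auto simp: cell_def)

text \<open>\<open>D\<close> is sampled at the upper right corner of each cell, so at a point
  \<open>p\<close> only its values just above and to the right of \<open>p\<close> matter. If these
  equal the indicator of \<open>Z\<close> at almost every point, the step functions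
  \<open>f n\<close> converge and dominated convergence applies.\<close>

lemma riemann_plane:
  fixes D :: "real \<Rightarrow> real \<Rightarrow> real" and Z :: "(real \<times> real) set"
  assumes x: "0 < x" and t: "0 < t" and Z: "Z \<in> sets borel"
    and D: "\<And>y s. \<bar>D y s\<bar> \<le> 1"
    and near: "AE p in lborel. fst p \<in> {0<..x} \<longrightarrow> snd p \<in> {0<..t} \<longrightarrow>
       (\<exists>\<delta>>0. \<forall>y' s'. fst p \<le> y' \<longrightarrow> y' < fst p + \<delta> \<longrightarrow> y' \<le> x \<longrightarrow> snd p \<le> s' \<longrightarrow> s' < snd p + \<delta> \<longrightarrow> s' \<le> t \<longrightarrow>
          D y' s' = indicator Z p)"
    and out: "AE p in lborel. p \<in> Z \<longrightarrow> fst p \<in> {0<..x} \<and> snd p \<in> {0<..t}"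
  shows "(\<lambda>n. x / real n * (t / real n) * (\<Sum>k=1..n. \<Sum>l=1..n. D (x * real k / real n) (t * real l / real n))) \<longlonglongrightarrow> measure lborel Z"
proof -
  define f where "f = (\<lambda>n p. \<Sum>k=1..n. \<Sum>l=1..n. D (x * real k / real n) (t * real l / real n) * indicator (cell x n k \<times> cell t n l) p)"
  define B where "B = {0<..x} \<times> {0<..t}"
  have cc: "cell x n k \<times> cell t n l \<in> sets borel" for n k l by (intro borel_Times cell_borel)
  have mc: "measure lborel (cell x n k \<times> cell t n l) = x / n * (t / n)"
    "emeasure lborel (cell x n k \<times> cell t n l) < \<infinity>" if "k \<in> {1..n}" "l \<in> {1..n}" for n k l
  proof -
    show "measure lborel (cell x n k \<times> cell t n l) = x / n * (t / n)"
      using that x t by (subst measure_rectangle[OF cell_borel cell_borel]) (simp add: cell_def slot_measure)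
    have "bounded (cell x n k \<times> cell t n l)"
      by (intro bounded_Times) (auto simp: cell_def intro: bounded_subset[OF slot_borel(2)])
    then show "emeasure lborel (cell x n k \<times> cell t n l) < \<infinity>" by (rule emeasure_bounded_finite)
  qed
  have B_borel: "B \<in> sets borel" and B_fin: "emeasure lborel B < \<infinity>"
  proof -
    show "B \<in> sets borel" unfolding B_def by (intro borel_Times) auto
    have "bounded B" unfolding B_def by (intro bounded_Times) auto
    then show "emeasure lborel B < \<infinity>" by (rule emeasure_bounded_finite)
  qed
  have fm: "f n \<in> borel_measurable lborel" for n
    unfolding f_def using cc by (intro borel_measurable_sum borel_measurable_times borel_measurable_const borel_measurable_indicator) simp
  have f_in: "\<exists>y' s'. y' \<in> {y..y + x / n} \<and> y' \<le> x \<and> s' \<in> {s..s + t / n} \<and> s' \<le> t \<and> f n (y, s) = D y' s'"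
    if n: "0 < n" and ys: "0 < y" "y \<le> x" "0 < s" "s \<le> t" for n y s
  proof -
    obtain k where k: "k \<in> {1..n}" "y \<le> x * k / n" "x * k / n \<le> y + x / n" "x * k / n \<le> x"
      "\<And>k'. k' \<in> {1..n} \<Longrightarrow> y \<in> cell x n k' \<longleftrightarrow> k' = k" using cell_cases[OF x n ys(1,2)] by blast
    obtain l where l: "l \<in> {1..n}" "s \<le> t * l / n" "t * l / n \<le> s + t / n" "t * l / n \<le> t"
      "\<And>l'. l' \<in> {1..n} \<Longrightarrow> s \<in> cell t n l' \<longleftrightarrow> l' = l" using cell_cases[OF t n ys(3,4)] by blast
    have "f n (y, s) = (\<Sum>k'=1..n. \<Sum>l'=1..n. if l' = l then (if k' = k then D (x * real k' / real n) (t * real l' / real n) else 0) else 0)"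
      unfolding f_def by (intro sum.cong refl) (simp add: indicator_def k(5) l(5))
    also have "\<dots> = D (x * real k / real n) (t * real l / real n)" using k(1) l(1) by (simp add: sum.delta)
    finally show ?thesis using k l by (intro exI[of _ "x * k / n"] exI[of _ "t * l / n"]) auto
  qed
  have f_out: "f n (y, s) = 0" if "\<not> (0 < y \<and> y \<le> x \<and> 0 < s \<and> s \<le> t)" for n y s
  proof -
    have "indicator (cell x n k \<times> cell t n l) (y, s) = (0::real)" if "k \<in> {1..n}" "l \<in> {1..n}" for k l
    proof -
      have "0 < n" using that by auto
      then show ?thesis
        using that cell_outside[OF x, of n k y] cell_outside[OF t, of n l s] \<open>\<not> _\<close> by (auto simp: indicator_def)
    qed
    then show ?thesis unfolding f_def by (intro sum.neutral ballI) simp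
  qed
  have "(\<lambda>n. \<integral>p. f (Suc n) p \<partial>lborel) \<longlonglongrightarrow> (\<integral>p. indicator Z p \<partial>lborel)"
  proof (rule integral_dominated_convergence[where w="indicator B :: _ \<Rightarrow> real"])
    show "AE p in lborel. (\<lambda>n. f (Suc n) p) \<longlonglongrightarrow> indicator Z p"
      using near out
    proof eventually_elim
      case (elim p)
      obtain y s where p: "p = (y, s)" by fastforce
      show ?case
      proof (cases "0 < y \<and> y \<le> x \<and> 0 < s \<and> s \<le> t")
        case False
        then have "p \<notin> Z" using elim(2) p by auto
        then show ?thesis using f_out[OF False] by (simp add: p)
      next
        case True
        then obtain d where d: "d > 0" "\<And>y' s'. y \<le> y' \<Longrightarrow> y' < y + d \<Longrightarrow> y' \<le> x \<Longrightarrow> s \<le> s' \<Longrightarrow> s' < s + d \<Longrightarrow> s' \<le> t \<Longrightarrow>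
          D y' s' = indicator Z p" using elim(1) p by auto
        have "eventually (\<lambda>n. max x t / d < real n) sequentially"
          using filterlim_real_sequentially by (simp add: filterlim_at_top_dense)
        then have "eventually (\<lambda>n. f (Suc n) p = indicator Z p) sequentially"
        proof eventually_elim
          case (elim n)
          have "max x t < real (Suc n) * d" using elim d(1) by (simp add: divide_less_eq algebra_simps)
          then have "x / Suc n < d" "t / Suc n < d" by (simp_all add: divide_less_eq mult.commute)
          moreover obtain y' s' where "y' \<in> {y..y + x / Suc n}" "y' \<le> x" "s' \<in> {s..s + t / Suc n}" "s' \<le> t" "f (Suc n) (y, s) = D y' s'"
            using f_in[of "Suc n" y s] True by auto
          ultimately show ?case using d(2)[of y' s'] by (simp add: p)
        qed
        then show ?thesis by (rule tendsto_eventually)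
      qed
    qed
    show "AE p in lborel. norm (f (Suc n) p) \<le> indicator B p" for n
    proof (rule AE_I2)
      fix p :: "real \<times> real"
      obtain y s where p: "p = (y, s)" by fastforce
      show "norm (f (Suc n) p) \<le> indicator B p"
      proof (cases "0 < y \<and> y \<le> x \<and> 0 < s \<and> s \<le> t")
        case False
        then show ?thesis using f_out[OF False] by (simp add: p)
      next
        case True
        then obtain y' s' where "f (Suc n) (y, s) = D y' s'" using f_in[of "Suc n" y s] by auto
        then show ?thesis using D[of y' s'] True by (simp add: p B_def)
      qed
    qed
  qed (use fm Z B_borel B_fin in \<open>auto intro!: integrable_real_indicator\<close>)
  moreover have "(\<integral>p. f n p \<partial>lborel) = x / n * (t / n) * (\<Sum>k=1..n. \<Sum>l=1..n. D (x * real k / real n) (t * real l / real n))" for n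
  proof -
    have int: "integrable lborel (\<lambda>p. D (x * real k / real n) (t * real l / real n) * indicator (cell x n k \<times> cell t n l) p)"
      "(\<integral>p. D (x * real k / real n) (t * real l / real n) * indicator (cell x n k \<times> cell t n l) p \<partial>lborel) = D (x * real k / real n) (t * real l / real n) * (x / n * (t / n))"
      if "k \<in> {1..n}" "l \<in> {1..n}" for k l
      using mc[OF that] cc by (auto intro!: integrable_real_indicator)
    have "(\<integral>p. f n p \<partial>lborel) = (\<Sum>k=1..n. \<integral>p. (\<Sum>l=1..n. D (x * real k / real n) (t * real l / real n) * indicator (cell x n k \<times> cell t n l) p) \<partial>lborel)"
      unfolding f_def by (intro Bochner_Integration.integral_sum Bochner_Integration.integrable_sum int(1))
    also have "\<dots> = (\<Sum>k=1..n. \<Sum>l=1..n. D (x * real k / real n) (t * real l / real n) * (x / n * (t / n)))"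
    proof (intro sum.cong refl)
      fix k assume k: "k \<in> {1..n}"
      have "(\<integral>p. (\<Sum>l=1..n. D (x * real k / real n) (t * real l / real n) * indicator (cell x n k \<times> cell t n l) p) \<partial>lborel)
        = (\<Sum>l=1..n. \<integral>p. D (x * real k / real n) (t * real l / real n) * indicator (cell x n k \<times> cell t n l) p \<partial>lborel)"
        by (intro Bochner_Integration.integral_sum int(1)[OF k])
      also have "\<dots> = (\<Sum>l=1..n. D (x * real k / real n) (t * real l / real n) * (x / n * (t / n)))"
        by (intro sum.cong refl int(2)[OF k])
      finally show "(\<integral>p. (\<Sum>l=1..n. D (x * real k / real n) (t * real l / real n) * indicator (cell x n k \<times> cell t n l) p) \<partial>lborel)
        = (\<Sum>l=1..n. D (x * real k / real n) (t * real l / real n) * (x / n * (t / n)))" .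
    qed
    also have "\<dots> = (\<Sum>k=1..n. \<Sum>l=1..n. D (x * real k / real n) (t * real l / real n)) * (x / n * (t / n))"
      by (simp only: sum_distrib_right)
    finally show ?thesis by (simp only: mult.commute)
  qed
  moreover have "(\<integral>p. indicator Z p \<partial>lborel) = measure lborel Z" using Z by simp
  ultimately have "(\<lambda>n. x / Suc n * (t / Suc n) * (\<Sum>k=1..Suc n. \<Sum>l=1..Suc n. D (x * real k / real (Suc n)) (t * real l / real (Suc n)))) \<longlonglongrightarrow> measure lborel Z"
    by (simp only:)
  then show ?thesis by (rule LIMSEQ_imp_Suc)
qed

text \<open>Written as a maximum over the three predecessors, \<open>lpp\<close> passes on a gain
  between \<open>0\<close> and \<open>1\<close>; the gain arises only at the cell
  \<open>(1, 1)\<close>, whose predecessors are unaffected. The bound is the domination needed for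
  the area.\<close>

lemma flip_corner_bound: "\<bar>flip (1, 1) (lpp i j) c\<bar> \<le> 1"
proof -
  define a where "a = insert (1, 1) c"
  define b where "b = c - {(1, 1)}"
  have rec: "lpp (Suc i) (Suc j) c = max (max (lpp (Suc i) j c) (lpp i (Suc j) c)) (lpp i j c + of_bool ((Suc i, Suc j) \<in> c))" for i j c
  proof -
    have 1: "lpp (Suc i) j c = lpp i j c + of_bool (hinc c (Suc i) j)" by (simp add: lpp_def cnt_Suc)
    have 2: "lpp i (Suc j) c = lpp i j c + of_bool (vinc c i (Suc j))" by (simp add: lpp_conservation flux_Suc)
    have "lpp (Suc i) (Suc j) c = lpp (Suc i) j c + of_bool (vinc c (Suc i) (Suc j))"
      unfolding lpp_conservation by (simp only: flux_Suc add.assoc)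
    then show ?thesis unfolding 1 2 by (auto simp: max_def)
  qed
  have "lpp i j b \<le> lpp i j a \<and> lpp i j a \<le> lpp i j b + 1"
  proof (induction i arbitrary: j)
    case 0
    then show ?case by (simp add: lpp_def flux_def hinc_vinc_axis a_def b_def)
  next
    case (Suc i)
    note left = Suc
    show ?case
    proof (induction j)
      case 0
      then show ?case by (simp add: lpp_def cnt_def hinc_vinc_axis a_def b_def)
    next
      case (Suc j)
      show ?case
      proof (cases "i = 0 \<and> j = 0")
        case True
        have z: "lpp (Suc 0) 0 a = lpp (Suc 0) 0 b" "lpp 0 (Suc 0) a = lpp 0 (Suc 0) b" "lpp 0 0 a = lpp 0 0 b"
          by (simp_all add: lpp_def cnt_def flux_def hinc_vinc_axis a_def b_def)
        show ?thesis using True z unfolding rec by (auto simp: a_def b_def)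
      next
        case False
        then have w: "(Suc i, Suc j) \<in> a \<longleftrightarrow> (Suc i, Suc j) \<in> b" by (auto simp: a_def b_def)
        show ?thesis using Suc left[of "Suc j"] left[of j] unfolding rec w by linarith
      qed
    qed
  qed
  then show ?thesis by (simp add: flip_def a_def b_def)
qed

section \<open>Convergence of the lattice quantities\<close>

lemma gap_right:
  fixes y :: real
  assumes "finite F"
  shows "\<exists>\<delta>>0. \<forall>q\<in>F. q \<le> y \<or> y + \<delta> \<le> q"
  using assms
proof (induction F rule: finite_induct)
  case empty
  show ?case by (intro exI[of _ 1]) simp
next
  case (insert q F)
  then obtain d where d: "d > 0" "\<forall>q\<in>F. q \<le> y \<or> y + d \<le> q" by blast
  define e where "e = (if q \<le> y then d else min d (q - y))"
  have "e > 0" "e \<le> d" "q \<le> y \<or> y + e \<le> q" using d(1) by (auto simp: e_def)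
  moreover have "\<forall>q\<in>F. q \<le> y \<or> y + e \<le> q" using d(2) \<open>e \<le> d\<close> by force
  ultimately show ?case by blast
qed

lemma AE_off_lines:
  fixes F G :: "real set"
  assumes "finite F" "finite G"
  shows "AE p in lborel. fst p \<notin> F \<and> snd p \<notin> G"
proof -
  have b: "F \<in> sets borel" "G \<in> sets borel" using assms by (auto intro: borel_closed finite_imp_closed)
  have "emeasure lborel (F \<times> (UNIV :: real set)) = emeasure lborel F * emeasure lborel (UNIV :: real set)"
    unfolding lborel_prod[symmetric] using b
    by (intro sigma_finite_measure.emeasure_pair_measure_Times lborel.sigma_finite_measure_axioms) auto
  moreover have "emeasure lborel ((UNIV :: real set) \<times> G) = emeasure lborel (UNIV :: real set) * emeasure lborel G"
    unfolding lborel_prod[symmetric] using b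
    by (intro sigma_finite_measure.emeasure_pair_measure_Times lborel.sigma_finite_measure_axioms) auto
  moreover have "emeasure lborel F = 0" "emeasure lborel G = 0"
    using assms by (auto intro: emeasure_lborel_countable countable_finite)
  ultimately have e: "emeasure lborel (F \<times> (UNIV :: real set)) = 0" "emeasure lborel ((UNIV :: real set) \<times> G) = 0" by auto
  have m: "F \<times> (UNIV :: real set) \<in> sets lborel" "(UNIV :: real set) \<times> G \<in> sets lborel"
    unfolding sets_lborel using b by (auto intro!: borel_Times)
  have n: "F \<times> (UNIV :: real set) \<in> null_sets lborel" "(UNIV :: real set) \<times> G \<in> null_sets lborel"
    using e m by (auto simp: null_sets_def)
  show ?thesis using AE_not_in[OF n(1)] AE_not_in[OF n(2)] by eventually_elim auto
qed

context configuration
begin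

lemma eventually_resolved:
  assumes "0 < x" "0 < t"
  shows "eventually (\<lambda>n. 0 < n \<and> resolves x n (S \<inter> {..x} \<union> fst ` (A \<inter> {..x} \<times> {..t})) \<and>
    resolves t n (K \<inter> {..t} \<union> snd ` (A \<inter> {..x} \<times> {..t}))) sequentially"
proof (intro eventually_conj)
  show "eventually (\<lambda>n. resolves x n (S \<inter> {..x} \<union> fst ` (A \<inter> {..x} \<times> {..t}))) sequentially"
    by (rule eventually_resolves) (use assms S_pos A_pos S_finite A_finite in auto)
  show "eventually (\<lambda>n. resolves t n (K \<inter> {..t} \<union> snd ` (A \<inter> {..x} \<times> {..t}))) sequentially"
    by (rule eventually_resolves) (use assms K_pos A_pos K_finite A_finite in auto)
qed (rule eventually_gt_at_top)

lemma alive_mono: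
  assumes "0 < R" "R \<le> R'" "0 \<le> t" "H R S1 t \<noteq> H R S t"
  shows "H R' S1 t \<noteq> H R' S t"
proof
  assume "H R' S1 t = H R' S t"
  then have "H R' S1 t \<inter> {..R} = H R' S t \<inter> {..R}" by simp
  then show False using H_cut[OF sub_S0(1), of R R' R t] H_cut[OF sub_S0(2), of R R' R t] assms
      H_coords[OF sub_S0(1), of R t] H_coords[OF sub_S0(2), of R t] by (simp add: Int_absorb2 subset_iff)
qed

context
  fixes x t R :: real
  assumes x: "0 < x" and t: "0 < t" and R: "0 < R" "x \<le> R" and alive: "H R S1 t \<noteq> H R S t"
begin

text \<open>The effect felt at the corner \<open>(k, n)\<close> is the indicator that the second
  class particle is at most \<open>x * k / n\<close> at time \<open>t\<close>, so the sum is a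
  Riemann sum for the remaining length.\<close>

lemma X_limit:
  "(\<lambda>n. x / real n * (\<Sum>k=1..n. flip (1, 0) (lpp k n) (conf x t n S K A))) \<longlonglongrightarrow> max (x - sc t) 0"
proof (rule Lim_transform_eventually)
  have "0 \<le> sc t" using sc_coords(2)[OF R(1) _ alive] t by simp
  then show "(\<lambda>n. x / real n * (\<Sum>k=1..n. (of_bool (sc t \<le> x * real k / real n) :: real))) \<longlonglongrightarrow> max (x - sc t) 0"
    by (rule riemann_line[OF x])
  show "eventually (\<lambda>n. x / real n * (\<Sum>k=1..n. (of_bool (sc t \<le> x * real k / real n) :: real)) =
     x / real n * (\<Sum>k=1..n. flip (1, 0) (lpp k n) (conf x t n S K A))) sequentially"
    using eventually_resolved[OF x t]
  proof eventually_elim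
    case (elim n)
    then have n: "0 < n" and rx: "resolves x n (S \<inter> {..x} \<union> fst ` (A \<inter> {..x} \<times> {..t}))"
      and rt: "resolves t n (K \<inter> {..t} \<union> snd ` (A \<inter> {..x} \<times> {..t}))" by auto
    have "of_bool (sc t \<le> x * real k / real n) = flip (1, 0) (lpp k n) (conf x t n S K A)" if k: "k \<in> {1..n}" for k
    proof -
      have y: "x * real k / real n \<le> x" using k x n by (simp add: divide_le_eq)
      have "H x S0 t \<inter> {..x * real k / real n} = H R S0 t \<inter> {..x * real k / real n}"
        "H x S t \<inter> {..x * real k / real n} = H R S t \<inter> {..x * real k / real n}"
        using H_cut[OF sub_S0(4) _ R(2) y, of t] H_cut[OF sub_S0(1) _ R(2) y, of t] x t by auto
      then show ?thesis
        using flip_source_conf[OF x t n rx rt, of k] count_X[OF R(1) _ alive, of "x * real k / real n"] k t by simp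
    qed
    then show ?case by simp
  qed
qed

text \<open>\<open>dsc s\<close> may lie beyond \<open>x\<close>, so the pair is described in the
  large window \<open>R\<close>; the counts up to \<open>y \<le> x\<close> do not depend on the
  window.\<close>

lemma count_pair_cut:
  assumes "0 < s" "s \<le> t" "y \<le> x"
  shows "real (card (H x S2 s \<inter> {..y})) - real (card (H x S s \<inter> {..y})) = of_bool (\<not> met s \<and> sc s \<le> y \<and> y < dsc s)"
proof -
  have al: "H R S1 s \<noteq> H R S s" using alive_before[of s t R] alive assms by auto
  have "H x S2 s \<inter> {..y} = H R S2 s \<inter> {..y}" "H x S s \<inter> {..y} = H R S s \<inter> {..y}"
    using H_cut[OF sub_S0(3) _ R(2) assms(3), of s] H_cut[OF sub_S0(1) _ R(2) assms(3), of s] x assms by auto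
  then show ?thesis using count_pair[OF R(1) _ al, of y] assms by simp
qed

lemma area_limit:
  "(\<lambda>n. x / real n * (t / real n) * (\<Sum>k=1..n. \<Sum>l=1..n. flip (1, 1) (lpp k l) (conf x t n S K A)))
    \<longlonglongrightarrow> measure lborel (enclosed_region sc dsc \<inter> ({0..x} \<times> {0..t}))"
proof (rule Lim_transform_eventually)
  define D where "D = (\<lambda>y s. of_bool (\<not> met s \<and> sc s \<le> y \<and> y < dsc s) :: real)"
  define Z where "Z = enclosed_region sc dsc \<inter> ({0..x} \<times> {0..t})"
  show "eventually (\<lambda>n. x / real n * (t / real n) * (\<Sum>k=1..n. \<Sum>l=1..n. D (x * real k / real n) (t * real l / real n)) =
      x / real n * (t / real n) * (\<Sum>k=1..n. \<Sum>l=1..n. flip (1, 1) (lpp k l) (conf x t n S K A))) sequentially"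
    using eventually_resolved[OF x t]
  proof eventually_elim
    case (elim n)
    then have n: "0 < n" and rx: "resolves x n (S \<inter> {..x} \<union> fst ` (A \<inter> {..x} \<times> {..t}))"
      and rt: "resolves t n (K \<inter> {..t} \<union> snd ` (A \<inter> {..x} \<times> {..t}))" by auto
    have "D (x * real k / real n) (t * real l / real n) = flip (1, 1) (lpp k l) (conf x t n S K A)"
      if k: "k \<in> {1..n}" and l: "l \<in> {1..n}" for k l
    proof -
      have "x * real k / real n \<le> x" "t * real l / real n \<le> t" "0 < t * real l / real n"
        using k l x t n by (simp_all add: divide_le_eq)
      then show ?thesis
        using flip_alpha_conf[OF x t n rx rt, of k l] count_pair_cut[of "t * real l / real n" "x * real k / real n"] k l
        by (simp add: D_def)
    qed
    then show ?case by simp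
  qed
  define F where "F = coords t \<inter> {..x}"
  \<comment> \<open>An infinite meeting time gives \<open>m = 0\<close>, which only excludes one
    more null line.\<close>
  define m where "m = real_of_ereal (meeting_time sc dsc)"
  have F: "finite F"
  proof (rule finite_subset)
    show "F \<subseteq> insert 0 (S \<inter> {..x} \<union> fst ` (A \<inter> {..x} \<times> {..t}))" by (force simp: F_def coords_def)
  qed (use S_finite A_finite in auto)
  have F0: "0 \<in> F" using x by (simp add: F_def coords_def)
  have off: "AE p in lborel. fst p \<notin> F \<and> snd p \<notin> {m}" using F by (intro AE_off_lines) auto
  show "(\<lambda>n. x / real n * (t / real n) * (\<Sum>k=1..n. \<Sum>l=1..n. D (x * real k / real n) (t * real l / real n))) \<longlonglongrightarrow> measure lborel Z"
  proof (rule riemann_plane[OF x t])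
    show "Z \<in> sets borel" unfolding Z_def by (rule region_measurable[OF R(1) alive])
    show "\<bar>D y s\<bar> \<le> 1" for y s by (simp add: D_def)
    show "AE p in lborel. p \<in> Z \<longrightarrow> fst p \<in> {0<..x} \<and> snd p \<in> {0<..t}"
      using off
    proof eventually_elim
      case (elim p)
      then have "fst p \<noteq> 0" using F0 by auto
      then show ?case by (cases p) (auto simp: Z_def enclosed_region_def less_le)
    qed
    show "AE p in lborel. fst p \<in> {0<..x} \<longrightarrow> snd p \<in> {0<..t} \<longrightarrow>
       (\<exists>\<delta>>0. \<forall>y' s'. fst p \<le> y' \<longrightarrow> y' < fst p + \<delta> \<longrightarrow> y' \<le> x \<longrightarrow> snd p \<le> s' \<longrightarrow> s' < snd p + \<delta> \<longrightarrow> s' \<le> t \<longrightarrow>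
          D y' s' = indicator Z p)"
      using off
    proof (eventually_elim, intro impI)
      fix p :: "real \<times> real"
      assume p: "fst p \<notin> F \<and> snd p \<notin> {m}" "fst p \<in> {0<..x}" "snd p \<in> {0<..t}"
      define y s where "y = fst p" and "s = snd p"
      have ys: "0 < y" "y \<le> x" "0 < s" "s \<le> t" "y \<notin> F" "s \<noteq> m" and ps: "p = (y, s)" using p by (auto simp: y_def s_def)
      have al: "H R S1 s \<noteq> H R S s" using alive_before[of s t R] alive ys by auto
      have "y \<notin> coords s" using ys coords_mono[of s t] by (auto simp: F_def)
      moreover have "ereal s \<noteq> meeting_time sc dsc" using ys(6) unfolding m_def by (metis real_of_ereal.simps(1))
      ultimately have "p \<in> Z \<longleftrightarrow> \<not> met s \<and> sc s \<le> y \<and> y < dsc s"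
        using region_iff[OF R(1) ys(3) al] ys ps by (auto simp: Z_def)
      then have Zp: "indicator Z p = D y s" by (simp add: D_def indicator_def)
      \<comment> \<open>Up to the next possible particle position and the next mark the counts do
        not change, so \<open>D\<close> is constant on this small quadrant.\<close>
      obtain d1 where d1: "d1 > 0" "\<forall>q\<in>F. q \<le> y \<or> y + d1 \<le> q" using gap_right[OF F] by blast
      have "finite (snd ` W x 0 t)" by simp
      then obtain d2 where d2: "d2 > 0" "\<forall>q\<in>snd ` W x 0 t. q \<le> s \<or> s + d2 \<le> q" using gap_right by blast
      have "D y' s' = indicator Z p" if q: "y \<le> y'" "y' < y + min d1 d2" "y' \<le> x" "s \<le> s'" "s' < s + min d1 d2" "s' \<le> t" for y' s'
      proof -
        have "W x s s' = {}"
        proof (rule ccontr)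
          assume "W x s s' \<noteq> {}"
          then obtain u r where ur: "(u, r) \<in> W x s s'" by auto
          then have "(u, r) \<in> W x 0 t" "s < r" "r \<le> s'" using q ys by (auto simp: W_def)
          then have "r \<le> s \<or> s + d2 \<le> r" using d2(2) by force
          then show False using \<open>s < r\<close> \<open>r \<le> s'\<close> q by linarith
        qed
        then have Hs: "H x C s' = H x C s" for C using ys q by (intro H_empty) auto
        have Hy: "H x C s \<inter> {..y'} = H x C s \<inter> {..y}" if C: "C \<subseteq> insert 0 S" for C
        proof -
          have "c \<le> y" if c: "c \<in> H x C s" "c \<le> y'" for c
          proof -
            have "c \<in> F" using H_coords[OF C, of x s] c x ys coords_mono[of s t] by (auto simp: F_def)
            then show ?thesis using d1(2) c q by force
          qed
          then show ?thesis using q by auto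
        qed
        have "D y' s' = real (card (H x S2 s' \<inter> {..y'})) - real (card (H x S s' \<inter> {..y'}))"
          unfolding D_def using q ys by (intro count_pair_cut[symmetric]) auto
        also have "\<dots> = D y s"
          unfolding D_def Hs Hy[OF sub_S0(3)] Hy[OF sub_S0(1)] using ys by (intro count_pair_cut) auto
        finally show ?thesis unfolding Zp .
      qed
      then show "\<exists>\<delta>>0. \<forall>y' s'. fst p \<le> y' \<longrightarrow> y' < fst p + \<delta> \<longrightarrow> y' \<le> x \<longrightarrow> snd p \<le> s' \<longrightarrow> s' < snd p + \<delta> \<longrightarrow> s' \<le> t \<longrightarrow>
          D y' s' = indicator Z p"
        unfolding y_def[symmetric] s_def[symmetric] using d1(1) d2(1)
        by (intro exI[of _ "min d1 d2"]) simp
    qed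
  qed
qed

end

lemma dead_limit:
  assumes x: "0 < x" and t: "0 < t"
  shows "(\<lambda>n. of_bool (lpp n n (drop_first (conf x t n S K A)) = lpp n n (conf x t n S K A)) :: real)
    \<longlonglongrightarrow> of_bool (H x S1 t = H x S t)"
proof (rule tendsto_eventually)
  show "eventually (\<lambda>n. (of_bool (lpp n n (drop_first (conf x t n S K A)) = lpp n n (conf x t n S K A)) :: real)
     = of_bool (H x S1 t = H x S t)) sequentially"
    using eventually_resolved[OF x t]
  proof eventually_elim
    case (elim n)
    then show ?case using drop_first_conf[OF x t, of n] by simp
  qed
qed

end

section \<open>Finiteness of the second class particles\<close>

text \<open>\<open>survive\<close> grows with the width, so \<open>N\<close> times the last deficit
  is at most the sum in \<open>survive_deficit\<close>. The constant 8 consists of 2 from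
  \<open>n \<le> 2 * N\<close> and 4 from \<open>S * (1 - S) \<le> s \<le> q * r\<close> and
  \<open>r \<le> 4 * (R * (1 - R))\<close>.\<close>

lemma survive_bound:
  fixes N n :: nat and r s \<epsilon> q :: real
  assumes pos: "0 < r" "0 < s" and r1: "r \<le> 1" and rs: "r * s \<le> 1" and e: "0 < \<epsilon>"
    and N: "0 < N" "n \<le> 2 * N" and q: "s \<le> q * r"
  shows "1 - survive r s N n \<le> (\<epsilon> + 8 * q / \<epsilon>) / 2"
proof -
  define A where "A = 1 - survive r s N n"
  define R where "R = r / (1 + r)"
  define S where "S = s / (1 + s)"
  have R1: "R * (1 - R) = r / (1 + r)\<^sup>2" "S * (1 - S) = s / (1 + s)\<^sup>2"
    using pos by (simp_all add: R_def S_def power2_eq_square field_simps)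
  have Rp: "0 < R * (1 - R)" unfolding R1 using pos by simp
  have "1 \<le> (1 + s)\<^sup>2" "0 < (1 + s)\<^sup>2" using pos by (simp_all add: one_le_power)
  then have "s / (1 + s)\<^sup>2 \<le> s / 1" using pos by (intro divide_left_mono) simp_all
  also have "\<dots> \<le> 4 * q * (r / 4)" using q by simp
  also have "\<dots> \<le> 4 * q * (r / (1 + r)\<^sup>2)"
  proof (intro mult_left_mono divide_left_mono)
    have "(1 + r)\<^sup>2 \<le> 2\<^sup>2" using pos r1 by (intro power_mono) auto
    then show "(1 + r)\<^sup>2 \<le> 4" by simp
    have "0 < q * r" using q pos by linarith
    then show "0 \<le> 4 * q" using pos by (simp add: zero_less_mult_iff)
  qed (use pos in auto)
  finally have Sq: "S * (1 - S) \<le> 4 * q * (R * (1 - R))" unfolding R1 .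
  have "R * (1 - R) * (N * A) \<le> R * (1 - R) * (\<Sum>k=1..N. 1 - survive r s k n)"
  proof (intro mult_left_mono)
    have "(\<Sum>k=1..N. A) \<le> (\<Sum>k=1..N. 1 - survive r s k n)"
      unfolding A_def using survive_mono[OF pos rs] by (intro sum_mono) simp
    then show "N * A \<le> (\<Sum>k=1..N. 1 - survive r s k n)" by simp
  qed (use Rp in simp)
  also have "\<dots> \<le> (\<epsilon> * (N * (R * (1 - R))) + n * (S * (1 - S)) / \<epsilon>) / 2"
    by (rule survive_deficit[OF pos rs R_def S_def e])
  also have "\<dots> \<le> (\<epsilon> * (N * (R * (1 - R))) + (2 * real N) * (4 * q * (R * (1 - R))) / \<epsilon>) / 2"
  proof -
    have "real n * (S * (1 - S)) \<le> (2 * real N) * (4 * q * (R * (1 - R)))"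
    proof (rule mult_mono[OF _ Sq])
      have "real n \<le> real (2 * N)" using N(2) by (simp only: of_nat_le_iff)
      then show "real n \<le> 2 * real N" by simp
      show "0 \<le> S * (1 - S)" unfolding R1 using pos by simp
    qed simp
    then show ?thesis using e by (intro divide_right_mono add_left_mono) auto
  qed
  also have "\<dots> = R * (1 - R) * (N * ((\<epsilon> + 8 * q / \<epsilon>) / 2))" using e by (simp add: field_simps)
  finally have "N * A \<le> N * ((\<epsilon> + 8 * q / \<epsilon>) / 2)" using Rp by (simp only: mult_le_cancel_left_pos)
  then show ?thesis using N unfolding A_def by (simp only: mult_le_cancel_left_pos of_nat_0_less_iff)
qed

text \<open>The leftmost source is found within distance \<open>j\<close> up to an exponentially small probability, and
  adding a source within that distance leaves the width \<open>j ^ 4\<close> with probability \<open>O(1 / j\<^sup>2)\<close>.\<close>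

lemma dead_bound:
  fixes j n :: nat and \<tau> t :: real
  defines "r \<equiv> \<tau> * (real j ^ 4 / n)" and "s \<equiv> \<tau> * (t / n)"
  assumes tau: "0 < \<tau>" and t: "0 < t" and j: "2 \<le> j"
    and n: "2 * j ^ 3 \<le> n" "\<tau> * real j ^ 4 \<le> n" "\<tau> * t \<le> n"
  shows "bern (grid n n) (lat r s) (\<lambda>c. of_bool (lpp n n (drop_first c) = lpp n n c)) \<le> (\<tau> * (1 + 8 * t) / 2 + 4 / \<tau>) / j"
proof -
  have jp: "0 < real j" "1 \<le> real j" using j by auto
  have n0: "0 < n" using n(1) j by (cases "n = 0") auto
  have pos: "0 < r" "0 < s" unfolding r_def s_def using tau t jp n0 by simp_all
  have r1: "r \<le> 1" and s1: "s \<le> 1" unfolding r_def s_def using n n0 by (simp_all add: divide_le_eq)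
  have rs: "r * s \<le> 1" using r1 s1 pos by (simp add: mult_le_one)
  \<comment> \<open>The \<open>n\<close> columns span the width \<open>j ^ 4\<close>, so the first
    \<open>k\<close> of them span about \<open>j\<close>.\<close>
  define k where "k = n div j ^ 3"
  have j8: "8 \<le> j ^ 3" using power_mono[OF j, of 3] by simp
  have kj: "k * j ^ 3 \<le> n" "n < (k + 1) * j ^ 3"
  proof -
    show "k * j ^ 3 \<le> n" unfolding k_def by simp
    show "n < (k + 1) * j ^ 3" using j dividend_less_div_times[of "j ^ 3" n] unfolding k_def by (simp add: algebra_simps)
  qed
  have "k * 8 \<le> n" using kj(1) j8 by (meson mult_le_mono2 order_trans)
  then have kn: "k < n" "0 < n - k" "n \<le> 2 * (n - k)" using n0 by auto
  have kjr: "real k * real j ^ 3 \<le> n" "real n \<le> (real k + 1) * real j ^ 3"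
  proof -
    have "real (k * j ^ 3) \<le> real n" "real n \<le> real ((k + 1) * j ^ 3)"
      using kj by (simp_all only: of_nat_le_iff less_imp_le)
    then show "real k * real j ^ 3 \<le> n" "real n \<le> (real k + 1) * real j ^ 3" by (simp_all add: distrib_right)
  qed
  have kr1: "k * r \<le> \<tau> * j"
  proof -
    have "k * r = \<tau> * j * (real k * real j ^ 3 / n)" by (simp add: r_def power4_eq_xxxx power3_eq_cube)
    also have "\<dots> \<le> \<tau> * j * 1" using kjr(1) tau n0 by (intro mult_left_mono) auto
    finally show ?thesis by simp
  qed
  have kr2: "\<tau> * j / 2 \<le> k * r"
  proof -
    have "real n \<le> 2 * (real k * real j ^ 3)"
    proof -
      have "real (2 * j ^ 3) \<le> real n" using n(1) by (simp only: of_nat_le_iff)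
      then show ?thesis using kjr(2) by (simp add: algebra_simps)
    qed
    then have "1 / 2 \<le> real k * real j ^ 3 / n" using n0 by (simp add: field_simps)
    then have "\<tau> * j * (1 / 2) \<le> \<tau> * j * (real k * real j ^ 3 / n)" using tau by (intro mult_left_mono) auto
    also have "\<dots> = k * r" by (simp add: r_def power4_eq_xxxx power3_eq_cube)
    finally show ?thesis by simp
  qed
  define A where "A = 1 - survive r s (n - k) n"
  have A0: "0 \<le> A" using survive_bounds(2)[OF pos rs] by (simp add: A_def)
  have A: "A \<le> (1 + 8 * t) / (2 * (real j)\<^sup>2)"
  proof -
    have "s \<le> t / real j ^ 4 * r" using jp n0 by (simp add: r_def s_def mult.commute)
    \<comment> \<open>With \<open>q = t / j ^ 4\<close>, the choice
      \<open>\<epsilon> = 1 / j\<^sup>2\<close> gives both terms of \<open>survive_bound\<close> the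
      order \<open>1 / j\<^sup>2\<close>.\<close>
    then have "A \<le> (1 / (real j)\<^sup>2 + 8 * (t / real j ^ 4) / (1 / (real j)\<^sup>2)) / 2"
      unfolding A_def using jp by (intro survive_bound[OF pos r1 rs _ kn(2,3)]) auto
    also have "8 * (t / real j ^ 4) / (1 / (real j)\<^sup>2) = 8 * t / (real j)\<^sup>2"
      using jp by (simp add: power4_eq_xxxx power2_eq_square)
    finally show ?thesis by (simp add: add_divide_distrib)
  qed
  have "bern (grid n n) (lat r s) (\<lambda>c. of_bool (lpp n n (drop_first c) = lpp n n c))
     \<le> k * (r / (1 + r)) * A + (1 - r / (1 + r)) ^ k"
    unfolding A_def by (rule drop_first_bound[OF pos rs kn(1)])
  also have "k * (r / (1 + r)) * A \<le> \<tau> * j * ((1 + 8 * t) / (2 * (real j)\<^sup>2))"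
  proof (rule mult_mono)
    have "r / (1 + r) \<le> r" using pos by (simp add: divide_le_eq algebra_simps)
    then have "k * (r / (1 + r)) \<le> k * r" by (intro mult_left_mono) auto
    then show "k * (r / (1 + r)) \<le> \<tau> * j" using kr1 by linarith
  qed (use A A0 tau in auto)
  also have "\<tau> * j * ((1 + 8 * t) / (2 * (real j)\<^sup>2)) = \<tau> * (1 + 8 * t) / 2 / j"
    using jp by (simp add: power2_eq_square)
  also have "(1 - r / (1 + r)) ^ k \<le> 4 / \<tau> / j"
  proof -
    have "(1 - r / (1 + r)) ^ k \<le> exp (- (r / (1 + r))) ^ k"
      using exp_ge_add_one_self[of "- (r / (1 + r))"] pos by (intro power_mono) (auto simp: divide_le_eq)
    also have "\<dots> = exp (- (k * (r / (1 + r))))" by (simp add: exp_of_nat_mult[symmetric])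
    also have "\<dots> \<le> exp (- (\<tau> * j / 4))"
    proof -
      have "r / 2 \<le> r / (1 + r)" using pos r1 by (intro divide_left_mono) auto
      then have "k * (r / 2) \<le> k * (r / (1 + r))" by (intro mult_left_mono) auto
      moreover have "k * (r / 2) = k * r / 2" by simp
      ultimately have "\<tau> * j / 4 \<le> k * (r / (1 + r))" using kr2 by linarith
      then show ?thesis by (simp only: exp_le_cancel_iff neg_le_iff_le)
    qed
    also have "\<dots> \<le> 1 / (\<tau> * j / 4)"
    proof -
      have u: "0 < \<tau> * j / 4" using tau jp by simp
      have "\<tau> * j / 4 \<le> exp (\<tau> * j / 4)" using exp_ge_add_one_self[of "\<tau> * j / 4"] by linarith
      then show ?thesis unfolding exp_minus inverse_eq_divide using u by (intro divide_left_mono) auto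
    qed
    finally show ?thesis by simp
  qed
  finally show ?thesis by (simp add: add_divide_distrib)
qed

context hammersley_model
begin

text \<open>The dual second class particle has left \<open>[0, R]\<close> by time \<open>t\<close>.\<close>

definition dead :: "real \<Rightarrow> real \<Rightarrow> 'w \<Rightarrow> bool" where
  "dead R t \<omega> \<longleftrightarrow> hammersley_upto R (marks (sinks \<omega>) (alpha \<omega>)) (sources \<omega> - leftmost (sources \<omega>)) t =
     hammersley_upto R (marks (sinks \<omega>) (alpha \<omega>)) (sources \<omega>) t"

lemma dead_transfer:
  assumes R: "0 < R" and t: "0 < t"
  shows "(\<lambda>\<omega>. of_bool (dead R t \<omega>) :: real) \<in> borel_measurable (completion M)"
    and "(\<lambda>n. bern (grid n n) (lat (\<tau> * (R / n)) (\<tau> * (t / n))) (\<lambda>c. of_bool (lpp n n (drop_first c) = lpp n n c)))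
       \<longlonglongrightarrow> (\<integral>\<omega>. of_bool (dead R t \<omega>) \<partial>completion M)"
proof -
  have "AE \<omega> in M. (\<lambda>n. of_bool (lpp n n (drop_first (cfg R t n \<omega>)) = lpp n n (cfg R t n \<omega>)) :: real) \<longlonglongrightarrow> of_bool (dead R t \<omega>)"
    using AE_configuration AE_conf
  proof eventually_elim
    case (elim \<omega>)
    show ?case using configuration.dead_limit[OF elim(1) R t] elim(2) by (simp add: dead_def)
  qed
  then show "(\<lambda>\<omega>. of_bool (dead R t \<omega>) :: real) \<in> borel_measurable (completion M)"
    "(\<lambda>n. bern (grid n n) (lat (\<tau> * (R / n)) (\<tau> * (t / n))) (\<lambda>c. of_bool (lpp n n (drop_first c) = lpp n n c)))
       \<longlonglongrightarrow> (\<integral>\<omega>. of_bool (dead R t \<omega>) \<partial>completion M)"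
    using transfer[OF R t, of "\<lambda>n c. of_bool (lpp n n (drop_first c) = lpp n n c)" 1 "\<lambda>\<omega>. of_bool (dead R t \<omega>)"] by auto
qed

text \<open>The windows of width \<open>j ^ 4\<close> are all dead with probability at most
  \<open>c / j\<close> for every \<open>j\<close>, hence with probability zero.\<close>

lemma AE_alive:
  assumes t: "0 < t"
  shows "AE \<omega> in M. \<exists>R>0. \<not> dead R t \<omega>"
proof -
  interpret C: prob_space "completion M" by (rule prob_space_completion)
  \<comment> \<open>\<open>Suc n\<close>, because \<open>dead_bound\<close> starts at
    \<open>j = 2\<close> and \<open>AE_exists_index\<close> at \<open>n = 1\<close>.\<close>
  define B where "B = (\<lambda>n. {\<omega>\<in>space (completion M). dead (real (Suc n) ^ 4) t \<omega>})"
  define c where "c = \<tau> * (1 + 8 * t) / 2 + 4 / \<tau>"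
  have c: "0 \<le> c" using tau t by (simp add: c_def)
  have Bm: "B n \<in> sets (completion M)" for n
  proof -
    have "B n = (\<lambda>\<omega>. of_bool (dead (real (Suc n) ^ 4) t \<omega>) :: real) -` {1} \<inter> space (completion M)"
      by (auto simp: B_def)
    then show ?thesis using measurable_sets[OF dead_transfer(1)[OF _ t], of "real (Suc n) ^ 4" "{1}"] by simp
  qed
  have Bp: "measure (completion M) (B n) \<le> c / n" if n: "n \<ge> 1" for n
  proof -
    define j where "j = Suc n"
    have R: "0 < real j ^ 4" by (simp add: j_def)
    have "measure (completion M) (B n) = (\<integral>\<omega>. indicator (B n) \<omega> \<partial>completion M)"
      using sets.sets_into_space[OF Bm[of n]] by (simp add: Int_absorb2)
    also have "\<dots> = (\<integral>\<omega>. of_bool (dead (real j ^ 4) t \<omega>) \<partial>completion M)"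
      by (intro Bochner_Integration.integral_cong refl) (simp add: B_def j_def indicator_def)
    also have "\<dots> \<le> c / j"
    proof (rule tendsto_upperbound[OF dead_transfer(2)[OF R t]])
      have "eventually (\<lambda>m. real (2 * j ^ 3) + \<tau> * real j ^ 4 + \<tau> * t < real m) sequentially"
        using filterlim_real_sequentially by (simp add: filterlim_at_top_dense)
      then show "eventually (\<lambda>m. bern (grid m m) (lat (\<tau> * (real j ^ 4 / m)) (\<tau> * (t / m))) (\<lambda>c. of_bool (lpp m m (drop_first c) = lpp m m c)) \<le> c / j) sequentially"
      proof eventually_elim
        case (elim m)
        have nn: "0 \<le> \<tau> * real j ^ 4" "0 \<le> \<tau> * t" "0 \<le> real (2 * j ^ 3)" using tau t by simp_all
        then have "real (2 * j ^ 3) \<le> real m" using elim by linarith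
        then have m: "2 * j ^ 3 \<le> m" by (simp only: of_nat_le_iff)
        have m': "\<tau> * real j ^ 4 \<le> real m" "\<tau> * t \<le> real m" using nn elim by linarith+
        have "2 \<le> j" using n by (simp add: j_def)
        then show ?case unfolding c_def by (rule dead_bound[OF tau t _ m m'])
      qed
    qed simp
    also have "\<dots> \<le> c / n" using c n by (intro divide_left_mono) (auto simp: j_def)
    finally show ?thesis .
  qed
  have "AE \<omega> in completion M. \<exists>n\<ge>1. \<omega> \<notin> B n"
    by (rule C.AE_exists_index[OF Bm Bp])
  then have "AE \<omega> in M. \<exists>n\<ge>1. \<omega> \<notin> B n" by (simp only: AE_completion_iff)
  with AE_space show ?thesis
  proof eventually_elim
    case (elim \<omega>)
    then obtain n where "\<omega> \<notin> B n" by blast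
    then have "\<not> dead (real (Suc n) ^ 4) t \<omega>" using elim(1) by (simp add: B_def)
    then show ?case by (intro exI[of _ "real (Suc n) ^ 4"]) simp
  qed
qed

section \<open>Passage to the limit in the lattice identity\<close>

abbreviation "X \<omega> \<equiv> second_class (sources \<omega>) (sinks \<omega>) (alpha \<omega>)"
abbreviation "X' \<omega> \<equiv> dual_second_class (sources \<omega>) (sinks \<omega>) (alpha \<omega>)"

lemma AE_limits:
  assumes x: "0 < x" and t: "0 < t"
  shows "AE \<omega> in M. (\<lambda>n. x / real n * (\<Sum>k=1..n. flip (1, 0) (lpp k n) (cfg x t n \<omega>))) \<longlonglongrightarrow> max (x - X \<omega> t) 0"
    and "AE \<omega> in M. (\<lambda>n. x / real n * (t / real n) * (\<Sum>k=1..n. \<Sum>l=1..n. flip (1, 1) (lpp k l) (cfg x t n \<omega>)))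
      \<longlonglongrightarrow> measure lborel (enclosed_region (X \<omega>) (X' \<omega>) \<inter> ({0..x} \<times> {0..t}))"
proof -
  have "AE \<omega> in M. (\<lambda>n. x / real n * (\<Sum>k=1..n. flip (1, 0) (lpp k n) (cfg x t n \<omega>))) \<longlonglongrightarrow> max (x - X \<omega> t) 0 \<and>
     (\<lambda>n. x / real n * (t / real n) * (\<Sum>k=1..n. \<Sum>l=1..n. flip (1, 1) (lpp k l) (cfg x t n \<omega>)))
      \<longlonglongrightarrow> measure lborel (enclosed_region (X \<omega>) (X' \<omega>) \<inter> ({0..x} \<times> {0..t}))"
    using AE_configuration AE_conf AE_alive[OF t]
  proof eventually_elim
    case (elim \<omega>)
    interpret configuration "sources \<omega>" "sinks \<omega>" "alpha \<omega>" by fact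
    obtain R where R: "0 < R" "\<not> dead R t \<omega>" using elim(3) by blast
    \<comment> \<open>The window must both contain \<open>[0, x]\<close> and still show the dual
      particle at time \<open>t\<close>.\<close>
    have al: "H (max x R) S1 t \<noteq> H (max x R) (sources \<omega>) t"
      using alive_mono[of R "max x R" t] R t by (simp add: dead_def)
    have mx: "0 < max x R" "x \<le> max x R" using x by auto
    show ?case
      using X_limit[OF x t mx al] area_limit[OF x t mx al] elim(2) by (simp add: sc_def dsc_def)
  qed
  then show "AE \<omega> in M. (\<lambda>n. x / real n * (\<Sum>k=1..n. flip (1, 0) (lpp k n) (cfg x t n \<omega>))) \<longlonglongrightarrow> max (x - X \<omega> t) 0"
    "AE \<omega> in M. (\<lambda>n. x / real n * (t / real n) * (\<Sum>k=1..n. \<Sum>l=1..n. flip (1, 1) (lpp k l) (cfg x t n \<omega>)))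
      \<longlonglongrightarrow> measure lborel (enclosed_region (X \<omega>) (X' \<omega>) \<inter> ({0..x} \<times> {0..t}))"
    by auto
qed

text \<open>\<open>bern_grid_flip\<close> places all corners \<open>(k, n)\<close> on one grid, so
  the sum of expectations is the expectation of a single bounded functional of \<open>cfg\<close>,
  whose pathwise limit is known.\<close>

lemma survive_limit:
  assumes x: "0 < x" and t: "0 < t"
  shows "(\<lambda>n. x / real n * (\<Sum>k=1..n. survive (\<tau> * (x / n)) (\<tau> * (t / n)) k n)) \<longlonglongrightarrow> (\<integral>\<omega>. max (x - X \<omega> t) 0 \<partial>completion M)"
proof -
  define F where "F = (\<lambda>n c. x / real n * (\<Sum>k=1..n. flip (1, 0) (lpp k n) c))"
  have F: "\<bar>F n c\<bar> \<le> x" for n c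
  proof -
    have "\<bar>\<Sum>k=1..n. flip (1, 0) (lpp k n) c\<bar> \<le> (\<Sum>k=1..n. 1)"
      using flip_source_bounds by (intro order_trans[OF sum_abs] sum_mono) auto
    then have "x / real n * \<bar>\<Sum>k=1..n. flip (1, 0) (lpp k n) c\<bar> \<le> x / real n * real n"
      using x by (intro mult_left_mono) auto
    also have "\<dots> \<le> x" using x by simp
    finally show ?thesis using x by (simp add: F_def abs_mult)
  qed
  have B: "bern (grid n n) P (F n) = x / real n * (\<Sum>k=1..n. bern (grid k n) P (flip (1, 0) (lpp k n)))" for n P
  proof -
    have "bern (grid n n) P (F n) = x / real n * (\<Sum>k=1..n. bern (grid n n) P (flip (1, 0) (lpp k n)))"
      unfolding F_def bern_cmult bern_sum by simp
    also have "(\<Sum>k=1..n. bern (grid n n) P (flip (1, 0) (lpp k n))) = (\<Sum>k=1..n. bern (grid k n) P (flip (1, 0) (lpp k n)))"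
      by (intro sum.cong refl bern_grid_flip[where h="\<lambda>x. x"]) (auto simp: grid_def)
    finally show ?thesis .
  qed
  have lim: "AE \<omega> in M. (\<lambda>n. F n (cfg x t n \<omega>)) \<longlonglongrightarrow> max (x - X \<omega> t) 0"
    unfolding F_def by (rule AE_limits(1)[OF x t])
  show ?thesis unfolding survive_def B[symmetric] by (rule transfer(2)[OF x t F lim])
qed

lemma enclosed_limit:
  assumes x: "0 < x" and t: "0 < t"
  shows "(\<lambda>n. x / real n * (t / real n) * (\<Sum>k=1..n. \<Sum>l=1..n. enclosed (\<tau> * (x / n)) (\<tau> * (t / n)) k l)) \<longlonglongrightarrow>
    (\<integral>\<omega>. measure lborel (enclosed_region (X \<omega>) (X' \<omega>) \<inter> ({0..x} \<times> {0..t})) \<partial>completion M)"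
proof -
  define F where "F = (\<lambda>n c. x / real n * (t / real n) * (\<Sum>k=1..n. \<Sum>l=1..n. flip (1, 1) (lpp k l) c))"
  have F: "\<bar>F n c\<bar> \<le> x * t" for n c
  proof -
    have "\<bar>\<Sum>k=1..n. \<Sum>l=1..n. flip (1, 1) (lpp k l) c\<bar> \<le> (\<Sum>k=1..n. \<Sum>l=1..n. 1)"
      by (intro order_trans[OF sum_abs] sum_mono flip_corner_bound)
    then have "x / real n * (t / real n) * \<bar>\<Sum>k=1..n. \<Sum>l=1..n. flip (1, 1) (lpp k l) c\<bar> \<le> x / real n * (t / real n) * (real n * real n)"
      using x t by (intro mult_left_mono) auto
    also have "\<dots> \<le> x * t" using x t by simp
    finally show ?thesis using x t by (simp add: F_def abs_mult)
  qed
  have B: "bern (grid n n) P (F n) = x / real n * (t / real n) * (\<Sum>k=1..n. \<Sum>l=1..n. bern (grid k l) P (flip (1, 1) (lpp k l)))" for n P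
  proof -
    have "bern (grid n n) P (F n) = x / real n * (t / real n) * (\<Sum>k=1..n. \<Sum>l=1..n. bern (grid n n) P (flip (1, 1) (lpp k l)))"
      unfolding F_def bern_cmult bern_sum by simp
    also have "(\<Sum>k=1..n. \<Sum>l=1..n. bern (grid n n) P (flip (1, 1) (lpp k l))) = (\<Sum>k=1..n. \<Sum>l=1..n. bern (grid k l) P (flip (1, 1) (lpp k l)))"
      by (intro sum.cong refl bern_grid_flip[where h="\<lambda>x. x"]) (auto simp: grid_def)
    finally show ?thesis .
  qed
  have lim: "AE \<omega> in M. (\<lambda>n. F n (cfg x t n \<omega>)) \<longlonglongrightarrow>
      measure lborel (enclosed_region (X \<omega>) (X' \<omega>) \<inter> ({0..x} \<times> {0..t}))"
    unfolding F_def by (rule AE_limits(2)[OF x t])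
  show ?thesis unfolding enclosed_def B[symmetric] by (rule transfer(2)[OF x t F lim])
qed

lemma area_identity:
  assumes x: "0 < x" and t: "0 < t"
  shows "(\<integral>\<omega>. measure lborel (enclosed_region (X \<omega>) (X' \<omega>) \<inter> ({0..x} \<times> {0..t})) \<partial>completion M) =
    (x + t) / (2 * \<tau>) - 1 / (2 * \<tau>) * ((\<integral>\<omega>. max (x - X \<omega> t) 0 \<partial>completion M) + (\<integral>\<omega>. max (t - X \<omega> x) 0 \<partial>completion M))"
    (is "?C = _ - _ * (?A + ?B)")
proof -
  define r s where "r = (\<lambda>n::nat. \<tau> * (x / n))" and "s = (\<lambda>n::nat. \<tau> * (t / n))"
  define a b c where "a = (\<lambda>n. x / real n * (\<Sum>k=1..n. survive (r n) (s n) k n))"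
    and "b = (\<lambda>n. t / real n * (\<Sum>k=1..n. survive (s n) (r n) k n))"
    and "c = (\<lambda>n. x / real n * (t / real n) * (\<Sum>k=1..n. \<Sum>l=1..n. enclosed (r n) (s n) k l))"
  \<comment> \<open>The sinks contribute \<open>survive (s n) (r n)\<close>, which is the source
    quantity of the rectangle with sides exchanged. The symmetry of the two axes is thus used on the
    lattice, and \<open>survive_limit\<close> applies with \<open>t\<close> and \<open>x\<close>
    interchanged.\<close>
  have abc: "a \<longlonglongrightarrow> ?A" "b \<longlonglongrightarrow> ?B" "c \<longlonglongrightarrow> ?C"
    unfolding a_def b_def c_def r_def s_def
    by (rule survive_limit[OF x t] survive_limit[OF t x] enclosed_limit[OF x t])+
  have lim0: "(\<lambda>n. \<tau> * (y / real n)) \<longlonglongrightarrow> 0" for y :: real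
    using tendsto_mult[OF tendsto_const[of "\<tau> * y"] lim_inverse_n] by (simp add: divide_inverse mult.assoc)
  have r0: "(\<lambda>n. 1 / (1 + r n)\<^sup>2) \<longlonglongrightarrow> 1" "(\<lambda>n. 1 / (1 + s n)\<^sup>2) \<longlonglongrightarrow> 1"
    unfolding r_def s_def by (auto intro!: tendsto_eq_intros lim0)
  have id: "\<tau> * x * (1 / (1 + r n)\<^sup>2) + \<tau> * t * (1 / (1 + s n)\<^sup>2) =
     \<tau> * a n * (1 / (1 + r n)\<^sup>2) + \<tau> * b n * (1 / (1 + s n)\<^sup>2) + 2 * \<tau>\<^sup>2 * c n" if n: "0 < n" for n
  proof -
    have pos: "0 < r n" "0 < s n" unfolding r_def s_def using tau x t n by simp_all
    have nr: "n * (r n / (1 + r n)\<^sup>2) = \<tau> * x * (1 / (1 + r n)\<^sup>2)" "n * (s n / (1 + s n)\<^sup>2) = \<tau> * t * (1 / (1 + s n)\<^sup>2)"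
      using n by (simp_all add: r_def s_def)
    have sa: "r n / (1 + r n)\<^sup>2 * (\<Sum>k=1..n. survive (r n) (s n) k n) = \<tau> * a n * (1 / (1 + r n)\<^sup>2)"
      unfolding a_def by (simp add: r_def)
    have sb: "s n / (1 + s n)\<^sup>2 * (\<Sum>k=1..n. survive (s n) (r n) k n) = \<tau> * b n * (1 / (1 + s n)\<^sup>2)"
      unfolding b_def by (simp add: s_def)
    have scc: "2 * r n * s n * (\<Sum>k=1..n. \<Sum>l=1..n. enclosed (r n) (s n) k l) = 2 * \<tau>\<^sup>2 * c n"
      unfolding c_def by (simp add: r_def s_def power2_eq_square)
    show ?thesis using lattice_identity[OF pos, of n n] unfolding nr sa sb scc .
  qed
  have "(\<lambda>n. \<tau> * x * (1 / (1 + r n)\<^sup>2) + \<tau> * t * (1 / (1 + s n)\<^sup>2)) \<longlonglongrightarrow> \<tau> * x * 1 + \<tau> * t * 1"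
    by (intro tendsto_intros r0)
  moreover have "(\<lambda>n. \<tau> * x * (1 / (1 + r n)\<^sup>2) + \<tau> * t * (1 / (1 + s n)\<^sup>2)) \<longlonglongrightarrow> \<tau> * ?A * 1 + \<tau> * ?B * 1 + 2 * \<tau>\<^sup>2 * ?C"
  proof (rule Lim_transform_eventually)
    show "(\<lambda>n. \<tau> * a n * (1 / (1 + r n)\<^sup>2) + \<tau> * b n * (1 / (1 + s n)\<^sup>2) + 2 * \<tau>\<^sup>2 * c n) \<longlonglongrightarrow> \<tau> * ?A * 1 + \<tau> * ?B * 1 + 2 * \<tau>\<^sup>2 * ?C"
      by (intro tendsto_intros r0 abc)
    show "eventually (\<lambda>n. \<tau> * a n * (1 / (1 + r n)\<^sup>2) + \<tau> * b n * (1 / (1 + s n)\<^sup>2) + 2 * \<tau>\<^sup>2 * c n =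
        \<tau> * x * (1 / (1 + r n)\<^sup>2) + \<tau> * t * (1 / (1 + s n)\<^sup>2)) sequentially"
      using eventually_gt_at_top[of "0::nat"] by eventually_elim (rule id[symmetric])
  qed
  ultimately have "\<tau> * x * 1 + \<tau> * t * 1 = \<tau> * ?A * 1 + \<tau> * ?B * 1 + 2 * \<tau>\<^sup>2 * ?C"
    by (rule LIMSEQ_unique)
  then have "\<tau> * (x + t) = \<tau> * (?A + ?B + 2 * \<tau> * ?C)" by (simp add: algebra_simps power2_eq_square)
  then have "x + t = ?A + ?B + 2 * \<tau> * ?C" using tau by simp
  then have "?C = (x + t - (?A + ?B)) / (2 * \<tau>)" using tau by (simp add: eq_divide_eq mult.commute)
  then show ?thesis by (simp add: diff_divide_distrib)
qed

end

theorem theorem3p2: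
  fixes M :: "'w measure" and \<tau> x t :: real
    and sources sinks :: "'w \<Rightarrow> real set" and alpha :: "'w \<Rightarrow> (real \<times> real) set"
  defines "X \<equiv> \<lambda>\<omega>. second_class (sources \<omega>) (sinks \<omega>) (alpha \<omega>)"
    and "X' \<equiv> \<lambda>\<omega>. dual_second_class (sources \<omega>) (sinks \<omega>) (alpha \<omega>)"
  assumes "prob_space M" and "\<tau> > 0"
    and "poisson_process M {0<..} \<tau> sources"
    and "poisson_process M {0<..} \<tau> sinks"
    and "poisson_process M ({0<..} \<times> {0<..}) (\<tau>\<^sup>2) alpha"
    and "prob_space.indep_sets M
           (\<lambda>i. [process_events M sources, process_events M sinks, process_events M alpha] ! i) {..<3}"
    and "x > 0" and "t > 0"
  shows "(\<integral>\<omega>. measure lborel (enclosed_region (X \<omega>) (X' \<omega>) \<inter> ({0..x} \<times> {0..t})) \<partial>completion M)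
         = (x + t) / (2 * \<tau>)
           - 1 / (2 * \<tau>) * ((\<integral>\<omega>. max (x - X \<omega> t) 0 \<partial>completion M)
                          + (\<integral>\<omega>. max (t - X \<omega> x) 0 \<partial>completion M))"
proof -
  interpret hammersley_model M \<tau> sources sinks alpha
    using assms(3-8) by (simp add: hammersley_model_def hammersley_model_axioms_def)
  show ?thesis unfolding assms(1,2) by (rule area_identity) fact+
qed

end
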